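(* Let $0<p,q\le\infty$ and let $\mu\in C^1(\mathbb{R}^n)$ be real-valued such that, for some $s>0$ and $\epsilon>0$, $\langle\xi\rangle^{-s}\partial_j\mu(\xi)\in W^{\infty,\infty}_{n/(\dot p\wedge\dot q)+\epsilon}$ for $j=1,\dots,n$. Then for every $\delta>sn/(\dot p\wedge\dot q)$ the operator $e^{i\mu(D)}$ is bounded from $W^{p,q}_\delta$ to $W^{p,q}$, i.e. $\|e^{i\mu(D)}f\|_{W^{p,q}}\le C\|f\|_{W^{p,q}_\delta}$ for all $f\in\mathcal S(\mathbb{R}^n)$.
   Context: Fourier transform: $\hat f(\xi)=\int f(x)e^{-2\pi i x\cdot\xi}dx$. $\langle x\rangle=(1+|x|^2)^{1/2}$. For a fixed nonzero Schwartz window $\phi$, $V_\phi f(x,\xi)=\int f(y)\overline{\phi(y-x)}e^{-2\pi i y\cdot\xi}dy$. For $0<p,q\le\infty$, $s\in\mathbb{R}$, the Wiener amalgam space $W^{p,q}_s$ consists of $f\in\mathcal S'$ with $\|f\|_{W^{p,q}_s}=\big\|\,\|V_\phi f(x,\xi)\langle\xi\rangle^s\|_{L^q_\xi}\big\|_{L^p_x}<\infty$ (independent of $\phi$ up to equivalence); $W^{p,q}=W^{p,q}_0$. $\dot p=\min\{1,p\}$, $\dot q=\min\{1,q\}$, $\dot p\wedge\dot q=\min\{\dot p,\dot q\}$. $e^{i\mu(D)}f=\mathcal F^{-1}(e^{i\mu}\hat f)$. *)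

theory Defs
  imports "HOL-Analysis.Analysis" "HOL-Probability.Essential_Supremum"
begin

definition pdiff :: "'n::finite \<Rightarrow> (real^'n \<Rightarrow> 'b::real_normed_vector) \<Rightarrow> real^'n \<Rightarrow> 'b" where
  "pdiff i f x = vector_derivative (\<lambda>t. f (x + t *\<^sub>R axis i 1)) (at 0)"

fun pdiffs :: "'n::finite list \<Rightarrow> (real^'n \<Rightarrow> 'b::real_normed_vector) \<Rightarrow> real^'n \<Rightarrow> 'b" where
  "pdiffs [] f = f"
| "pdiffs (i # is) f = pdiff i (pdiffs is f)"

definition jbr :: "real^'n::finite \<Rightarrow> real" where
  "jbr x = sqrt (1 + (norm x)^2)"

definition schwartz :: "(real^'n::finite \<Rightarrow> complex) \<Rightarrow> bool" where
  "schwartz f \<longleftrightarrow>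
     (\<forall>is i x. (\<lambda>t. pdiffs is f (x + t *\<^sub>R axis i 1)) differentiable (at 0)) \<and>
     (\<forall>is (N::nat). \<exists>C. \<forall>x. jbr x ^ N * norm (pdiffs is f x) \<le> C)"

definition fourier :: "(real^'n::finite \<Rightarrow> complex) \<Rightarrow> real^'n \<Rightarrow> complex" where
  "fourier f \<xi> = (LINT x|lborel. f x * exp (- (2 * pi * \<i> * complex_of_real (x \<bullet> \<xi>))))"

definition fmult :: "(real^'n::finite \<Rightarrow> real) \<Rightarrow> (real^'n \<Rightarrow> complex) \<Rightarrow> real^'n \<Rightarrow> complex" where
  "fmult \<mu> f x = (LINT \<xi>|lborel. exp (\<i> * complex_of_real (\<mu> \<xi>)) * fourier f \<xi>
                                  * exp (2 * pi * \<i> * complex_of_real (x \<bullet> \<xi>)))"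

definition stft :: "(real^'n::finite \<Rightarrow> complex) \<Rightarrow> (real^'n \<Rightarrow> complex) \<Rightarrow> real^'n \<Rightarrow> real^'n \<Rightarrow> complex" where
  "stft \<phi> f x \<xi> = (LINT y|lborel. f y * cnj (\<phi> (y - x)) * exp (- (2 * pi * \<i> * complex_of_real (y \<bullet> \<xi>))))"

text \<open>Real powers on ennreal (used with positive exponents only).\<close>
definition enn_powr :: "ennreal \<Rightarrow> real \<Rightarrow> ennreal" where
  "enn_powr a r = (if a = top then top else ennreal (enn2real a powr r))"

definition lpnorm :: "ennreal \<Rightarrow> (real^'n::finite \<Rightarrow> ennreal) \<Rightarrow> ennreal" where
  "lpnorm p g = (if p = top then esssup lborel g
                 else enn_powr (\<integral>\<^sup>+ x. enn_powr (g x) (enn2real p) \<partial>lborel) (1 / enn2real p))"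

definition wnorm :: "(real^'n::finite \<Rightarrow> complex) \<Rightarrow> ennreal \<Rightarrow> ennreal \<Rightarrow> real \<Rightarrow> (real^'n \<Rightarrow> complex) \<Rightarrow> ennreal" where
  "wnorm \<phi> p q s f = lpnorm p (\<lambda>x. lpnorm q (\<lambda>\<xi>. ennreal (norm (stft \<phi> f x \<xi>) * jbr \<xi> powr s)))"

definition in_W :: "(real^'n::finite \<Rightarrow> complex) \<Rightarrow> ennreal \<Rightarrow> ennreal \<Rightarrow> real \<Rightarrow> (real^'n \<Rightarrow> complex) \<Rightarrow> bool" where
  "in_W \<phi> p q s f \<longleftrightarrow>
     (\<forall>x \<xi>. integrable lborel (\<lambda>y. f y * cnj (\<phi> (y - x)) * exp (- (2 * pi * \<i> * complex_of_real (y \<bullet> \<xi>))))) \<and>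
     wnorm \<phi> p q s f < top"

end

theory Submission
  imports Defs "HOL-Probability.Characteristic_Functions"
begin

text \<open>
  On a unit ball around \<open>\<xi>\<close> the gradient of \<open>\<mu>\<close> has size \<open>\<langle>\<xi>\<rangle>\<^sup>s\<close>, so the Fourier transform of
  \<open>e\<^sup>i\<^sup>\<mu>\<close>, localised near \<open>\<xi>\<close>, lives on the scale \<open>\<langle>\<xi>\<rangle>\<^sup>s\<close>: it is \<open>O((\<langle>\<xi>\<rangle>\<^sup>s / \<langle>y\<rangle>)\<^sup>N)\<close>, where \<open>N\<close> is the
  order of decay granted by the hypothesis on \<open>\<langle>\<xi>\<rangle>\<^sup>-\<^sup>s \<partial>\<^sub>j \<mu>\<close>. One obtains this by bootstrapping the
  identity \<open>2\<pi>i y\<^sub>j F(u) = F(\<partial>\<^sub>j u)\<close> for \<open>u = e\<^sup>i\<^sup>\<mu> g\<close> with a Gaussian \<open>g\<close>. A reproducing formula then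
  dominates the short-time Fourier transform of \<open>e\<^sup>i\<^sup>\<mu>\<^sup>(\<^sup>D\<^sup>) f\<close> by the convolution, in phase space, of
  \<open>|V f(x, \<xi>)| \<langle>\<xi>\<rangle>\<^sup>s\<^sup>N\<close> with \<open>\<langle>x\<rangle>\<^sup>-\<^sup>N \<langle>\<xi>\<rangle>\<^sup>-\<^sup>L\<close>. With \<open>r = min(1, p, q)\<close> and \<open>N\<close> slightly above \<open>n / r\<close>, so that
  \<open>s N \<le> \<delta>\<close>, the case \<open>\<mu> = 0\<close> of the same bound shows that \<open>|V f|\<close> is nearly constant at unit scale;
  this allows \<open>r\<close>-th powers to be taken inside the integral. Minkowski's inequality in \<open>L\<^sup>p\<^sup>/\<^sup>r(L\<^sup>q\<^sup>/\<^sup>r)\<close>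
  concludes.
\<close>

section \<open>Weights\<close>

text \<open>The phase is only C^1, so integrating by parts N times is impossible. The substitute for
  higher derivatives is the decay of the windowed transform of the gradient: after one
  differentiation the factor \<open>e^(i mu)\<close> reappears, multiplied by functions whose
  transforms decay to order N > n, and convolution with these keeps the decay already known. Orders
  are thus gained one at a time; a non-integer N is reached from its two neighbouring integers.
  Gaussians are used because a Gaussian is a product of Gaussians with the same centre, so that each
  factor of a product gets its own window. The hypothesis comes in the given Schwartz window and the
  conclusion uses that window again, so windows are changed twice, each time by averaging over
  translates. Neither Young's nor Minkowski's inequality survives below exponent 1; both return for
  r-th powers because p/r and q/r are at least 1. Integrability of the r-th power of
  \<open><x>^(-N)\<close> requires N r > n, and N orders of decay cost a weight
  \<open><xi>^(s N)\<close>: hence the threshold s n / r for delta.\<close>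

lemma jbr_ge_1: "1 \<le> jbr x"
  by (simp add: jbr_def)

lemma jbr_pos [simp]: "0 < jbr x"
  using jbr_ge_1[of x] by linarith

lemma jbr_nonneg [simp]: "0 \<le> jbr x"
  using jbr_ge_1[of x] by linarith

lemma jbr_nz [simp]: "jbr x \<noteq> 0"
  using jbr_pos[of x] by linarith

lemma norm_le_jbr: "norm x \<le> jbr x"
  unfolding jbr_def by (rule real_le_rsqrt) simp

lemma jbr_le: "jbr x \<le> 1 + norm x"
  unfolding jbr_def by (rule real_le_lsqrt) (auto simp: power2_eq_square algebra_simps)

lemma jbr_uminus [simp]: "jbr (- x) = jbr x"
  by (simp add: jbr_def)

lemma jbr_minus_commute: "jbr (x - y) = jbr (y - x)"
  by (simp add: jbr_def norm_minus_commute)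

text \<open>\<open>jbr x\<close> is the Euclidean norm of \<open>(1, x)\<close>, so the triangle
  inequality for \<open>(1, x) + (0, y)\<close> applies.\<close>

lemma jbr_add_le: "jbr (x + y) \<le> jbr x + jbr y"
proof -
  have "jbr (x + y) = norm (1::real, x + y)" by (simp add: jbr_def norm_Pair)
  also have "\<dots> \<le> norm ((1::real, x) + (0, y))" by simp
  also have "\<dots> \<le> norm (1::real, x) + norm (0::real, y)" by (rule norm_triangle_ineq)
  also have "\<dots> \<le> jbr x + jbr y" using norm_le_jbr[of y] by (simp add: jbr_def norm_Pair)
  finally show ?thesis .
qed

lemma jbr_add_le_mult: "jbr (x + y) \<le> 2 * (jbr x * jbr y)"
proof -
  have "jbr x * 1 \<le> jbr x * jbr y" "1 * jbr y \<le> jbr x * jbr y"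
    using jbr_ge_1[of x] jbr_ge_1[of y] by (auto intro!: mult_mono)
  thus ?thesis using jbr_add_le[of x y] by linarith
qed

lemma jbr_powr_add_le:
  assumes "0 \<le> k"
  shows "jbr (x + y) powr k \<le> 2 powr k * (jbr x powr k * jbr y powr k)"
  using powr_mono2[OF assms _ jbr_add_le_mult[of x y]] by (simp add: powr_mult)

lemma jbr_powr_minus_mult_le:
  assumes "0 \<le> k"
  shows "jbr x powr (-k) * jbr y powr (-k) \<le> 2 powr k * jbr (x + y) powr (-k)"
  using jbr_powr_add_le[OF assms, of x y] by (simp add: powr_minus divide_simps mult_ac)

lemma jbr_powr_mono: "a \<le> b \<Longrightarrow> jbr x powr a \<le> jbr x powr b"
  using jbr_ge_1[of x] by (intro powr_mono) auto

lemma jbr_powr_le_1: "a \<le> 0 \<Longrightarrow> jbr x powr a \<le> 1"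
  using jbr_powr_mono[of a 0 x] by simp

lemma jbr_powr_ge_1: "0 \<le> a \<Longrightarrow> 1 \<le> jbr x powr a"
  using jbr_powr_mono[of 0 a x] by simp

text \<open>Peetre's inequality for both signs of the exponent: a weight may be re-centred at the
  price of a power of the distance. For negative \<open>k\<close> the positive case is used with
  \<open>x\<close> and \<open>a\<close> exchanged.\<close>

lemma jbr_powr_shift_le:
  "jbr x powr k \<le> 2 powr \<bar>k\<bar> * (jbr (x - a) powr \<bar>k\<bar> * jbr a powr k)"
proof (cases "0 \<le> k")
  case True
  thus ?thesis using jbr_powr_add_le[of k "x - a" a] by simp
next
  case False
  have "jbr a powr (-k) \<le> 2 powr (-k) * (jbr x powr (-k) * jbr (a - x) powr (-k))"
    using jbr_powr_add_le[of "-k" x "a - x"] False by simp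
  thus ?thesis using False
    by (simp add: powr_minus divide_simps mult_ac jbr_minus_commute[of a x])
qed

lemma jbr_powr_le_iff: "a \<le> A * jbr x powr (-K) \<longleftrightarrow> jbr x powr K * a \<le> A"
  by (simp add: powr_minus divide_simps mult_ac)

lemma jbr_mult_powr: "b = 1 + a \<Longrightarrow> jbr x * jbr x powr a = jbr x powr b"
  by (simp add: powr_add)

lemma continuous_jbr [continuous_intros]:
  "continuous_on S f \<Longrightarrow> continuous_on S (\<lambda>x. jbr (f x))"
  unfolding jbr_def by (intro continuous_intros)

lemma continuous_jbr_powr [continuous_intros]:
  "continuous_on S f \<Longrightarrow> continuous_on S (\<lambda>x. jbr (f x) powr a)"
  by (intro continuous_intros) (auto intro!: jbr_nz)

lemma measurable_jbr [measurable (raw)]: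
  "f \<in> borel_measurable M \<Longrightarrow> (\<lambda>x. jbr (f x)) \<in> borel_measurable M"
  unfolding jbr_def by measurable

section \<open>Invariance of Lebesgue integrals under translation and reflection\<close>

lemma nn_integral_lborel_translate:
  fixes f :: "'a::euclidean_space \<Rightarrow> ennreal"
  assumes [measurable]: "f \<in> borel_measurable borel"
  shows "(\<integral>\<^sup>+x. f (x + a) \<partial>lborel) = (\<integral>\<^sup>+x. f x \<partial>lborel)"
  by (subst (2) lborel_distr_plus[of a, symmetric]) (simp add: nn_integral_distr add.commute)

lemma lborel_distr_neg: "distr lborel borel uminus = (lborel :: 'a::euclidean_space measure)"
  by (subst (2) lborel_affine[of "-1" 0]) (auto simp: density_1 one_ennreal_def[symmetric])

lemma nn_integral_lborel_uminus:
  fixes f :: "'a::euclidean_space \<Rightarrow> ennreal"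
  assumes [measurable]: "f \<in> borel_measurable borel"
  shows "(\<integral>\<^sup>+x. f (- x) \<partial>lborel) = (\<integral>\<^sup>+x. f x \<partial>lborel)"
  by (subst (2) lborel_distr_neg[symmetric]) (simp add: nn_integral_distr)

lemma nn_integral_lborel_reflect:
  fixes f :: "'a::euclidean_space \<Rightarrow> ennreal"
  assumes [measurable]: "f \<in> borel_measurable borel"
  shows "(\<integral>\<^sup>+x. f (a - x) \<partial>lborel) = (\<integral>\<^sup>+x. f x \<partial>lborel)"
  using nn_integral_lborel_uminus[of "\<lambda>x. f (x + a)"] nn_integral_lborel_translate[of f a]
  by (simp add: add.commute)

text \<open>If \<open>f\<close> is not integrable, neither is its translate, and both integrals are
  \<open>0\<close> by convention; so the equality holds for every \<open>f\<close>.\<close>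

lemma integral_lborel_translate:
  fixes f :: "'a::euclidean_space \<Rightarrow> 'b::{banach,second_countable_topology}"
  shows "(LINT x|lborel. f (x + a)) = (LINT x|lborel. f x)"
    and "integrable lborel (\<lambda>x. f (x + a)) \<longleftrightarrow> integrable lborel f"
proof -
  have D: "distr lborel lborel (\<lambda>x. x + c) = (lborel :: 'a measure)" for c
    using lborel_distr_plus[of c] by (simp add: add.commute[of _ c] cong: distr_cong)
  have I: "integrable lborel (\<lambda>x. g (x + c))" if "integrable lborel g" for c and g :: "'a \<Rightarrow> 'b"
    using integrable_distr[of "\<lambda>x. x + c" lborel lborel g] that D[of c] by simp
  show A: "integrable lborel (\<lambda>x. f (x + a)) \<longleftrightarrow> integrable lborel f"
    using I[of f a] I[of "\<lambda>x. f (x + a)" "- a"] by auto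
  show "(LINT x|lborel. f (x + a)) = (LINT x|lborel. f x)"
  proof (cases "integrable lborel f")
    case True
    thus ?thesis using integral_distr[of "\<lambda>x. x + a" lborel lborel f] D[of a] by simp
  next
    case False
    thus ?thesis using A by (simp add: not_integrable_integral_eq)
  qed
qed

lemma integral_lborel_uminus:
  fixes f :: "'a::euclidean_space \<Rightarrow> 'b::{banach,second_countable_topology}"
  shows "(LINT x|lborel. f (- x)) = (LINT x|lborel. f x)"
    and "integrable lborel (\<lambda>x. f (- x)) \<longleftrightarrow> integrable lborel f"
proof -
  have D: "distr lborel lborel uminus = (lborel :: 'a measure)"
    using lborel_distr_neg by (simp cong: distr_cong)
  have I: "integrable lborel (\<lambda>x. g (- x))" if "integrable lborel g" for g :: "'a \<Rightarrow> 'b"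
    using integrable_distr[of "uminus" lborel lborel g] that D by simp
  show A: "integrable lborel (\<lambda>x. f (- x)) \<longleftrightarrow> integrable lborel f"
    using I[of f] I[of "\<lambda>x. f (- x)"] by auto
  show "(LINT x|lborel. f (- x)) = (LINT x|lborel. f x)"
  proof (cases "integrable lborel f")
    case True
    thus ?thesis using integral_distr[of "uminus" lborel lborel f] D by simp
  next
    case False
    thus ?thesis using A by (simp add: not_integrable_integral_eq)
  qed
qed

lemma integral_lborel_reflect:
  fixes f :: "'a::euclidean_space \<Rightarrow> 'b::{banach,second_countable_topology}"
  shows "(LINT x|lborel. f (a - x)) = (LINT x|lborel. f x)"
    and "integrable lborel (\<lambda>x. f (a - x)) \<longleftrightarrow> integrable lborel f"
  using integral_lborel_uminus[of "\<lambda>x. f (x + a)"] integral_lborel_translate[of f a]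
  by (simp_all add: add.commute)

section \<open>Integrability and convolution of weights\<close>

lemma ennreal_le_suminf: "h k \<le> (\<Sum>k. h k)" for h :: "nat \<Rightarrow> ennreal"
  using sum_le_suminf[of h "{k}"] by simp

text \<open>Dyadic decomposition: where \<open>2^k <= jbr x < 2^(k+1)\<close> the weight is at most
  \<open>2^(-N k)\<close> and \<open>x\<close> lies in a ball of volume proportional to
  \<open>2^(k d)\<close>. The sum over \<open>k\<close> is geometric with ratio
  \<open>2^(d - N) < 1\<close>.\<close>

lemma integrable_jbr_powr:
  assumes "real CARD('n::finite) < N"
  shows "integrable lborel (\<lambda>x::real^'n. jbr x powr (-N))"
proof -
  define d where "d = CARD('n)"
  have d: "real d < N" "DIM(real^'n) = d" using assms by (auto simp: d_def)
  have N: "0 < N" using d by linarith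
  define V where "V = unit_ball_vol (real d)"
  have V: "0 \<le> V" by (simp add: V_def)
  define t where "t k = 2 powr (-(N * real k)) * (V * (2 ^ Suc k) ^ d)" for k
  have pt: "ennreal (jbr x powr (-N)) \<le> (\<Sum>k. ennreal (2 powr (-(N * real k))) * indicator (ball 0 (2 ^ Suc k)) x)"
    for x :: "real^'n"
  proof -
    define k where "k = nat \<lfloor>log 2 (jbr x)\<rfloor>"
    have l0: "0 \<le> log 2 (jbr x)" using jbr_ge_1[of x] by simp
    have k1: "real k \<le> log 2 (jbr x)" and k2: "log 2 (jbr x) < real k + 1"
      using l0 unfolding k_def by linarith+
    have "2 powr real k \<le> jbr x" using k1 by (simp add: le_log_iff)
    hence "(2 powr real k) powr N \<le> jbr x powr N" using N by (intro powr_mono2) auto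
    hence "jbr x powr (-N) \<le> 2 powr (-(N * real k))"
      by (simp add: powr_minus powr_powr divide_simps mult_ac)
    moreover have "jbr x < 2 powr (real k + 1)" using k2 by (simp add: log_less_iff)
    hence "x \<in> ball 0 (2 ^ Suc k)" using norm_le_jbr[of x]
      by (simp add: powr_add powr_realpow)
    ultimately have "ennreal (jbr x powr (-N)) \<le> ennreal (2 powr (-(N * real k))) * indicator (ball 0 (2 ^ Suc k)) x"
      by (simp add: ennreal_leI)
    also have "\<dots> \<le> (\<Sum>k. ennreal (2 powr (-(N * real k))) * indicator (ball 0 (2 ^ Suc k)) x)"
      by (rule ennreal_le_suminf)
    finally show ?thesis .
  qed
  have t: "t k = V * 2 ^ d * (2 powr (real d - N)) ^ k" for k
  proof -
    have "(2 powr (real d - N)) ^ k = 2 powr ((real d - N) * real k)"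
      by (simp add: powr_powr flip: powr_realpow)
    also have "\<dots> = 2 powr (real k * real d) * 2 powr (-(N * real k))"
      by (simp add: algebra_simps flip: powr_add)
    also have "2 powr (real k * real d) = (2 ^ k) ^ d"
      by (simp add: powr_realpow flip: of_nat_mult power_mult)
    finally show ?thesis by (simp add: t_def power_mult_distrib)
  qed
  have "summable t" unfolding t using d
    by (intro summable_mult summable_geometric) (simp add: powr_less_one)
  moreover have t0: "0 \<le> t k" for k unfolding t_def using V by simp
  ultimately have fin: "(\<Sum>k. ennreal (t k)) < top"
    by (simp add: suminf_ennreal2 less_top)
  have "(\<integral>\<^sup>+(x::real^'n). ennreal (jbr x powr (-N)) \<partial>lborel)
      \<le> (\<integral>\<^sup>+(x::real^'n). (\<Sum>k. ennreal (2 powr (-(N * real k))) * indicator (ball 0 (2 ^ Suc k)) x) \<partial>lborel)"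
    by (intro nn_integral_mono pt)
  also have "\<dots> = (\<Sum>k. \<integral>\<^sup>+(x::real^'n). ennreal (2 powr (-(N * real k))) * indicator (ball 0 (2 ^ Suc k)) x \<partial>lborel)"
    by (intro nn_integral_suminf borel_measurable_times_ennreal borel_measurable_const borel_measurable_indicator)
      (simp only: sets_lborel borel_open open_ball)
  also have "\<dots> = (\<Sum>k. ennreal (t k))"
  proof (rule suminf_cong)
    fix k
    have "(\<integral>\<^sup>+(x::real^'n). ennreal (2 powr (-(N * real k))) * indicator (ball 0 (2 ^ Suc k)) x \<partial>lborel)
        = ennreal (2 powr (-(N * real k))) * emeasure lborel (ball (0::real^'n) (2 ^ Suc k))"
      by (rule nn_integral_cmult_indicator) simp
    also have "emeasure lborel (ball (0::real^'n) (2 ^ Suc k)) = ennreal (V * (2 ^ Suc k) ^ d)"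
      using emeasure_ball[of "2 ^ Suc k" "0::real^'n"] d(2) by (simp add: V_def)
    finally show "(\<integral>\<^sup>+(x::real^'n). ennreal (2 powr (-(N * real k))) * indicator (ball 0 (2 ^ Suc k)) x \<partial>lborel)
        = ennreal (t k)"
      by (simp only: t_def ennreal_mult'[symmetric] powr_ge_zero)
  qed
  finally have "(\<integral>\<^sup>+(x::real^'n). ennreal (jbr x powr (-N)) \<partial>lborel) < top" using fin by simp
  thus ?thesis by (intro integrableI_bounded) auto
qed

lemma integrable_jbr_powr_diff:
  fixes a :: "real^'n::finite"
  assumes "real CARD('n) < N"
  shows "integrable lborel (\<lambda>x. jbr (x - a) powr (-N))"
    and "integrable lborel (\<lambda>x. jbr (a - x) powr (-N))"
  using integral_lborel_translate(2)[of "\<lambda>x. jbr x powr (-N)" "-a"]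
    integrable_jbr_powr[OF assms] jbr_minus_commute[of a]
  by simp_all

text \<open>Either \<open>jbr z\<close> or \<open>jbr (y - z)\<close> is at least half of
  \<open>jbr y\<close>. The larger one pays for the factor \<open>jbr y powr (-k)\<close>, and what
  remains is bounded by an integrable weight of order \<open>N\<close> centred at \<open>0\<close>
  or at \<open>y\<close>.\<close>

lemma integral_jbr_powr_conv:
  assumes N: "real CARD('n::finite) < N" and k: "0 \<le> k" "k \<le> N"
  obtains C where "0 < C"
    "\<And>y::real^'n. integrable lborel (\<lambda>z. jbr z powr (-N) * jbr (y - z) powr (-k))"
    "\<And>y::real^'n. (LINT z|lborel. jbr z powr (-N) * jbr (y - z) powr (-k)) \<le> C * jbr y powr (-k)"
proof -
  let ?I = "LINT z::real^'n|lborel. jbr z powr (-N)"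
  note int = integrable_jbr_powr[OF N]
  have I0: "0 \<le> ?I" by (intro integral_nonneg_AE) auto
  have A: "integrable lborel (\<lambda>z. jbr z powr (-N) * jbr (y - z) powr (-k))" for y :: "real^'n"
    by (rule Bochner_Integration.integrable_bound[OF int])
      (use k in \<open>auto simp: abs_mult intro!: mult_left_le jbr_powr_le_1\<close>)
  have pt: "jbr y powr k * (jbr z powr (-N) * jbr (y - z) powr (-k)) \<le>
      2 powr k * (2 * jbr z powr (-N) + jbr (y - z) powr (-N))" for y z :: "real^'n"
  proof -
    define a b where "a = jbr z" and "b = jbr (y - z)"
    have ab: "1 \<le> a" "1 \<le> b" by (auto simp: a_def b_def jbr_ge_1)
    have "jbr y \<le> a + b" using jbr_add_le[of z "y - z"] by (simp add: a_def b_def)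
    also have "a + b \<le> 2 * max a b" by simp
    finally have "jbr y powr k \<le> (2 * max a b) powr k" using k by (intro powr_mono2) auto
    also have "\<dots> = 2 powr k * (max a b powr k)" using ab by (simp add: powr_mult)
    finally have 1: "jbr y powr k \<le> 2 powr k * (max a b powr k)" .
    have 2: "max a b powr k * (a powr (-N) * b powr (-k)) \<le> 2 * a powr (-N) + b powr (-N)"
    proof (cases "a \<le> b")
      case True
      hence "max a b powr k * (a powr (-N) * b powr (-k)) = a powr (-N) * b powr (k + -k)"
        by (simp only: max_def if_True powr_add) (simp add: mult_ac)
      also have "\<dots> = a powr (-N)" using ab by simp
      finally show ?thesis using powr_ge_zero[of a "-N"] powr_ge_zero[of b "-N"] by linarith
    next
      case False
      hence "max a b powr k * (a powr (-N) * b powr (-k)) = a powr (k - N) * b powr (-k)"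
        by (simp add: max_def powr_diff powr_minus divide_simps)
      \<comment> \<open>Here \<open>k <= N\<close> enters: since \<open>b < a\<close>, the surplus
        \<open>a powr (k - N)\<close> can be traded for the same power of \<open>b\<close>.\<close>
      also have "\<dots> \<le> b powr (k - N) * b powr (-k)"
        using False ab k by (intro mult_right_mono powr_mono2') auto
      also have "\<dots> = b powr (-N)" by (simp flip: powr_add)
      finally show ?thesis using powr_ge_zero[of a "-N"] by linarith
    qed
    have "jbr y powr k * (a powr (-N) * b powr (-k)) \<le> 2 powr k * (max a b powr k) * (a powr (-N) * b powr (-k))"
      using 1 by (intro mult_right_mono) auto
    also have "\<dots> \<le> 2 powr k * (2 * a powr (-N) + b powr (-N))"
      using 2 by (simp add: mult.assoc)
    finally show ?thesis by (simp add: a_def b_def)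
  qed
  \<comment> \<open>The summand \<open>1\<close> secures a positive constant without showing that
    \<open>?I\<close> is positive; later constants contain it for the same reason.\<close>
  have B: "(LINT z|lborel. jbr z powr (-N) * jbr (y - z) powr (-k)) \<le> (2 powr k * (3 * ?I) + 1) * jbr y powr (-k)" for y :: "real^'n"
  proof -
    have "jbr y powr k * (LINT z|lborel. jbr z powr (-N) * jbr (y - z) powr (-k))
       = (LINT z|lborel. jbr y powr k * (jbr z powr (-N) * jbr (y - z) powr (-k)))" by simp
    also have "\<dots> \<le> (LINT z|lborel. 2 powr k * (2 * jbr z powr (-N) + jbr (y - z) powr (-N)))"
      by (intro integral_mono integrable_mult_right A int pt Bochner_Integration.integrable_add
          integrable_jbr_powr_diff[OF N])
    also have "\<dots> = 2 powr k * (2 * ?I + (LINT z|lborel. jbr (y - z) powr (-N)))"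
      using int integrable_jbr_powr_diff[OF N, of y] by simp
    also have "(LINT z|lborel. jbr (y - z) powr (-N)) = ?I"
      by (rule integral_lborel_reflect)
    finally have "jbr y powr k * (LINT z|lborel. jbr z powr (-N) * jbr (y - z) powr (-k)) \<le> 2 powr k * (3 * ?I) + 1"
      by simp
    thus ?thesis by (simp add: powr_minus divide_simps mult_ac)
  qed
  show thesis by (rule that[of "2 powr k * (3 * ?I) + 1"]) (use A B I0 in \<open>auto intro!: add_nonneg_pos\<close>)
qed

section \<open>The Fourier transform\<close>

definition chr :: "real \<Rightarrow> complex" where
  "chr t = cis (2 * pi * t)"

lemma chr_add: "chr (a + b) = chr a * chr b"
  by (simp add: chr_def cis_mult distrib_left)

lemma chr_diff: "chr (a - b) = chr a * chr (- b)"
  using chr_add[of a "- b"] by simp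

lemma chr_0 [simp]: "chr 0 = 1"
  by (simp add: chr_def)

lemma chr_mult_uminus [simp]: "chr t * chr (- t) = 1" "chr (- t) * chr t = 1"
  by (simp_all flip: chr_add)

lemma norm_chr [simp]: "norm (chr t) = 1"
  by (simp add: chr_def)

lemma cnj_chr: "cnj (chr t) = chr (- t)"
  by (simp add: chr_def cis_cnj)

lemma continuous_chr [continuous_intros]:
  "continuous_on S f \<Longrightarrow> continuous_on S (\<lambda>x. chr (f x))"
  unfolding chr_def by (intro continuous_intros)

lemma measurable_chr [measurable (raw)]:
  "f \<in> borel_measurable M \<Longrightarrow> (\<lambda>x. chr (f x)) \<in> borel_measurable M"
proof -
  have "chr \<in> borel_measurable borel"
    by (intro borel_measurable_continuous_onI continuous_intros)
  thus "f \<in> borel_measurable M \<Longrightarrow> (\<lambda>x. chr (f x)) \<in> borel_measurable M"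
    by measurable
qed

lemma measurable_cnj [measurable (raw)]:
  "f \<in> borel_measurable M \<Longrightarrow> (\<lambda>x. cnj (f x)) \<in> borel_measurable M"
  by (rule measurable_compose[OF _ borel_measurable_continuous_onI]) (auto intro!: continuous_intros)

lemma exp_eq_chr: "exp (2 * complex_of_real pi * \<i> * complex_of_real t) = chr t"
  by (simp add: chr_def cis_conv_exp mult_ac)

lemma exp_uminus_eq_chr: "exp (- (2 * complex_of_real pi * \<i> * complex_of_real t)) = chr (- t)"
  using exp_eq_chr[of "-t"] by simp

lemma fourier_chr: "fourier f \<xi> = (LINT x|lborel. f x * chr (- (x \<bullet> \<xi>)))"
  by (simp add: fourier_def exp_uminus_eq_chr)

lemma stft_eq_fourier: "stft \<phi> f x \<xi> = fourier (\<lambda>y. f y * cnj (\<phi> (y - x))) \<xi>"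
  by (simp add: stft_def fourier_def)

text \<open>The inverse transform is the forward transform at the reflected point, so one transform
  serves for both directions.\<close>

lemma fmult_eq_fourier:
  "fmult \<mu> f x = fourier (\<lambda>\<xi>. exp (\<i> * complex_of_real (\<mu> \<xi>)) * fourier f \<xi>) (- x)"
  by (simp add: fmult_def fourier_chr exp_eq_chr inner_commute)

lemma integrable_mult_chr:
  assumes [measurable]: "g \<in> borel_measurable M" and u: "integrable M u"
  shows "integrable M (\<lambda>x. u x * chr (g x))"
proof -
  have [measurable]: "u \<in> borel_measurable M" using u by simp
  show ?thesis by (rule Bochner_Integration.integrable_bound[OF u]) (auto simp: norm_mult)
qed

lemma norm_fourier_le: "norm (fourier u \<xi>) \<le> (LINT x|lborel. norm (u x))"
proof -
  have "norm (fourier u \<xi>) \<le> (LINT x|lborel. norm (u x * chr (- (x \<bullet> \<xi>))))"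
    unfolding fourier_chr by (rule integral_norm_bound)
  thus ?thesis by (simp add: norm_mult)
qed

lemma continuous_fourier:
  assumes u: "integrable lborel u"
  shows "continuous_on UNIV (fourier u)"
proof -
  have [measurable]: "u \<in> borel_measurable borel" using u by simp
  have "(\<lambda>k. fourier u (X k)) \<longlonglongrightarrow> fourier u \<xi>" if X: "X \<longlonglongrightarrow> \<xi>" for X \<xi>
    unfolding fourier_chr
  proof (rule integral_dominated_convergence[where w = "\<lambda>x. norm (u x)"])
    show "AE x in lborel. (\<lambda>k. u x * chr (- (x \<bullet> X k))) \<longlonglongrightarrow> u x * chr (- (x \<bullet> \<xi>))"
    proof (intro AE_I2 tendsto_mult tendsto_const)
      fix x :: "real^'a"
      have "isCont chr t" for t
        using continuous_chr[OF continuous_on_id, of UNIV] by (simp add: continuous_on_eq_continuous_at)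
      moreover have "(\<lambda>k. - (x \<bullet> X k)) \<longlonglongrightarrow> - (x \<bullet> \<xi>)" by (intro tendsto_intros X)
      ultimately show "(\<lambda>k. chr (- (x \<bullet> X k))) \<longlonglongrightarrow> chr (- (x \<bullet> \<xi>))"
        by (rule isCont_tendsto_compose)
    qed
  qed (use u in \<open>auto simp: norm_mult\<close>)
  thus ?thesis
    unfolding continuous_on_sequentially by (auto simp: comp_def)
qed

lemma measurable_fourier [measurable (raw)]:
  assumes [measurable]: "g \<in> M \<rightarrow>\<^sub>M borel" and [measurable]: "(\<lambda>(z, x). u z x) \<in> borel_measurable (M \<Otimes>\<^sub>M borel)"
  shows "(\<lambda>z. fourier (u z) (g z)) \<in> borel_measurable M"
  unfolding fourier_chr by measurable

lemma fourier_translate: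
  "fourier (\<lambda>x. u (x - a)) \<xi> = chr (- (a \<bullet> \<xi>)) * fourier u \<xi>"
proof -
  have "fourier (\<lambda>x. u (x - a)) \<xi> = (LINT x|lborel. u (x + a - a) * chr (- ((x + a) \<bullet> \<xi>)))"
    unfolding fourier_chr by (rule integral_lborel_translate(1)[symmetric])
  also have "\<dots> = (LINT x|lborel. chr (- (a \<bullet> \<xi>)) * (u x * chr (- (x \<bullet> \<xi>))))"
    by (intro Bochner_Integration.integral_cong) (auto simp: inner_add_left chr_add chr_diff mult_ac)
  finally show ?thesis by (simp add: fourier_chr)
qed

lemma fourier_modulate:
  "fourier (\<lambda>x. u x * chr (x \<bullet> a)) \<xi> = fourier u (\<xi> - a)"
  unfolding fourier_chr by (simp add: inner_diff_right mult.assoc flip: chr_add)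

lemma fourier_cnj: "fourier (\<lambda>x. cnj (u x)) \<xi> = cnj (fourier u (- \<xi>))"
proof -
  have "cnj (fourier u (- \<xi>)) = (LINT x|lborel. cnj (u x * chr (- (x \<bullet> - \<xi>))))"
    unfolding fourier_chr by (rule Bochner_Integration.integral_cnj[symmetric])
  thus ?thesis by (simp add: fourier_chr cnj_chr)
qed

lemma fourier_cmult: "fourier (\<lambda>x. c * u x) \<xi> = c * fourier u \<xi>"
  by (simp add: fourier_chr mult.assoc)

lemma fourier_add:
  assumes "integrable lborel u" "integrable lborel v"
  shows "fourier (\<lambda>x. u x + v x) \<xi> = fourier u \<xi> + fourier v \<xi>"
  unfolding fourier_chr distrib_right
  by (intro Bochner_Integration.integral_add integrable_mult_chr assms) auto

section \<open>Exchange of integrals and the multiplication formula\<close>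

lemma integrable_pair_mult:
  fixes u :: "'a::euclidean_space \<Rightarrow> complex" and v :: "'b::euclidean_space \<Rightarrow> complex"
  assumes u: "integrable lborel u" and v: "integrable lborel v"
    and [measurable]: "(\<lambda>(x, y). K x y) \<in> borel_measurable (lborel \<Otimes>\<^sub>M lborel)"
    and K: "\<And>x y. norm (K x y) \<le> B"
  shows "integrable (lborel \<Otimes>\<^sub>M lborel) (\<lambda>(x, y). u x * v y * K x y)"
proof -
  have [measurable]: "u \<in> borel_measurable borel" "v \<in> borel_measurable borel" using u v by simp_all
  have K1 [measurable]: "(\<lambda>y. K x y) \<in> borel_measurable borel" for x
    using measurable_compose[OF measurable_Pair1', OF _ assms(3), of x] by (simp add: comp_def)
  have I: "integrable (lborel \<Otimes>\<^sub>M lborel) (\<lambda>(x, y). u x * v y)"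
  proof (rule lborel_pair.Fubini_integrable)
    show "(\<lambda>(x, y). u x * v y) \<in> borel_measurable (lborel \<Otimes>\<^sub>M lborel)" by measurable
    have "integrable lborel (\<lambda>x. norm (u x) * (LINT y|lborel. norm (v y)))"
      using u by simp
    thus "integrable lborel (\<lambda>x. LINT y|lborel. norm (case (x, y) of (x, y) \<Rightarrow> u x * v y))"
      by (simp add: norm_mult)
    show "AE x in lborel. integrable lborel (\<lambda>y. case (x, y) of (x, y) \<Rightarrow> u x * v y)"
      using v by simp
  qed
  have I': "integrable (lborel \<Otimes>\<^sub>M lborel) (\<lambda>z. B *\<^sub>R (case z of (x, y) \<Rightarrow> u x * v y))"
    using I by (rule integrable_scaleR_right)
  show ?thesis
  proof (rule Bochner_Integration.integrable_bound[OF I'])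
    show "(\<lambda>(x, y). u x * v y * K x y) \<in> borel_measurable (lborel \<Otimes>\<^sub>M lborel)" by measurable
    have "0 \<le> B" using K norm_ge_zero order_trans by blast
    thus "AE z in lborel \<Otimes>\<^sub>M lborel. norm (case z of (x, y) \<Rightarrow> u x * v y * K x y)
        \<le> norm (B *\<^sub>R (case z of (x, y) \<Rightarrow> u x * v y))"
      using K by (auto simp: norm_mult mult.commute[of B] intro!: AE_I2 mult_left_mono)
  qed
qed

text \<open>Serves the exchanges in which two independent integrable functions are coupled by a
  bounded kernel; in the applications the kernel is a character.\<close>

lemma fubini_kernel:
  fixes u :: "'a::euclidean_space \<Rightarrow> complex" and v :: "'b::euclidean_space \<Rightarrow> complex"
  assumes u: "integrable lborel u" and v: "integrable lborel v"
    and K1: "(\<lambda>(x, y). K x y) \<in> borel_measurable (lborel \<Otimes>\<^sub>M lborel)"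
    and K2: "\<And>x y. norm (K x y) \<le> B"
  shows "(LINT x|lborel. u x * (LINT y|lborel. v y * K x y))
       = (LINT y|lborel. v y * (LINT x|lborel. u x * K x y))"
proof -
  have "(LINT x|lborel. LINT y|lborel. u x * v y * K x y) = (LINT y|lborel. LINT x|lborel. u x * v y * K x y)"
    by (rule lborel_pair.Fubini_integral[symmetric, OF integrable_pair_mult[OF assms]])
  moreover have "(LINT y|lborel. u x * v y * K x y) = u x * (LINT y|lborel. v y * K x y)" for x
    by (simp add: mult.assoc)
  moreover have "(LINT x|lborel. u x * v y * K x y) = v y * (LINT x|lborel. u x * K x y)" for y
  proof -
    have "(LINT x|lborel. u x * v y * K x y) = (LINT x|lborel. v y * (u x * K x y))"
      by (intro Bochner_Integration.integral_cong refl) (simp add: mult_ac)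
    thus ?thesis by simp
  qed
  ultimately show ?thesis by simp
qed

lemma fourier_multiplication_formula:
  assumes "integrable lborel u" "integrable lborel v"
  shows "(LINT x|lborel. u x * fourier v x) = (LINT x|lborel. v x * fourier u x)"
  unfolding fourier_chr
  using fubini_kernel[OF assms, of "\<lambda>x y. chr (- (y \<bullet> x))" 1] by (simp add: inner_commute)

section \<open>Gaussians and their transforms\<close>

text \<open>Unnormalised and with a free parameter, so that Gaussians with a common centre multiply
  by adding parameters (\<open>gauss_mult\<close>). This is what distributes one window over several
  factors.\<close>

definition gauss :: "real \<Rightarrow> real^'n::finite \<Rightarrow> real" where
  "gauss b x = exp (- (b * (norm x)\<^sup>2))"

abbreviation cgauss :: "real \<Rightarrow> real^'n::finite \<Rightarrow> complex" where
  "cgauss b x \<equiv> complex_of_real (gauss b x)"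

lemma gauss_pos [simp]: "0 < gauss b x"
  by (simp add: gauss_def)

lemma gauss_nonneg [simp]: "0 \<le> gauss b x"
  by (simp add: gauss_def)

lemma gauss_le_1: "0 \<le> b \<Longrightarrow> gauss b x \<le> 1"
  by (simp add: gauss_def)

lemma gauss_mult: "gauss a x * gauss b x = gauss (a + b) x"
  by (simp add: gauss_def distrib_right flip: exp_add)

lemma continuous_gauss [continuous_intros]:
  "continuous_on S f \<Longrightarrow> continuous_on S (\<lambda>x. gauss b (f x))"
  unfolding gauss_def by (intro continuous_intros)

lemma measurable_gauss [measurable (raw)]:
  "f \<in> borel_measurable M \<Longrightarrow> (\<lambda>x. gauss b (f x)) \<in> borel_measurable M"
  unfolding gauss_def by measurable

text \<open>With \<open>t = (jbr x)^2\<close>, raising \<open>b t / m <= exp (b t / m)\<close> to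
  the power \<open>m\<close> gives \<open>t^m <= (m / b)^m exp (b t)\<close>. The factor
  \<open>exp b\<close> in the constant accounts for \<open>t = 1 + (norm x)^2\<close>.\<close>

lemma gauss_le_jbr:
  assumes b: "0 < b"
  obtains C where "0 < C" "\<And>x::real^'n::finite. gauss b x \<le> C * jbr x powr (-K)"
proof -
  define m where "m = nat \<lceil>\<bar>K\<bar>\<rceil> + 1"
  have m: "0 < m" "K \<le> real (2 * m)" by (auto simp: m_def) linarith
  have "gauss b x \<le> ((real m / b) ^ m * exp b) * jbr x powr (-K)" for x :: "real^'n"
  proof -
    define t where "t = 1 + (norm x)\<^sup>2"
    have t: "1 \<le> t" "t = (jbr x)\<^sup>2" by (auto simp: t_def jbr_def)
    have "t ^ m = (real m / b) ^ m * (b * t / real m) ^ m" using b m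
      by (simp flip: power_mult_distrib)
    also have "\<dots> \<le> (real m / b) ^ m * exp (b * t / real m) ^ m"
    proof (intro mult_left_mono power_mono)
      show "b * t / real m \<le> exp (b * t / real m)"
        using exp_ge_add_one_self[of "b * t / real m"] by linarith
    qed (use b t(1) in auto)
    also have "exp (b * t / real m) ^ m = exp (b * t)" using m by (simp flip: exp_of_nat_mult)
    finally have 1: "t ^ m \<le> (real m / b) ^ m * exp (b * t)" .
    have "jbr x powr K \<le> jbr x powr real (2 * m)" by (rule jbr_powr_mono[OF m(2)])
    also have "\<dots> = jbr x ^ (2 * m)" by (rule powr_realpow) simp
    also have "\<dots> = t ^ m" by (simp only: t power_mult)
    finally have "jbr x powr K * gauss b x \<le> ((real m / b) ^ m * exp (b * t)) * gauss b x"
      using 1 by (intro mult_right_mono) auto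
    also have "\<dots> = (real m / b) ^ m * exp b"
      by (simp add: gauss_def t_def algebra_simps flip: exp_add)
    finally show ?thesis by (simp only: jbr_powr_le_iff)
  qed
  moreover have "0 < (real m / b) ^ m * exp b" using b m by simp
  ultimately show thesis using that by blast
qed

lemma integrable_gauss:
  assumes b: "0 < b"
  shows "integrable lborel (gauss b :: real^'n::finite \<Rightarrow> real)"
proof -
  obtain C where C: "0 < C" "\<And>x::real^'n. gauss b x \<le> C * jbr x powr (-(real CARD('n) + 1))"
    using gauss_le_jbr[OF b] by blast
  have "integrable lborel (\<lambda>x::real^'n. C * jbr x powr (-(real CARD('n) + 1)))"
    by (intro integrable_mult_right integrable_jbr_powr) simp
  thus ?thesis
    by (rule Bochner_Integration.integrable_bound) (use C in auto)
qed

text \<open>The substitution \<open>x = c t\<close> with \<open>c = sqrt (2 b)\<close> turns the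
  integral into the characteristic function of the standard normal distribution at
  \<open>- 2 pi y / c\<close>.\<close>

lemma fourier_gauss_1dim:
  fixes b y :: real
  assumes b: "0 < b"
  shows "(LINT t|lborel. complex_of_real (exp (- (b * t\<^sup>2))) * chr (- (t * y)))
       = complex_of_real (sqrt (pi / b) * exp (- (pi\<^sup>2 / b * y\<^sup>2)))" (is ?A)
    and "integrable lborel (\<lambda>t. complex_of_real (exp (- (b * t\<^sup>2))) * chr (- (t * y)))" (is ?B)
proof -
  define c where "c = sqrt (2 * b)"
  have c: "0 < c" "c\<^sup>2 = 2 * b" using b by (auto simp: c_def)
  define \<tau> where "\<tau> = - (2 * pi * y / c)"
  define f :: "real \<Rightarrow> complex" where "f x = std_normal_density x *\<^sub>R iexp (\<tau> * x)" for x
  have "char std_normal_distribution \<tau> = (LINT x|lborel. f x)"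
    unfolding char_def f_def by (subst integral_density) (auto simp: normal_density_nonneg)
  hence 1: "(LINT x|lborel. f x) = complex_of_real (exp (- (\<tau>\<^sup>2) / 2))"
    by (simp add: char_std_normal_distribution)
  have f: "f (0 + c * t) = complex_of_real (1 / sqrt (2 * pi)) * (complex_of_real (exp (- (b * t\<^sup>2))) * chr (- (t * y)))" for t
  proof -
    have "\<tau> * (c * t) = 2 * pi * (- (t * y))" using c by (simp add: \<tau>_def)
    hence "iexp (\<tau> * (c * t)) = chr (- (t * y))" by (simp add: chr_def cis_conv_exp)
    moreover have "- ((c * t)\<^sup>2 / 2) = - (b * t\<^sup>2)" using c by (simp add: power_mult_distrib)
    ultimately show ?thesis
      by (simp add: f_def normal_density_def scaleR_conv_of_real mult_ac)
  qed
  have int: "integrable lborel f"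
    unfolding f_def
    by (rule Bochner_Integration.integrable_bound[OF integrable_normal_density[of 1 0]])
      auto
  have "integrable lborel (\<lambda>t. f (0 + c * t))" using lborel_integrable_real_affine[OF int, of c 0] c by simp
  hence "integrable lborel (\<lambda>t. complex_of_real (sqrt (2 * pi)) * f (0 + c * t))"
    by (rule integrable_mult_right)
  moreover have "complex_of_real (sqrt (2 * pi)) * f (0 + c * t)
      = complex_of_real (exp (- (b * t\<^sup>2))) * chr (- (t * y))" for t
  proof -
    have "complex_of_real k * (complex_of_real (1 / k) * X) = X" if "k \<noteq> 0" for k X
      using that by simp
    from this[of "sqrt (2 * pi)"] show ?thesis unfolding f by simp
  qed
  ultimately show ?B by simp
  have "(LINT x|lborel. f x) = c *\<^sub>R (LINT t|lborel. f (0 + c * t))"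
    using lborel_integral_real_affine[of c f 0] c by simp
  also have "\<dots> = complex_of_real (c / sqrt (2 * pi)) * (LINT t|lborel. complex_of_real (exp (- (b * t\<^sup>2))) * chr (- (t * y)))"
    unfolding f by (simp add: scaleR_conv_of_real)
  finally have "(LINT t|lborel. complex_of_real (exp (- (b * t\<^sup>2))) * chr (- (t * y)))
      = complex_of_real (sqrt (2 * pi) / c * exp (- (\<tau>\<^sup>2) / 2))"
    unfolding 1 using c by (simp add: field_simps)
  also have "sqrt (2 * pi) / c = sqrt (pi / b)" using b
    by (simp add: c_def flip: real_sqrt_divide)
  also have "- (\<tau>\<^sup>2) / 2 = - (pi\<^sup>2 / b * y\<^sup>2)" using c b
    by (simp add: \<tau>_def power_divide power_mult_distrib field_simps)
  finally show ?A .
qed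

lemma integral_lborel_prod_Basis:
  fixes f :: "'a::euclidean_space \<Rightarrow> real \<Rightarrow> complex"
  assumes "\<And>b. b \<in> Basis \<Longrightarrow> integrable lborel (f b)"
  shows "(LINT x|lborel. (\<Prod>b\<in>Basis. f b (x \<bullet> b))) = (\<Prod>b\<in>Basis. (LINT t|lborel. f b t))"
proof -
  interpret product_sigma_finite "\<lambda>_::'a. lborel :: real measure" by standard
  have [measurable]: "b \<in> Basis \<Longrightarrow> f b \<in> borel_measurable borel" for b
    using assms[of b] by simp
  have "(LINT x|lborel. (\<Prod>b\<in>Basis. f b (x \<bullet> b)))
      = (LINT g|Pi\<^sub>M Basis (\<lambda>_. lborel). (\<Prod>b\<in>Basis. f b ((\<Sum>b\<in>Basis. g b *\<^sub>R b) \<bullet> b)))"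
    by (subst lborel_eq, subst integral_distr) auto
  also have "\<dots> = (LINT g|Pi\<^sub>M Basis (\<lambda>_. lborel). (\<Prod>b\<in>Basis. f b (g b)))"
    by (intro Bochner_Integration.integral_cong refl prod.cong) simp
  also have "\<dots> = (\<Prod>b\<in>Basis. (LINT t|lborel. f b t))"
    by (rule product_integral_prod) (use assms in auto)
  finally show ?thesis .
qed

lemma fourier_gauss:
  fixes \<xi> :: "real^'n::finite"
  assumes b: "0 < b"
  shows "fourier (\<lambda>x. cgauss b x) \<xi>
       = complex_of_real (sqrt (pi / b) ^ CARD('n) * gauss (pi\<^sup>2 / b) \<xi>)"
proof -
  define f where "f e t = complex_of_real (exp (- (b * t\<^sup>2))) * chr (- (t * (\<xi> \<bullet> e)))" for e t
  have sq: "(norm x)\<^sup>2 = (\<Sum>e\<in>Basis. (x \<bullet> e)\<^sup>2)" for x :: "real^'n"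
    unfolding power2_norm_eq_inner by (subst euclidean_inner) (simp add: power2_eq_square)
  have chr_sum: "chr (\<Sum>e\<in>A. g e) = (\<Prod>e\<in>A. chr (g e))" if "finite A" for g :: "real^'n \<Rightarrow> real" and A
    using that by (induction A rule: finite_induct) (auto simp: chr_add)
  have "cgauss b x * chr (- (x \<bullet> \<xi>)) = (\<Prod>e\<in>Basis. f e (x \<bullet> e))" for x
  proof -
    have "cgauss b x = (\<Prod>e\<in>Basis. complex_of_real (exp (- (b * (x \<bullet> e)\<^sup>2))))"
      unfolding gauss_def sq of_real_prod[symmetric]
      by (simp add: exp_sum[symmetric] sum_distrib_left sum_negf)
    moreover have "chr (- (x \<bullet> \<xi>)) = (\<Prod>e\<in>Basis. chr (- ((x \<bullet> e) * (\<xi> \<bullet> e))))"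
      unfolding euclidean_inner[of x \<xi>] sum_negf[symmetric] by (rule chr_sum) simp
    ultimately show ?thesis by (simp add: f_def prod.distrib)
  qed
  hence "fourier (\<lambda>x. cgauss b x) \<xi> = (LINT x|lborel. (\<Prod>e\<in>Basis. f e (x \<bullet> e)))"
    by (simp add: fourier_chr)
  also have "\<dots> = (\<Prod>e\<in>Basis. (LINT t|lborel. f e t))"
    by (rule integral_lborel_prod_Basis) (unfold f_def, rule fourier_gauss_1dim(2)[OF b])
  also have "\<dots> = (\<Prod>e\<in>(Basis::(real^'n) set). complex_of_real (sqrt (pi / b) * exp (- (pi\<^sup>2 / b * (\<xi> \<bullet> e)\<^sup>2))))"
    unfolding f_def fourier_gauss_1dim(1)[OF b] ..
  also have "\<dots> = complex_of_real (sqrt (pi / b) ^ CARD('n) * gauss (pi\<^sup>2 / b) \<xi>)"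
    unfolding gauss_def sq of_real_prod[symmetric]
    by (simp add: prod.distrib exp_sum[symmetric] sum_distrib_left sum_negf)
  finally show ?thesis .
qed

section \<open>Approximate identities and Fourier inversion\<close>

lemma integral_lborel_scale:
  fixes f :: "'a::euclidean_space \<Rightarrow> 'b::{banach,second_countable_topology}"
  assumes [measurable]: "f \<in> borel_measurable borel" and c: "0 < c"
  shows "(LINT x|lborel. f x) = c ^ DIM('a) *\<^sub>R (LINT x|lborel. f (c *\<^sub>R x))"
  by (subst lborel_affine[of c 0]) (use c in \<open>simp_all add: integral_density integral_distr\<close>)

lemma integral_gauss:
  assumes b: "0 < b"
  shows "(LINT x|lborel. gauss b (x::real^'n::finite)) = sqrt (pi / b) ^ CARD('n)"
proof -
  have "complex_of_real (LINT x|lborel. gauss b (x::real^'n)) = fourier (\<lambda>x::real^'n. cgauss b x) 0"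
    by (simp add: fourier_chr)
  also have "\<dots> = complex_of_real (sqrt (pi / b) ^ CARD('n))"
    unfolding fourier_gauss[OF b] by (simp add: gauss_def)
  finally show ?thesis by (simp only: of_real_eq_iff)
qed

text \<open>The kernel is a Gaussian of integral \<open>1\<close> and width proportional to
  \<open>1 / (k + 1)\<close>. As \<open>u\<close> is integrable and continuous, it is bounded on
  bounded sets but possibly not globally; hence the split at the unit ball. Outside, the kernel
  tends to \<open>0\<close> uniformly and \<open>u\<close> is integrated; inside, rescaling gives a
  fixed Gaussian and dominated convergence.\<close>

lemma gauss_approx_identity:
  fixes u :: "real^'n::finite \<Rightarrow> complex"
  assumes u: "integrable lborel u" and cont: "continuous_on UNIV u"
  shows "(\<lambda>k. LINT y|lborel. u (x + y) * complex_of_real ((real (Suc k) / sqrt pi) ^ CARD('n) * gauss ((real (Suc k))\<^sup>2) y))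
      \<longlonglongrightarrow> u x"
proof -
  let ?n = "CARD('n)"
  define H where "H k y = (real (Suc k) / sqrt pi) ^ ?n * gauss ((real (Suc k))\<^sup>2) y" for k and y :: "real^'n"
  have [measurable]: "u \<in> borel_measurable borel"
    using cont by (rule borel_measurable_continuous_onI)
  have Hm [measurable]: "H k \<in> borel_measurable borel" for k
    unfolding H_def by measurable
  have H0: "0 \<le> H k y" for k y by (simp add: H_def)
  have uint: "integrable lborel (\<lambda>y. u (x + y))"
    using integral_lborel_translate(2)[of u x] u by (simp add: add.commute)
  define B where "B = cball (0::real^'n) 1"
  have Bm [measurable]: "B \<in> sets borel" by (simp add: B_def)
  have uH: "integrable lborel (\<lambda>y. u (x + y) * complex_of_real (H k y))" for k
  proof (rule Bochner_Integration.integrable_bound)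
    show "integrable lborel (\<lambda>y. (real (Suc k) / sqrt pi) ^ ?n *\<^sub>R u (x + y))"
      using uint by (rule integrable_scaleR_right)
    have le: "H k y \<le> (real (Suc k) / sqrt pi) ^ ?n" for y
      unfolding H_def by (intro mult_left_le gauss_le_1) auto
    thus "AE y in lborel. norm (u (x + y) * complex_of_real (H k y)) \<le> norm ((real (Suc k) / sqrt pi) ^ ?n *\<^sub>R u (x + y))"
    proof (intro AE_I2)
      fix y
      show "norm (u (x + y) * complex_of_real (H k y)) \<le> norm ((real (Suc k) / sqrt pi) ^ ?n *\<^sub>R u (x + y))"
        using mult_right_mono[OF le[of y], of "norm (u (x + y))"] H0[of k y]
        by (simp add: norm_mult mult.commute del: of_nat_Suc)
    qed
  qed measurable
  \<comment> \<open>For \<open>1 <= norm y\<close> the exponent is at least \<open>k + 1\<close>,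
    because \<open>(k + 1)^2 >= k + 1\<close>; the exponential then beats the normalising power
    \<open>(k + 1)^n\<close>.\<close>
  have H_out: "H k y \<le> (1 / sqrt pi) ^ ?n * (real (Suc k) ^ ?n / exp (real (Suc k)))" if "y \<notin> B" for k y
  proof -
    have "1 \<le> (norm y)\<^sup>2" using that by (simp add: B_def)
    hence "real (Suc k) * 1 \<le> (real (Suc k))\<^sup>2 * (norm y)\<^sup>2"
      by (intro mult_mono) (auto simp: power2_eq_square mult_le_cancel_left1)
    hence "gauss ((real (Suc k))\<^sup>2) y \<le> exp (- real (Suc k))"
      by (simp add: gauss_def)
    hence "H k y \<le> (real (Suc k) / sqrt pi) ^ ?n * exp (- real (Suc k))"
      unfolding H_def by (intro mult_left_mono) auto
    thus ?thesis by (simp add: power_divide exp_minus divide_simps del: of_nat_Suc)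
  qed
  have out: "(\<lambda>k. LINT y|lborel. indicator (- B) y *\<^sub>R (u (x + y) * complex_of_real (H k y))) \<longlonglongrightarrow> 0"
  proof (rule Lim_null_comparison)
    define c where "c k = (1 / sqrt pi) ^ ?n * (real (Suc k) ^ ?n / exp (real (Suc k)))" for k
    have c0: "0 \<le> c k" for k by (simp add: c_def)
    show "\<forall>\<^sub>F k in sequentially. norm (LINT y|lborel. indicator (- B) y *\<^sub>R (u (x + y) * complex_of_real (H k y)))
        \<le> c k * (LINT y|lborel. norm (u (x + y)))"
    proof (intro always_eventually allI)
      fix k
      have "norm (LINT y|lborel. indicator (- B) y *\<^sub>R (u (x + y) * complex_of_real (H k y)))
          \<le> (LINT y|lborel. c k * norm (u (x + y)))"
      proof (rule Bochner_Integration.integral_norm_bound_integral)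
        show "integrable lborel (\<lambda>y. indicator (- B) y *\<^sub>R (u (x + y) * complex_of_real (H k y)))"
          by (intro integrable_mult_indicator uH) simp
        show "integrable lborel (\<lambda>y. c k * norm (u (x + y)))" using uint by simp
        show "norm (indicator (- B) y *\<^sub>R (u (x + y) * complex_of_real (H k y))) \<le> c k * norm (u (x + y))" for y
        proof (cases "y \<in> B")
          case False
          hence "H k y \<le> c k" using H_out[of y k] by (simp add: c_def)
          from mult_right_mono[OF this, of "norm (u (x + y))"] show ?thesis
            using False H0[of k y] by (simp add: norm_mult mult.commute)
        qed (simp add: c0)
      qed
      thus "norm (LINT y|lborel. indicator (- B) y *\<^sub>R (u (x + y) * complex_of_real (H k y)))
        \<le> c k * (LINT y|lborel. norm (u (x + y)))" by simp
    qed
    have "(\<lambda>k. real (Suc k) ^ ?n / exp (real (Suc k))) \<longlonglongrightarrow> 0"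
      by (rule filterlim_compose[OF tendsto_power_div_exp_0])
        (rule filterlim_compose[OF filterlim_real_sequentially filterlim_Suc])
    hence "c \<longlonglongrightarrow> 0" unfolding c_def by (rule tendsto_mult_right_zero)
    thus "(\<lambda>k. c k * (LINT y|lborel. norm (u (x + y)))) \<longlonglongrightarrow> 0"
      by (rule tendsto_mult_left_zero)
  qed
  have "bounded (u ` cball x 1)"
    by (intro compact_imp_bounded compact_continuous_image continuous_on_subset[OF cont]) auto
  then obtain M where "\<forall>z\<in>u ` cball x 1. norm z \<le> M" unfolding bounded_iff by blast
  hence M: "\<And>y. y \<in> cball x 1 \<Longrightarrow> norm (u y) \<le> M" by blast
  have M0: "0 \<le> M" using M[of x] norm_ge_zero[of "u x"] by (simp del: norm_ge_zero)
  have ins: "(\<lambda>k. LINT y|lborel. indicator B y *\<^sub>R (u (x + y) * complex_of_real (H k y))) \<longlonglongrightarrow> u x"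
  proof -
    \<comment> \<open>The integrand after the substitution \<open>y = z / (k + 1)\<close>; the
      Jacobian cancels the power \<open>(k + 1)^n\<close> of the kernel.\<close>
    define W where "W k z = indicator B ((1 / real (Suc k)) *\<^sub>R z) *\<^sub>R (u (x + (1 / real (Suc k)) *\<^sub>R z) * complex_of_real ((1 / sqrt pi) ^ ?n * gauss 1 z))"
      for k and z :: "real^'n"
    have eq: "(LINT y|lborel. indicator B y *\<^sub>R (u (x + y) * complex_of_real (H k y))) = (LINT z|lborel. W k z)" for k
    proof -
      have "(LINT y|lborel. indicator B y *\<^sub>R (u (x + y) * complex_of_real (H k y)))
        = (1 / real (Suc k)) ^ ?n *\<^sub>R (LINT z|lborel. indicator B ((1 / real (Suc k)) *\<^sub>R z) *\<^sub>R
            (u (x + (1 / real (Suc k)) *\<^sub>R z) * complex_of_real (H k ((1 / real (Suc k)) *\<^sub>R z))))"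
        by (subst integral_lborel_scale[of _ "1 / real (Suc k)"]) (auto simp del: of_nat_Suc)
      also have "\<dots> = (LINT z|lborel. W k z)"
      proof -
        have "gauss ((real (Suc k))\<^sup>2) ((1 / real (Suc k)) *\<^sub>R z) = gauss 1 z" for z :: "real^'n"
          by (simp add: gauss_def power_mult_distrib power_divide del: of_nat_Suc)
        hence HW: "(1 / real (Suc k)) ^ ?n * H k ((1 / real (Suc k)) *\<^sub>R z) = (1 / sqrt pi) ^ ?n * gauss 1 z" for z
          by (simp add: H_def power_divide del: of_nat_Suc)
        have "a *\<^sub>R (i *\<^sub>R (v * complex_of_real h)) = i *\<^sub>R (v * complex_of_real (a * h))" for a i h v
          by (simp add: scaleR_conv_of_real mult_ac)
        hence "(1 / real (Suc k)) ^ ?n *\<^sub>R (indicator B ((1 / real (Suc k)) *\<^sub>R z) *\<^sub>R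
            (u (x + (1 / real (Suc k)) *\<^sub>R z) * complex_of_real (H k ((1 / real (Suc k)) *\<^sub>R z)))) = W k z" for z
          unfolding W_def HW[symmetric] by simp
        thus ?thesis by (simp flip: integral_scaleR_right del: of_nat_Suc)
      qed
      finally show ?thesis .
    qed
    have "(\<lambda>k. LINT z|lborel. W k z) \<longlonglongrightarrow> (LINT z|lborel. u x * complex_of_real ((1 / sqrt pi) ^ ?n * gauss 1 (z::real^'n)))"
    proof (rule integral_dominated_convergence[where w = "\<lambda>z. M * ((1 / sqrt pi) ^ ?n * gauss 1 z)"])
      show "integrable lborel (\<lambda>z::real^'n. M * ((1 / sqrt pi) ^ ?n * gauss 1 z))"
        by (intro integrable_mult_right integrable_gauss) simp
      show "AE z in lborel. (\<lambda>k. W k z) \<longlonglongrightarrow> u x * complex_of_real ((1 / sqrt pi) ^ ?n * gauss 1 z)"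
      proof (rule AE_I2)
        fix z :: "real^'n"
        have "(\<lambda>k. 1 / real (Suc k)) \<longlonglongrightarrow> 0"
          using LIMSEQ_inverse_real_of_nat by (simp add: inverse_eq_divide)
        hence z0: "(\<lambda>k. (1 / real (Suc k)) *\<^sub>R z) \<longlonglongrightarrow> 0 *\<^sub>R z" by (intro tendsto_scaleR tendsto_const)
        hence "(\<lambda>k. x + (1 / real (Suc k)) *\<^sub>R z) \<longlonglongrightarrow> x + 0 *\<^sub>R z" by (intro tendsto_add tendsto_const)
        moreover have "isCont u (x + 0 *\<^sub>R z)" using cont by (simp add: continuous_on_eq_continuous_at)
        ultimately have "(\<lambda>k. u (x + (1 / real (Suc k)) *\<^sub>R z)) \<longlonglongrightarrow> u (x + 0 *\<^sub>R z)"
          by (rule isCont_tendsto_compose[rotated])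
        hence l: "(\<lambda>k. u (x + (1 / real (Suc k)) *\<^sub>R z) * complex_of_real ((1 / sqrt pi) ^ ?n * gauss 1 z))
            \<longlonglongrightarrow> u x * complex_of_real ((1 / sqrt pi) ^ ?n * gauss 1 z)"
          by (intro tendsto_mult tendsto_const) simp
        have "\<forall>\<^sub>F k in sequentially. dist ((1 / real (Suc k)) *\<^sub>R z) (0 *\<^sub>R z) < 1"
          using z0 by (rule tendstoD) simp
        hence "\<forall>\<^sub>F k in sequentially. u (x + (1 / real (Suc k)) *\<^sub>R z) * complex_of_real ((1 / sqrt pi) ^ ?n * gauss 1 z) = W k z"
          by eventually_elim (simp add: W_def B_def del: of_nat_Suc)
        thus "(\<lambda>k. W k z) \<longlonglongrightarrow> u x * complex_of_real ((1 / sqrt pi) ^ ?n * gauss 1 z)"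
          using l by (rule Lim_transform_eventually[rotated])
      qed
      show "AE z in lborel. norm (W k z) \<le> M * ((1 / sqrt pi) ^ ?n * gauss 1 z)" for k
      proof (rule AE_I2)
        fix z :: "real^'n"
        show "norm (W k z) \<le> M * ((1 / sqrt pi) ^ ?n * gauss 1 z)"
        proof (cases "(1 / real (Suc k)) *\<^sub>R z \<in> B")
          case True
          hence "norm (u (x + (1 / real (Suc k)) *\<^sub>R z)) \<le> M"
            by (intro M) (simp add: B_def dist_norm del: of_nat_Suc)
          moreover have nn: "0 \<le> (1 / sqrt pi) ^ ?n * gauss 1 z" by simp
          ultimately show ?thesis using mult_right_mono[OF _ nn] True
            by (simp only: W_def norm_scaleR norm_mult[of "u _"] norm_of_real abs_of_nonneg[OF nn]
                indicator_simps abs_one mult_1)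
        next
          case False
          thus ?thesis using M0 by (simp add: W_def del: of_nat_Suc)
        qed
      qed
    qed (auto simp: W_def)
    also have "(LINT z|lborel. u x * complex_of_real ((1 / sqrt pi) ^ ?n * gauss 1 (z::real^'n))) = u x"
    proof -
      have "(LINT z|lborel. u x * complex_of_real ((1 / sqrt pi) ^ ?n * gauss 1 (z::real^'n)))
        = u x * complex_of_real ((1 / sqrt pi) ^ ?n * (LINT z|lborel. gauss 1 (z::real^'n)))"
        by (simp only: integral_mult_right_zero integral_complex_of_real)
      thus ?thesis by (simp add: integral_gauss power_divide)
    qed
    finally show ?thesis unfolding eq .
  qed
  have "(\<lambda>k. (LINT y|lborel. indicator B y *\<^sub>R (u (x + y) * complex_of_real (H k y)))
      + (LINT y|lborel. indicator (- B) y *\<^sub>R (u (x + y) * complex_of_real (H k y)))) \<longlonglongrightarrow> u x + 0"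
    by (rule tendsto_add[OF ins out])
  moreover have "(LINT y|lborel. indicator B y *\<^sub>R (u (x + y) * complex_of_real (H k y)))
      + (LINT y|lborel. indicator (- B) y *\<^sub>R (u (x + y) * complex_of_real (H k y)))
      = (LINT y|lborel. u (x + y) * complex_of_real (H k y))" for k
  proof -
    have "(LINT y|lborel. indicator B y *\<^sub>R (u (x + y) * complex_of_real (H k y)))
      + (LINT y|lborel. indicator (- B) y *\<^sub>R (u (x + y) * complex_of_real (H k y)))
      = (LINT y|lborel. indicator B y *\<^sub>R (u (x + y) * complex_of_real (H k y))
          + indicator (- B) y *\<^sub>R (u (x + y) * complex_of_real (H k y)))"
      by (intro Bochner_Integration.integral_add[symmetric] integrable_mult_indicator uH) auto
    thus ?thesis by (auto intro!: Bochner_Integration.integral_cong simp: indicator_def elim!: trans)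
  qed
  ultimately show ?thesis by (simp add: H_def)
qed

text \<open>The multiplication formula is applied to \<open>u\<close> and a damped character
  \<open>g k\<close>. On the side of \<open>u\<close> the transform of \<open>g k\<close> is an
  approximate identity at \<open>x\<close>; on the side of \<open>fourier u\<close> the damping
  disappears in the limit.\<close>

theorem fourier_inversion:
  fixes u :: "real^'n::finite \<Rightarrow> complex"
  assumes u: "integrable lborel u" and cont: "continuous_on UNIV u"
    and Fu: "integrable lborel (fourier u)"
  shows "fourier (fourier u) (- x) = u x"
proof -
  let ?n = "CARD('n)"
  \<comment> \<open>Chosen so that \<open>pi^2 / b k = (k + 1)^2\<close>: the transform of
    \<open>g k\<close> is then exactly the kernel of \<open>gauss_approx_identity\<close>, centred
    at \<open>x\<close>.\<close>
  define b where "b k = pi\<^sup>2 / (real (Suc k))\<^sup>2" for k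
  have b: "0 < b k" for k by (simp add: b_def)
  define g where "g k \<xi> = cgauss (b k) \<xi> * chr (x \<bullet> \<xi>)" for k and \<xi> :: "real^'n"
  have gint: "integrable lborel (g k)" for k
    unfolding g_def using integrable_gauss[OF b[of k]]
    by (intro integrable_mult_chr) (auto simp: integrable_of_real)
  have Fg: "fourier (g k) y = complex_of_real ((real (Suc k) / sqrt pi) ^ ?n * gauss ((real (Suc k))\<^sup>2) (y - x))" for k y
  proof -
    have "fourier (g k) y = fourier (\<lambda>\<xi>. cgauss (b k) \<xi>) (y - x)"
      unfolding g_def inner_commute[of x] by (rule fourier_modulate)
    also have "\<dots> = complex_of_real (sqrt (pi / b k) ^ ?n * gauss (pi\<^sup>2 / b k) (y - x))"
      by (rule fourier_gauss[OF b])
    also have "pi\<^sup>2 / b k = (real (Suc k))\<^sup>2" by (simp add: b_def)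
    also have "sqrt (pi / b k) = real (Suc k) / sqrt pi"
    proof -
      have "pi / b k = (real (Suc k))\<^sup>2 / pi" by (simp add: b_def power2_eq_square divide_simps)
      thus ?thesis by (simp add: real_sqrt_divide)
    qed
    finally show ?thesis .
  qed
  have "(LINT y|lborel. u (x + y) * complex_of_real ((real (Suc k) / sqrt pi) ^ ?n * gauss ((real (Suc k))\<^sup>2) y))
      = (LINT \<xi>|lborel. g k \<xi> * fourier u \<xi>)" for k
  proof -
    have "(LINT \<xi>|lborel. g k \<xi> * fourier u \<xi>) = (LINT y|lborel. u y * fourier (g k) y)"
      by (rule fourier_multiplication_formula[OF gint u])
    also have "\<dots> = (LINT y|lborel. u (y + x) * fourier (g k) (y + x))"
      by (rule integral_lborel_translate(1)[symmetric])
    finally show ?thesis unfolding Fg by (simp add: add.commute)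
  qed
  hence 1: "(\<lambda>k. LINT \<xi>|lborel. g k \<xi> * fourier u \<xi>) \<longlonglongrightarrow> u x"
    using gauss_approx_identity[OF u cont, of x] by simp
  have [measurable]: "fourier u \<in> borel_measurable borel" using Fu by simp
  have 2: "(\<lambda>k. LINT \<xi>|lborel. g k \<xi> * fourier u \<xi>) \<longlonglongrightarrow> (LINT \<xi>|lborel. fourier u \<xi> * chr (- (\<xi> \<bullet> (- x))))"
  proof (rule integral_dominated_convergence[where w = "\<lambda>\<xi>. norm (fourier u \<xi>)"])
    show "AE \<xi> in lborel. (\<lambda>k. g k \<xi> * fourier u \<xi>) \<longlonglongrightarrow> fourier u \<xi> * chr (- (\<xi> \<bullet> (- x)))"
    proof (rule AE_I2)
      fix \<xi> :: "real^'n"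
      have "(\<lambda>k. 1 / real (Suc k)) \<longlonglongrightarrow> 0"
        using LIMSEQ_inverse_real_of_nat by (simp add: inverse_eq_divide)
      hence "(\<lambda>k. exp (- (pi\<^sup>2 * (1 / real (Suc k))\<^sup>2 * (norm \<xi>)\<^sup>2))) \<longlonglongrightarrow> exp (- (pi\<^sup>2 * 0\<^sup>2 * (norm \<xi>)\<^sup>2))"
        by (intro tendsto_intros)
      hence "(\<lambda>k. gauss (b k) \<xi>) \<longlonglongrightarrow> 1" by (simp add: gauss_def b_def power_divide)
      hence "(\<lambda>k. g k \<xi> * fourier u \<xi>) \<longlonglongrightarrow> complex_of_real 1 * chr (x \<bullet> \<xi>) * fourier u \<xi>"
        unfolding g_def by (intro tendsto_mult tendsto_const tendsto_of_real)
      thus "(\<lambda>k. g k \<xi> * fourier u \<xi>) \<longlonglongrightarrow> fourier u \<xi> * chr (- (\<xi> \<bullet> (- x)))"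
        by (simp add: inner_commute mult_ac)
    qed
    show "AE \<xi> in lborel. norm (g k \<xi> * fourier u \<xi>) \<le> norm (fourier u \<xi>)" for k
      using b[of k] by (auto intro!: AE_I2 mult_left_le_one_le gauss_le_1 simp: g_def norm_mult)
  qed (use Fu in \<open>auto simp: g_def\<close>)
  show ?thesis using LIMSEQ_unique[OF 2 1] by (simp only: fourier_chr[of "fourier u"])
qed

text \<open>\<open>v\<close> is replaced by its inversion integral and the integrals are exchanged.
  The asymmetry of the hypotheses is deliberate: \<open>u\<close> may be any integrable function,
  and the inversion is carried out on the well-behaved factor.\<close>

lemma fourier_mult:
  fixes u v :: "real^'n::finite \<Rightarrow> complex"
  assumes u: "integrable lborel u" and v: "integrable lborel v" "continuous_on UNIV v"
    and Fv: "integrable lborel (fourier v)"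
  shows "fourier (\<lambda>x. u x * v x) y = (LINT z|lborel. fourier v z * fourier u (y - z))"
proof -
  have u': "integrable lborel (\<lambda>x. u x * chr (- (x \<bullet> y)))"
    by (intro integrable_mult_chr u) simp
  have [measurable]: "u \<in> borel_measurable borel" using u by simp
  have "fourier (\<lambda>x. u x * v x) y = (LINT x|lborel. (u x * chr (- (x \<bullet> y))) * (LINT z|lborel. fourier v z * chr (x \<bullet> z)))"
  proof -
    have "(LINT z|lborel. fourier v z * chr (x \<bullet> z)) = v x" for x
      using fourier_inversion[OF v Fv, of x] by (simp add: fourier_chr[of "fourier v"] inner_commute)
    thus ?thesis by (simp add: fourier_chr mult_ac)
  qed
  also have "\<dots> = (LINT z|lborel. fourier v z * (LINT x|lborel. (u x * chr (- (x \<bullet> y))) * chr (x \<bullet> z)))"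
    by (rule fubini_kernel[OF u' Fv, where B = 1]) auto
  also have "\<dots> = (LINT z|lborel. fourier v z * fourier u (y - z))"
    by (simp add: fourier_chr[of u] mult.assoc inner_diff_right flip: chr_add)
  finally show ?thesis .
qed

section \<open>Differentiation along coordinate lines\<close>

lemma has_vector_derivative_quotient:
  assumes "(f has_vector_derivative D) (at 0)"
  shows "((\<lambda>s. (f s - f 0) /\<^sub>R s) \<longlongrightarrow> D) (at 0)"
proof -
  have "((\<lambda>h. norm (f h - f 0 - h *\<^sub>R D) / norm h) \<longlongrightarrow> 0) (at 0)"
    using assms unfolding has_vector_derivative_def has_derivative_at by simp
  moreover have "\<forall>\<^sub>F h in at 0. norm (f h - f 0 - h *\<^sub>R D) / norm h = norm ((f h - f 0) /\<^sub>R h - D)"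
  proof (rule eventually_at_filter[THEN iffD2], intro always_eventually allI impI)
    fix h :: real assume "h \<noteq> 0"
    hence "(f h - f 0) /\<^sub>R h - D = (f h - f 0 - h *\<^sub>R D) /\<^sub>R h"
      by (simp add: scaleR_diff_right)
    thus "norm (f h - f 0 - h *\<^sub>R D) / norm h = norm ((f h - f 0) /\<^sub>R h - D)"
      by (simp add: divide_inverse mult.commute)
  qed
  ultimately have "((\<lambda>h. norm ((f h - f 0) /\<^sub>R h - D)) \<longlongrightarrow> 0) (at 0)"
    by (rule Lim_transform_eventually)
  thus ?thesis by (rule LIM_zero_cancel[OF tendsto_norm_zero_cancel])
qed

lemma has_vector_derivative_line:
  fixes u :: "'a::real_normed_vector \<Rightarrow> 'b::real_normed_vector"
  assumes "\<And>x. ((\<lambda>t. u (x + t *\<^sub>R e)) has_vector_derivative u' x) (at 0)"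
  shows "((\<lambda>t. u (x + t *\<^sub>R e)) has_vector_derivative u' (x + s *\<^sub>R e)) (at s)"
proof -
  have "((\<lambda>t. t - s) has_vector_derivative 1) (at s)"
    by (auto intro!: derivative_eq_intros)
  moreover have "((\<lambda>t. u ((x + s *\<^sub>R e) + t *\<^sub>R e)) has_vector_derivative u' (x + s *\<^sub>R e)) (at (s - s))"
    using assms[of "x + s *\<^sub>R e"] by simp
  ultimately have "((\<lambda>t. u ((x + s *\<^sub>R e) + t *\<^sub>R e)) \<circ> (\<lambda>t. t - s) has_vector_derivative 1 *\<^sub>R u' (x + s *\<^sub>R e)) (at s)"
    by (rule vector_diff_chain_at)
  moreover have "(\<lambda>t. u ((x + s *\<^sub>R e) + t *\<^sub>R e)) \<circ> (\<lambda>t. t - s) = (\<lambda>t. u (x + t *\<^sub>R e))"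
    by (auto simp: scaleR_diff_left)
  ultimately show ?thesis by simp
qed

text \<open>Difference quotients take the place of integration by parts. By translation the
  transform of \<open>Q k\<close> is \<open>(chr (t k * (y $ j)) - 1) / t k\<close> times that of
  \<open>u\<close>, and both sides converge. The mean value inequality and the decay of
  \<open>u'\<close> supply the dominating function.\<close>

lemma fourier_deriv:
  fixes u u' :: "real^'n::finite \<Rightarrow> complex"
  assumes der: "\<And>x. ((\<lambda>t. u (x + t *\<^sub>R axis j 1)) has_vector_derivative u' x) (at 0)"
    and cont: "continuous_on UNIV u" "continuous_on UNIV u'"
    and K: "real CARD('n) < K"
    and u: "\<And>x. norm (u x) \<le> C * jbr x powr (-K)"
    and u': "\<And>x. norm (u' x) \<le> C * jbr x powr (-K)"
  shows "fourier u' y = complex_of_real (2 * pi * (y $ j)) * \<i> * fourier u y"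
proof -
  define e :: "real^'n" where "e = axis j 1"
  have e: "norm e = 1" by (simp add: e_def)
  have K0: "0 \<le> K" using K by linarith
  have [measurable]: "u \<in> borel_measurable borel" "u' \<in> borel_measurable borel"
    using cont by (auto intro: borel_measurable_continuous_onI)
  have C0: "0 \<le> C"
    using order_trans[OF norm_ge_zero u[of 0]] by (simp add: zero_le_mult_iff)
  have Cint: "integrable lborel (\<lambda>x::real^'n. c * jbr x powr (-K))" for c
    by (intro integrable_mult_right integrable_jbr_powr K)
  have uint: "integrable lborel u"
    by (rule Bochner_Integration.integrable_bound[OF Cint[of C]])
      (use u C0 in \<open>auto simp: abs_mult\<close>)
  have der_s: "((\<lambda>t. u (x + t *\<^sub>R e)) has_vector_derivative u' (x + s *\<^sub>R e)) (at s)" for x s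
    by (rule has_vector_derivative_line[OF der[folded e_def]])
  define t where "t k = 1 / real (Suc k)" for k
  have t: "0 < t k" "t k \<le> 1" for k by (auto simp: t_def divide_simps)
  have "(\<lambda>k. 1 / real (Suc k)) \<longlonglongrightarrow> 0"
    using LIMSEQ_inverse_real_of_nat by (simp add: inverse_eq_divide)
  hence t0: "filterlim t (at 0) sequentially"
    unfolding filterlim_at t_def[symmetric] using t by (auto intro!: always_eventually simp: less_imp_neq[symmetric])
  define Q where "Q k x = (u (x + t k *\<^sub>R e) - u x) /\<^sub>R t k" for k x
  have [measurable]: "Q k \<in> borel_measurable borel" for k
    unfolding Q_def by measurable
  \<comment> \<open>One factor \<open>2 powr K\<close> comes from Peetre's inequality, the other
    from \<open>jbr (s *\<^sub>R e) <= 2\<close> for shifts of length at most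
    \<open>1\<close>.\<close>
  define A where "A = C * (2 powr K * 2 powr K)"
  have Qle: "norm (Q k x) \<le> A * jbr x powr (-K)" for k x
  proof -
    have "continuous_on {0..t k} (\<lambda>s. u (x + s *\<^sub>R e))"
      by (intro continuous_on_compose2[OF cont(1)] continuous_intros) auto
    then obtain s where s: "s \<in> {0<..<t k}"
      and "norm (u (x + t k *\<^sub>R e) - u (x + 0 *\<^sub>R e)) \<le> norm ((t k - 0) *\<^sub>R u' (x + s *\<^sub>R e))"
      using mvt_general[of 0 "t k" "\<lambda>s. u (x + s *\<^sub>R e)" "\<lambda>s h. h *\<^sub>R u' (x + s *\<^sub>R e)"] t[of k] der_s[of x]
      unfolding has_vector_derivative_def by blast
    hence "norm (Q k x) \<le> norm (u' (x + s *\<^sub>R e))"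
      using t[of k] by (simp add: Q_def divide_simps mult.commute)
    also have "\<dots> \<le> C * jbr (x + s *\<^sub>R e) powr (-K)" by (rule u')
    also have "jbr (x + s *\<^sub>R e) powr (-K) \<le> 2 powr K * (jbr (s *\<^sub>R e) powr K * jbr x powr (-K))"
      using jbr_powr_shift_le[of "x + s *\<^sub>R e" "-K" x] K0 by simp
    also have "jbr (s *\<^sub>R e) powr K \<le> 2 powr K"
      using jbr_le[of "s *\<^sub>R e"] s t[of k] K0 e by (intro powr_mono2) auto
    finally show ?thesis using C0 by (simp add: A_def mult_left_mono mult_right_mono mult_ac)
  qed
  have 1: "(\<lambda>k. fourier (Q k) y) \<longlonglongrightarrow> fourier u' y"
    unfolding fourier_chr
  proof (rule integral_dominated_convergence[where w = "\<lambda>x. A * jbr x powr (-K)"])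
    show "AE x in lborel. (\<lambda>k. Q k x * chr (- (x \<bullet> y))) \<longlonglongrightarrow> u' x * chr (- (x \<bullet> y))"
    proof (intro AE_I2 tendsto_mult tendsto_const)
      fix x :: "real^'n"
      have "((\<lambda>t. (u (x + t *\<^sub>R e) - u (x + 0 *\<^sub>R e)) /\<^sub>R t) \<longlongrightarrow> u' x) (at 0)"
        by (rule has_vector_derivative_quotient) (use der_s[of x 0] in simp)
      from filterlim_compose[OF this t0] show "(\<lambda>k. Q k x) \<longlonglongrightarrow> u' x" by (simp add: Q_def)
    qed
    show "AE x in lborel. norm (Q k x * chr (- (x \<bullet> y))) \<le> A * jbr x powr (-K)" for k
      using Qle by (simp add: norm_mult)
  qed (use Cint[of A] in auto)
  have FQ: "fourier (Q k) y = (chr (t k * (y $ j)) - 1) /\<^sub>R t k * fourier u y" for k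
  proof -
    define c where "c = complex_of_real (inverse (t k))"
    have i1: "integrable lborel (\<lambda>x. u (x + t k *\<^sub>R e))"
      using integral_lborel_translate(2)[of u] uint by simp
    have "fourier (Q k) y = fourier (\<lambda>x. c * (u (x + t k *\<^sub>R e) + (-1) * u x)) y"
      by (simp add: Q_def[abs_def] scaleR_conv_of_real[of "inverse _"] c_def)
    also have "\<dots> = c * (fourier (\<lambda>x. u (x + t k *\<^sub>R e)) y + (-1) * fourier u y)"
      unfolding fourier_cmult using i1 uint by (subst fourier_add) (auto simp only: fourier_cmult integrable_mult_right)
    also have "fourier (\<lambda>x. u (x + t k *\<^sub>R e)) y = chr (t k * (y $ j)) * fourier u y"
      using fourier_translate[of u "- (t k *\<^sub>R e)" y]
      by (simp add: e_def inner_axis inner_axis' mult.commute)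
    finally show ?thesis by (simp add: c_def scaleR_conv_of_real algebra_simps)
  qed
  have "((\<lambda>s. exp (s *\<^sub>R (complex_of_real (2 * pi * (y $ j)) * \<i>))) has_vector_derivative
      exp (0 *\<^sub>R (complex_of_real (2 * pi * (y $ j)) * \<i>)) * (complex_of_real (2 * pi * (y $ j)) * \<i>)) (at 0)"
    by (rule exp_scaleR_has_vector_derivative_right)
  moreover have "exp (s *\<^sub>R (complex_of_real (2 * pi * (y $ j)) * \<i>)) = chr (s * (y $ j))" for s
    by (simp add: chr_def cis_conv_exp scaleR_conv_of_real mult_ac)
  ultimately have "((\<lambda>s. chr (s * (y $ j))) has_vector_derivative complex_of_real (2 * pi * (y $ j)) * \<i>) (at 0)"
    by simp
  hence "((\<lambda>s. (chr (s * (y $ j)) - chr (0 * (y $ j))) /\<^sub>R s) \<longlongrightarrow> complex_of_real (2 * pi * (y $ j)) * \<i>) (at 0)"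
    by (rule has_vector_derivative_quotient)
  from filterlim_compose[OF this t0]
  have "(\<lambda>k. (chr (t k * (y $ j)) - 1) /\<^sub>R t k) \<longlonglongrightarrow> complex_of_real (2 * pi * (y $ j)) * \<i>" by simp
  hence 2: "(\<lambda>k. fourier (Q k) y) \<longlonglongrightarrow> complex_of_real (2 * pi * (y $ j)) * \<i> * fourier u y"
    unfolding FQ by (intro tendsto_mult tendsto_const)
  show ?thesis by (rule LIMSEQ_unique[OF 1 2])
qed

section \<open>Decay of Fourier transforms of smooth functions\<close>

text \<open>Only pure derivatives in one coordinate direction are controlled: they suffice for
  decay of the Fourier transform, and the product rule becomes a short induction.\<close>

primrec dbnd :: "nat \<Rightarrow> 'n::finite \<Rightarrow> (real^'n \<Rightarrow> real) \<Rightarrow> (real^'n \<Rightarrow> complex) \<Rightarrow> bool" where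
  "dbnd 0 j B u \<longleftrightarrow> continuous_on UNIV u \<and> (\<forall>x. norm (u x) \<le> B x)"
| "dbnd (Suc m) j B u \<longleftrightarrow> continuous_on UNIV u \<and> (\<forall>x. norm (u x) \<le> B x) \<and>
     (\<exists>u'. (\<forall>x. ((\<lambda>t. u (x + t *\<^sub>R axis j 1)) has_vector_derivative u' x) (at 0)) \<and> dbnd m j B u')"

lemma dbnd_continuous: "dbnd m j B u \<Longrightarrow> continuous_on UNIV u"
  by (cases m) auto

lemma dbnd_bound: "dbnd m j B u \<Longrightarrow> norm (u x) \<le> B x"
  by (cases m) auto

declare dbnd.simps(2) [simp del]

lemma dbnd_SucI:
  assumes "continuous_on UNIV u" "\<And>x. norm (u x) \<le> B x"
    and "\<And>x. ((\<lambda>t. u (x + t *\<^sub>R axis j 1)) has_vector_derivative u' x) (at 0)" "dbnd m j B u'"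
  shows "dbnd (Suc m) j B u"
  unfolding dbnd.simps(2) using assms by blast

lemma dbnd_SucD:
  "dbnd (Suc m) j B u \<Longrightarrow>
    \<exists>u'. (\<forall>x. ((\<lambda>t. u (x + t *\<^sub>R axis j 1)) has_vector_derivative u' x) (at 0)) \<and> dbnd m j B u'"
  unfolding dbnd.simps(2) by blast

lemma dbnd_mono: "dbnd m j B u \<Longrightarrow> (\<And>x. B x \<le> B' x) \<Longrightarrow> dbnd m j B' u"
proof (induction m arbitrary: u)
  case (Suc m)
  obtain u' where u': "\<And>x. ((\<lambda>t. u (x + t *\<^sub>R axis j 1)) has_vector_derivative u' x) (at 0)" "dbnd m j B u'"
    using dbnd_SucD[OF Suc.prems(1)] by blast
  show ?case
    by (rule dbnd_SucI[OF dbnd_continuous[OF Suc.prems(1)] order_trans[OF dbnd_bound[OF Suc.prems(1)] Suc.prems(2)]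
          u'(1) Suc.IH[OF u'(2) Suc.prems(2)]])
qed (auto intro: order_trans)

lemma dbnd_Suc_imp: "dbnd (Suc m) j B u \<Longrightarrow> dbnd m j B u"
proof (induction m arbitrary: u)
  case 0
  show ?case using dbnd_continuous[OF 0] dbnd_bound[OF 0] by auto
next
  case (Suc m)
  obtain u' where u': "\<And>x. ((\<lambda>t. u (x + t *\<^sub>R axis j 1)) has_vector_derivative u' x) (at 0)" "dbnd (Suc m) j B u'"
    using dbnd_SucD[OF Suc.prems] by blast
  show ?case
    by (rule dbnd_SucI[OF dbnd_continuous[OF Suc.prems] dbnd_bound[OF Suc.prems] u'(1) Suc.IH[OF u'(2)]])
qed

lemma dbnd_add: "dbnd m j B u \<Longrightarrow> dbnd m j B' v \<Longrightarrow> dbnd m j (\<lambda>x. B x + B' x) (\<lambda>x. u x + v x)"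
proof (induction m arbitrary: u v)
  case 0
  thus ?case by (auto intro!: continuous_intros norm_triangle_mono)
next
  case (Suc m)
  obtain u' where u': "\<And>x. ((\<lambda>t. u (x + t *\<^sub>R axis j 1)) has_vector_derivative u' x) (at 0)" "dbnd m j B u'"
    using dbnd_SucD[OF Suc.prems(1)] by blast
  obtain v' where v': "\<And>x. ((\<lambda>t. v (x + t *\<^sub>R axis j 1)) has_vector_derivative v' x) (at 0)" "dbnd m j B' v'"
    using dbnd_SucD[OF Suc.prems(2)] by blast
  show ?case
    by (rule dbnd_SucI[OF _ _ has_vector_derivative_add[OF u'(1) v'(1)] Suc.IH[OF u'(2) v'(2)]])
      (auto intro!: continuous_intros norm_triangle_mono dbnd_continuous[OF Suc.prems(1)] dbnd_continuous[OF Suc.prems(2)]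
        dbnd_bound[OF Suc.prems(1)] dbnd_bound[OF Suc.prems(2)])
qed

text \<open>All derivatives share one bound, and each differentiation splits the product into two
  terms; so the constant doubles at every order, and no binomial coefficients appear.\<close>

lemma dbnd_mult:
  "dbnd m j B u \<Longrightarrow> dbnd m j B' v \<Longrightarrow> dbnd m j (\<lambda>x. 2 ^ m * (B x * B' x)) (\<lambda>x. u x * v x)"
proof (induction m arbitrary: u v)
  case 0
  thus ?case
    by (auto intro!: continuous_intros mult_mono simp: norm_mult) (meson norm_ge_zero order_trans)
next
  case (Suc m)
  obtain u' where u': "\<And>x. ((\<lambda>t. u (x + t *\<^sub>R axis j 1)) has_vector_derivative u' x) (at 0)" "dbnd m j B u'"
    using dbnd_SucD[OF Suc.prems(1)] by blast
  obtain v' where v': "\<And>x. ((\<lambda>t. v (x + t *\<^sub>R axis j 1)) has_vector_derivative v' x) (at 0)" "dbnd m j B' v'"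
    using dbnd_SucD[OF Suc.prems(2)] by blast
  note uv = Suc.prems[THEN dbnd_Suc_imp]
  have "((\<lambda>t. u (x + t *\<^sub>R axis j 1) * v (x + t *\<^sub>R axis j 1)) has_vector_derivative
      u (x + 0 *\<^sub>R axis j 1) * v' x + u' x * v (x + 0 *\<^sub>R axis j 1)) (at 0)" for x
    using u' v' by (intro has_vector_derivative_mult) auto
  hence d: "((\<lambda>t. u (x + t *\<^sub>R axis j 1) * v (x + t *\<^sub>R axis j 1)) has_vector_derivative
      u x * v' x + u' x * v x) (at 0)" for x by simp
  have "dbnd m j (\<lambda>x. 2 ^ m * (B x * B' x) + 2 ^ m * (B x * B' x)) (\<lambda>x. u x * v' x + u' x * v x)"
    by (intro dbnd_add Suc.IH u' v' uv)
  hence d': "dbnd m j (\<lambda>x. 2 ^ Suc m * (B x * B' x)) (\<lambda>x. u x * v' x + u' x * v x)"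
    by (rule dbnd_mono) simp
  have b: "norm (u x * v x) \<le> 2 ^ Suc m * (B x * B' x)" for x
  proof -
    have "norm (u x * v x) \<le> B x * B' x"
      unfolding norm_mult
      by (intro mult_mono dbnd_bound[OF uv(1)] dbnd_bound[OF uv(2)] norm_ge_zero
          order_trans[OF norm_ge_zero dbnd_bound[OF uv(1)]])
    moreover from this have "1 * (B x * B' x) \<le> 2 ^ Suc m * (B x * B' x)"
      using order_trans[OF norm_ge_zero] by (intro mult_right_mono one_le_power) auto
    ultimately show ?thesis by linarith
  qed
  have "continuous_on UNIV (\<lambda>x. u x * v x)"
    by (intro continuous_intros dbnd_continuous[OF uv(1)] dbnd_continuous[OF uv(2)])
  from dbnd_SucI[OF this b d d'] show ?case .
qed

lemma dbnd_translate: "dbnd m j B u \<Longrightarrow> dbnd m j (\<lambda>x. B (x - a)) (\<lambda>x. u (x - a))"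
proof (induction m arbitrary: u)
  case 0
  thus ?case by (auto intro!: continuous_on_compose2[of UNIV u] continuous_intros)
next
  case (Suc m)
  obtain u' where u': "\<And>x. ((\<lambda>t. u (x + t *\<^sub>R axis j 1)) has_vector_derivative u' x) (at 0)" "dbnd m j B u'"
    using dbnd_SucD[OF Suc.prems] by blast
  have d: "((\<lambda>t. u (x + t *\<^sub>R axis j 1 - a)) has_vector_derivative u' (x - a)) (at 0)" for x
    using u'(1)[of "x - a"] by (simp add: algebra_simps)
  have "continuous_on UNIV (\<lambda>x. u (x - a))"
    by (intro continuous_on_compose2[OF dbnd_continuous[OF Suc.prems]] continuous_intros) auto
  from dbnd_SucI[OF this dbnd_bound[OF Suc.prems] d Suc.IH[OF u'(2)]] show ?case .
qed

lemma dbnd_const: "norm c \<le> B \<Longrightarrow> dbnd m j (\<lambda>_. B) (\<lambda>_. c)"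
proof (induction m arbitrary: c)
  case (Suc m)
  have "dbnd m j (\<lambda>_. B) (\<lambda>_. 0)" using order_trans[OF norm_ge_zero Suc.prems] by (intro Suc.IH) simp
  thus ?case using Suc.prems by (intro dbnd_SucI[where u' = "\<lambda>_. 0"]) auto
qed auto

lemma dbnd_cmult:
  assumes "dbnd m j B u"
  shows "dbnd m j (\<lambda>x. 2 ^ m * (norm c * B x)) (\<lambda>x. c * u x)"
  using dbnd_mult[OF dbnd_const[of c "norm c"] assms] by simp

lemma dbnd_coord: "dbnd m j (\<lambda>x. jbr x) (\<lambda>x. complex_of_real (x $ i))"
proof -
  have b: "norm (complex_of_real (x $ i)) \<le> jbr x" for x :: "real^'a"
    using component_le_norm_cart[of x i] norm_le_jbr[of x] by simp
  have c: "continuous_on UNIV (\<lambda>x::real^'a. complex_of_real (x $ i))" by (intro continuous_intros)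
  show ?thesis
  proof (cases m)
    case (Suc k)
    define d :: real where "d = axis j 1 $ i"
    have d: "\<bar>d\<bar> \<le> 1" by (simp add: d_def axis_def)
    have "((\<lambda>t. complex_of_real ((x + t *\<^sub>R axis j 1) $ i)) has_vector_derivative complex_of_real d) (at 0)" for x :: "real^'a"
    proof -
      have "((\<lambda>t. (x + t *\<^sub>R axis j 1) $ i) has_real_derivative d) (at 0)"
        by (auto intro!: derivative_eq_intros simp: d_def)
      from has_vector_derivative_of_real[OF this] show ?thesis by simp
    qed
    moreover have "dbnd k j (\<lambda>x. jbr x) (\<lambda>_. complex_of_real d)"
      by (rule dbnd_mono[OF dbnd_const[of _ 1]]) (use d in \<open>auto simp: jbr_ge_1\<close>)
    ultimately show ?thesis unfolding Suc by (intro dbnd_SucI[OF c b])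
  qed (use b c in auto)
qed

lemma norm_sq_line: "(norm (x + t *\<^sub>R axis j 1))\<^sup>2 = (norm x)\<^sup>2 + 2 * t * (x $ j) + t\<^sup>2"
  unfolding power2_norm_eq_inner
  by (simp add: inner_add_left inner_add_right inner_axis inner_axis' power2_eq_square algebra_simps)

lemma gauss_line_derivative:
  "((\<lambda>t. gauss b (x + t *\<^sub>R axis j 1)) has_real_derivative - (2 * b) * (x $ j) * gauss b x) (at 0)"
proof -
  have "((\<lambda>t. exp (- (b * ((norm x)\<^sup>2 + 2 * t * (x $ j) + t\<^sup>2)))) has_real_derivative
      - (2 * b) * (x $ j) * exp (- (b * (norm x)\<^sup>2))) (at 0)"
    by (auto intro!: derivative_eq_intros)
  thus ?thesis unfolding gauss_def norm_sq_line .
qed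

text \<open>The derivative contains \<open>x $ j\<close>, which costs one power of decay. Hence
  \<open>K\<close> is generalised in the induction, and the hypothesis is used at
  \<open>K + 1\<close>.\<close>

lemma dbnd_gauss:
  assumes b: "0 < b"
  shows "\<exists>C>0. dbnd m j (\<lambda>x. C * jbr x powr (-K)) (\<lambda>x::real^'n::finite. cgauss b x)"
proof (induction m arbitrary: K)
  case 0
  obtain C where "0 < C" "\<And>x::real^'n. gauss b x \<le> C * jbr x powr (-K)"
    using gauss_le_jbr[OF b] by blast
  thus ?case by (auto intro!: exI[of _ C] continuous_intros)
next
  case (Suc m)
  obtain C0 where C0: "0 < C0" "\<And>x::real^'n. gauss b x \<le> C0 * jbr x powr (-K)"
    using gauss_le_jbr[OF b] by blast
  obtain C where C: "0 < C" "dbnd m j (\<lambda>x. C * jbr x powr (-(K+1))) (\<lambda>x::real^'n. cgauss b x)"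
    using Suc.IH[of "K + 1"] by blast
  define u' where "u' x = complex_of_real (- (2 * b)) * (complex_of_real (x $ j) * cgauss b x)" for x :: "real^'n"
  define A where "A = 2 ^ m * (2 * b * (2 ^ m * C))"
  have A: "0 < A" using b C by (simp add: A_def)
  have "((\<lambda>t. cgauss b (x + t *\<^sub>R axis j 1)) has_vector_derivative u' x) (at 0)" for x
    using has_vector_derivative_of_real[OF gauss_line_derivative[of b x j]] by (simp add: u'_def mult.assoc)
  moreover have "dbnd m j (\<lambda>x. A * jbr x powr (-K)) u'"
    unfolding u'_def
  proof (rule dbnd_mono[OF dbnd_cmult[OF dbnd_mult[OF dbnd_coord C(2)]]])
    fix x :: "real^'n"
    have "jbr x * jbr x powr (-(K+1)) = jbr x powr (-K)"
      using powr_add[of "jbr x" 1 "-(K+1)"] by simp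
    thus "2 ^ m * (norm (complex_of_real (- (2 * b))) * (2 ^ m * (jbr x * (C * jbr x powr (-(K+1)))))) \<le> A * jbr x powr (-K)"
      using b by (simp add: A_def mult_ac)
  qed
  hence "dbnd m j (\<lambda>x. max A C0 * jbr x powr (-K)) u'"
    by (rule dbnd_mono) (intro mult_right_mono, auto)
  moreover have "norm (cgauss b x) \<le> max A C0 * jbr x powr (-K)" for x :: "real^'n"
  proof -
    have "C0 * jbr x powr (-K) \<le> max A C0 * jbr x powr (-K)" by (intro mult_right_mono) auto
    thus ?thesis using C0(2)[of x] by (simp add: order_trans[OF C0(2)])
  qed
  moreover have "continuous_on UNIV (\<lambda>x::real^'n. cgauss b x)" by (intro continuous_intros)
  ultimately have "dbnd (Suc m) j (\<lambda>x. max A C0 * jbr x powr (-K)) (\<lambda>x::real^'n. cgauss b x)"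
    by (intro dbnd_SucI)
  thus ?case using A by (intro exI[of _ "max A C0"]) simp
qed

text \<open>The derivative is \<open>s * (x $ j) * jbr x powr (s - 2)\<close>, so the induction goes
  from \<open>s - 2\<close> to \<open>s\<close>. Its true order \<open>s - 1\<close> is given away,
  as a common bound for all derivatives is wanted.\<close>

lemma dbnd_jbr_powr:
  "\<exists>C>0. dbnd m j (\<lambda>x. C * jbr x powr s) (\<lambda>x::real^'n::finite. complex_of_real (jbr x powr s))"
proof (induction m arbitrary: s)
  case 0
  show ?case by (auto intro!: exI[of _ 1] continuous_intros)
next
  case (Suc m)
  obtain C where C: "0 < C" "dbnd m j (\<lambda>x. C * jbr x powr (s - 2)) (\<lambda>x::real^'n. complex_of_real (jbr x powr (s - 2)))"
    using Suc.IH[of "s - 2"] by blast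
  define u' where "u' x = complex_of_real s * (complex_of_real (x $ j) * complex_of_real (jbr x powr (s - 2)))" for x :: "real^'n"
  define A where "A = 2 ^ m * (\<bar>s\<bar> * (2 ^ m * C))"
  have A: "0 \<le> A" using C by (simp add: A_def)
  have "((\<lambda>t. complex_of_real (jbr (x + t *\<^sub>R axis j 1) powr s)) has_vector_derivative u' x) (at 0)" for x
  proof -
    define q where "q = 1 + (norm x)\<^sup>2"
    have q: "0 < q" by (simp add: q_def add_pos_nonneg)
    have jq: "jbr (x + t *\<^sub>R axis j 1) powr r = (q + 2 * t * (x $ j) + t\<^sup>2) powr (r / 2)" for t r
    proof -
      have "q + 2 * t * (x $ j) + t\<^sup>2 = 1 + (norm (x + t *\<^sub>R axis j 1))\<^sup>2" by (simp add: norm_sq_line q_def)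
      thus ?thesis by (simp add: jbr_def powr_half_sqrt[symmetric] powr_powr)
    qed
    have jx: "jbr x powr (s - 2) = q powr ((s - 2) / 2)" using jq[of 0 "s - 2"] by simp
    have "((\<lambda>t. (q + 2 * t * (x $ j) + t\<^sup>2) powr (s / 2)) has_real_derivative
        s * ((x $ j) * q powr ((s - 2) / 2))) (at 0)"
    proof -
      have "((\<lambda>t. q + 2 * t * (x $ j) + t\<^sup>2) has_real_derivative 2 * (x $ j)) (at 0)"
        by (auto intro!: derivative_eq_intros)
      from DERIV_fun_powr[OF this, of "s / 2"] q show ?thesis
        by (simp add: diff_divide_distrib mult_ac)
    qed
    hence "((\<lambda>t. jbr (x + t *\<^sub>R axis j 1) powr s) has_real_derivative s * ((x $ j) * jbr x powr (s - 2))) (at 0)"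
      unfolding jq jx .
    from has_vector_derivative_of_real[OF this] show ?thesis by (simp add: u'_def)
  qed
  moreover have "dbnd m j (\<lambda>x. A * jbr x powr s) u'"
    unfolding u'_def
  proof (rule dbnd_mono[OF dbnd_cmult[OF dbnd_mult[OF dbnd_coord C(2)]]])
    fix x :: "real^'n"
    have "jbr x * jbr x powr (s - 2) = jbr x powr (s - 1)"
      using powr_add[of "jbr x" 1 "s - 2"] by simp
    moreover have "jbr x powr (s - 1) \<le> jbr x powr s" by (rule jbr_powr_mono) simp
    ultimately have "A * (jbr x * jbr x powr (s - 2)) \<le> A * jbr x powr s" using A by (simp add: mult_left_mono)
    thus "2 ^ m * (norm (complex_of_real s) * (2 ^ m * (jbr x * (C * jbr x powr (s - 2))))) \<le> A * jbr x powr s"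
      by (simp add: A_def mult_ac)
  qed
  hence "dbnd m j (\<lambda>x. (A + 1) * jbr x powr s) u'"
    by (rule dbnd_mono) (simp add: distrib_right)
  moreover have "norm (complex_of_real (jbr x powr s)) \<le> (A + 1) * jbr x powr s" for x :: "real^'n"
    using A by (simp add: distrib_right)
  moreover have "continuous_on UNIV (\<lambda>x::real^'n. complex_of_real (jbr x powr s))" by (intro continuous_intros)
  ultimately have "dbnd (Suc m) j (\<lambda>x. (A + 1) * jbr x powr s) (\<lambda>x::real^'n. complex_of_real (jbr x powr s))"
    by (intro dbnd_SucI)
  thus ?case using A by (intro exI[of _ "A + 1"]) simp
qed

section \<open>From bounds on derivatives to decay of the transform\<close>

lemma fourier_decay_coord:
  fixes u :: "real^'n::finite \<Rightarrow> complex"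
  assumes "dbnd m j B u" and B: "integrable lborel B" "\<And>x. B x \<le> C * jbr x powr (-K)" "real CARD('n) < K"
  shows "\<bar>2 * pi * (y $ j)\<bar> ^ m * norm (fourier u y) \<le> (LINT x|lborel. B x)"
  using assms(1)
proof (induction m arbitrary: u)
  case 0
  have [measurable]: "u \<in> borel_measurable borel"
    using 0 by (auto intro: borel_measurable_continuous_onI)
  have "integrable lborel u"
    by (rule Bochner_Integration.integrable_bound[OF B(1)]) (use 0 order_trans[OF _ abs_ge_self] in auto)
  hence "(LINT x|lborel. norm (u x)) \<le> (LINT x|lborel. B x)"
    using 0 B(1) by (intro integral_mono) auto
  thus ?case using norm_fourier_le[of u y] by simp
next
  case (Suc m)
  obtain u' where u': "\<And>x. ((\<lambda>t. u (x + t *\<^sub>R axis j 1)) has_vector_derivative u' x) (at 0)" "dbnd m j B u'"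
    using dbnd_SucD[OF Suc.prems] by blast
  have "fourier u' y = complex_of_real (2 * pi * (y $ j)) * \<i> * fourier u y"
    by (rule fourier_deriv[OF u'(1) dbnd_continuous[OF Suc.prems] dbnd_continuous[OF u'(2)] B(3)
          order_trans[OF dbnd_bound[OF Suc.prems] B(2)] order_trans[OF dbnd_bound[OF u'(2)] B(2)]])
  hence "norm (fourier u' y) = \<bar>2 * pi * (y $ j)\<bar> * norm (fourier u y)"
    by (simp only: norm_mult norm_of_real norm_ii mult_1_right)
  thus ?case using Suc.IH[OF u'(2)] by (simp only: power_Suc mult.assoc mult.left_commute)
qed

text \<open>For \<open>norm y > 1\<close> some coordinate is at least \<open>norm y / n\<close> in
  absolute value, and \<open>m\<close> derivatives in that direction give the decay in all of
  \<open>y\<close>. For \<open>norm y <= 1\<close> the bound by the integral of \<open>B\<close> is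
  enough.\<close>

lemma fourier_decay:
  fixes u :: "real^'n::finite \<Rightarrow> complex"
  assumes u: "\<And>j. dbnd m j B u" and B: "integrable lborel B" "\<And>x. B x \<le> C * jbr x powr (-K)" "real CARD('n) < K"
  shows "norm (fourier u y) \<le> (2 * real CARD('n)) ^ m * (LINT x|lborel. B x) * jbr y powr (- real m)"
proof -
  have B0: "0 \<le> B x" for x using dbnd_bound[OF u] norm_ge_zero order_trans by blast
  have I: "norm (fourier u y) \<le> (LINT x|lborel. B x)"
    using fourier_decay_coord[of 0 _ B u C K y] dbnd_continuous[OF u] dbnd_bound[OF u] B by auto
  have n1: "1 \<le> real CARD('n)" by (simp add: Suc_leI)
  have "jbr y ^ m * norm (fourier u y) \<le> (2 * real CARD('n)) ^ m * (LINT x|lborel. B x)"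
  proof (cases "norm y \<le> 1")
    case True
    hence "jbr y \<le> 2 * real CARD('n)" using jbr_le[of y] n1 by linarith
    thus ?thesis using I by (intro mult_mono power_mono) auto
  next
    case False
    have "\<exists>j. norm y \<le> real CARD('n) * \<bar>y $ j\<bar>"
    proof (rule ccontr)
      assume "\<not> ?thesis"
      hence "\<bar>y $ j\<bar> < norm y / real CARD('n)" for j using n1 by (auto simp: field_simps not_le)
      hence "(\<Sum>j\<in>UNIV. \<bar>y $ j\<bar>) < (\<Sum>j\<in>(UNIV::'n set). norm y / real CARD('n))"
        by (intro sum_strict_mono) auto
      thus False using norm_le_l1_cart[of y] by simp
    qed
    then obtain j where j: "norm y \<le> real CARD('n) * \<bar>y $ j\<bar>" by blast
    have "jbr y \<le> 2 * real CARD('n) * \<bar>y $ j\<bar>" using jbr_le[of y] False j by linarith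
    also have "\<dots> \<le> 2 * real CARD('n) * \<bar>2 * pi * (y $ j)\<bar>"
      using pi_gt3 by (intro mult_left_mono) (auto simp: abs_mult mult_le_cancel_right1)
    finally have "jbr y ^ m \<le> (2 * real CARD('n) * \<bar>2 * pi * (y $ j)\<bar>) ^ m" by (intro power_mono) auto
    hence "jbr y ^ m * norm (fourier u y) \<le> (2 * real CARD('n)) ^ m * (\<bar>2 * pi * (y $ j)\<bar> ^ m * norm (fourier u y))"
      by (simp add: power_mult_distrib mult_right_mono mult.assoc[symmetric])
    also have "\<dots> \<le> (2 * real CARD('n)) ^ m * (LINT x|lborel. B x)"
      using fourier_decay_coord[OF u B] by (intro mult_left_mono) auto
    finally show ?thesis .
  qed
  thus ?thesis by (simp only: jbr_powr_le_iff powr_realpow[OF jbr_pos])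
qed

section \<open>Regularity of Schwartz functions\<close>

lemma norm_increment_line_le:
  fixes u :: "'a::real_normed_vector \<Rightarrow> 'b::euclidean_space"
  assumes der: "\<And>x. ((\<lambda>t. u (x + t *\<^sub>R e)) has_vector_derivative u' x) (at 0)"
    and C: "\<And>x. norm (u' x) \<le> C"
  shows "norm (u (x + t *\<^sub>R e) - u x) \<le> C * \<bar>t\<bar>"
proof -
  note der_s = has_vector_derivative_line[of u e u', OF der]
  have pos: "norm (u (x + t *\<^sub>R e) - u x) \<le> C * t" if t: "0 < t" for x t
  proof -
    have "continuous_on {0..t} (\<lambda>s. u (x + s *\<^sub>R e))"
      using der_s[of x] by (intro continuous_at_imp_continuous_on ballI has_vector_derivative_continuous)
    then obtain s where "norm (u (x + t *\<^sub>R e) - u (x + 0 *\<^sub>R e)) \<le> norm ((t - 0) *\<^sub>R u' (x + s *\<^sub>R e))"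
      using mvt_general[of 0 t "\<lambda>s. u (x + s *\<^sub>R e)" "\<lambda>s h. h *\<^sub>R u' (x + s *\<^sub>R e)"] t der_s[of x]
      unfolding has_vector_derivative_def by blast
    hence "norm (u (x + t *\<^sub>R e) - u x) \<le> t * norm (u' (x + s *\<^sub>R e))" using t by simp
    also have "\<dots> \<le> t * C" using t C by (intro mult_left_mono) auto
    finally show ?thesis by (simp add: mult.commute)
  qed
  consider "t = 0" | "0 < t" | "0 < - t" by linarith
  thus ?thesis
  proof cases
    case 3
    have "norm (u (x + t *\<^sub>R e + (- t) *\<^sub>R e) - u (x + t *\<^sub>R e)) \<le> C * (- t)" by (rule pos[OF 3])
    thus ?thesis using 3 by (simp add: norm_minus_commute)
  qed (use pos in auto)
qed

text \<open>The definition \<open>schwartz\<close> speaks of derivatives along coordinate lines,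
  which by themselves do not imply continuity. Boundedness of the partial derivatives does: moving
  along one axis after the other gives a Lipschitz estimate.\<close>

lemma continuous_of_bounded_partials:
  fixes u :: "real^'n::finite \<Rightarrow> 'b::euclidean_space"
  assumes der: "\<And>i x. ((\<lambda>t. u (x + t *\<^sub>R axis i 1)) has_vector_derivative u' i x) (at 0)"
    and C: "\<And>i x. norm (u' i x) \<le> C"
  shows "continuous_on UNIV u"
proof -
  have C0: "0 \<le> C" using order_trans[OF norm_ge_zero C] .
  have fin: "norm (u (x + (\<Sum>i\<in>S. h i *\<^sub>R axis i 1)) - u x) \<le> C * (\<Sum>i\<in>S. \<bar>h i\<bar>)" for S h x
    using finite[of S]
  proof (induction S rule: finite_induct)
    case (insert i S)
    let ?y = "x + (\<Sum>i\<in>S. h i *\<^sub>R axis i 1)"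
    have "norm (u (?y + h i *\<^sub>R axis i 1) - u ?y) \<le> C * \<bar>h i\<bar>"
      by (rule norm_increment_line_le[OF der C])
    moreover have "norm (u (?y + h i *\<^sub>R axis i 1) - u x) \<le> norm (u (?y + h i *\<^sub>R axis i 1) - u ?y) + norm (u ?y - u x)"
      by (rule norm_diff_triangle_ineq[THEN order_trans[rotated]]) (simp add: norm_triangle_sub)
    ultimately show ?case using insert by (simp add: algebra_simps)
  qed simp
  have "(C * real CARD('n))-lipschitz_on UNIV u"
  proof (rule lipschitz_onI)
    fix x y :: "real^'n"
    have "y + (\<Sum>i\<in>UNIV. (x - y) $ i *\<^sub>R axis i 1) = x"
      using basis_expansion[of "x - y"] by (simp add: scalar_mult_eq_scaleR)
    hence "norm (u x - u y) \<le> C * (\<Sum>i\<in>UNIV. \<bar>(x - y) $ i\<bar>)"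
      using fin[of y "\<lambda>i. (x - y) $ i" UNIV] by simp
    also have "\<dots> \<le> C * (\<Sum>i\<in>(UNIV::'n set). norm (x - y))"
      by (intro mult_left_mono sum_mono component_le_norm_cart C0)
    finally show "dist (u x) (u y) \<le> C * real CARD('n) * dist x y" by (simp add: dist_norm mult.assoc)
  qed (use C0 in simp)
  thus ?thesis by (rule lipschitz_on_continuous_on)
qed

lemma pdiffs_bound:
  assumes "schwartz f"
  obtains C where "0 < C" "\<And>x. norm (pdiffs is f x) \<le> C * jbr x powr (-K)"
proof -
  define N where "N = nat \<lceil>\<bar>K\<bar>\<rceil>"
  have N: "K \<le> real N" unfolding N_def by linarith
  obtain C where C: "\<And>x. jbr x ^ N * norm (pdiffs is f x) \<le> C"
    using assms unfolding schwartz_def by blast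
  have "norm (pdiffs is f x) \<le> max 1 C * jbr x powr (-K)" for x
  proof -
    have "jbr x powr K * norm (pdiffs is f x) \<le> jbr x ^ N * norm (pdiffs is f x)"
      using jbr_powr_mono[OF N, of x] by (intro mult_right_mono) (auto simp: powr_realpow)
    also have "\<dots> \<le> max 1 C" using C[of x] by simp
    finally show ?thesis by (simp only: jbr_powr_le_iff)
  qed
  thus thesis by (intro that[of "max 1 C"]) auto
qed

lemma schwartz_has_vector_derivative:
  assumes "schwartz f"
  shows "((\<lambda>t. pdiffs is f (x + t *\<^sub>R axis i 1)) has_vector_derivative pdiffs (i # is) f x) (at 0)"
  using assms unfolding schwartz_def
  by (simp add: pdiff_def vector_derivative_works[symmetric])

lemma pdiffs_continuous:
  assumes f: "schwartz (f :: real^'n::finite \<Rightarrow> complex)"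
  shows "continuous_on UNIV (pdiffs is f)"
proof -
  have "\<exists>C. \<forall>x. norm (pdiffs (i # is) f x) \<le> C" for i
    using pdiffs_bound[OF f, of "i # is" 0] by (metis powr_zero_eq_one jbr_nz minus_zero mult_1_right)
  then obtain C where C: "\<And>i x. norm (pdiffs (i # is) f x) \<le> C i" by metis
  have "norm (pdiffs (i # is) f x) \<le> (\<Sum>i\<in>UNIV. \<bar>C i\<bar>)" for i x
    using C[of i x] member_le_sum[of i UNIV "\<lambda>i. \<bar>C i\<bar>"] by simp
  thus ?thesis
    by (rule continuous_of_bounded_partials[OF schwartz_has_vector_derivative[OF f]])
qed

lemma dbnd_schwartz:
  assumes f: "schwartz (f :: real^'n::finite \<Rightarrow> complex)"
  shows "\<exists>C>0. dbnd m j (\<lambda>x. C * jbr x powr (-K)) (pdiffs is f)"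
proof (induction m arbitrary: "is")
  case 0
  obtain C where "0 < C" "\<And>x. norm (pdiffs is f x) \<le> C * jbr x powr (-K)"
    using pdiffs_bound[OF f] by blast
  thus ?case using pdiffs_continuous[OF f, of "is"] by (auto intro!: exI[of _ C])
next
  case (Suc m)
  obtain C where C: "0 < C" "\<And>x. norm (pdiffs is f x) \<le> C * jbr x powr (-K)"
    using pdiffs_bound[OF f] by blast
  obtain C' where C': "0 < C'" "dbnd m j (\<lambda>x. C' * jbr x powr (-K)) (pdiffs (j # is) f)"
    using Suc.IH[of "j # is"] by blast
  have "dbnd (Suc m) j (\<lambda>x. (C + C') * jbr x powr (-K)) (pdiffs is f)"
  proof (rule dbnd_SucI[OF pdiffs_continuous[OF f] _ schwartz_has_vector_derivative[OF f]])
    show "norm (pdiffs is f x) \<le> (C + C') * jbr x powr (-K)" for x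
      by (rule order_trans[OF C(2)]) (use C' in \<open>auto intro!: mult_right_mono\<close>)
    show "dbnd m j (\<lambda>x. (C + C') * jbr x powr (-K)) (pdiffs (j # is) f)"
      by (rule dbnd_mono[OF C'(2)]) (use C in \<open>auto intro!: mult_right_mono\<close>)
  qed
  thus ?case using C C' by (intro exI[of _ "C + C'"]) auto
qed

lemma dbnd_uniform:
  assumes "\<And>j::'n::finite. \<exists>C>0. dbnd m j (\<lambda>x. C * w x) u" and w: "\<And>x. 0 \<le> w x"
  obtains C where "0 < C" "\<And>j. dbnd m j (\<lambda>x. C * w x) u"
proof -
  obtain C where C: "\<And>j::'n. 0 < C j" "\<And>j. dbnd m j (\<lambda>x. C j * w x) u"
    using assms(1) by metis
  have "dbnd m j (\<lambda>x. (\<Sum>j\<in>UNIV. C j) * w x) u" for j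
    by (rule dbnd_mono[OF C(2)[of j]])
      (auto intro!: mult_right_mono w member_le_sum less_imp_le[OF C(1)])
  moreover have "0 < (\<Sum>j\<in>UNIV. C j)" by (intro sum_pos C) auto
  ultimately show thesis using that by blast
qed

section \<open>Uniform decay for windowed functions\<close>

text \<open>What matters is the order of the quantifiers: \<open>m\<close> and \<open>C\<close> are
  fixed before the function, its size \<open>A\<close> and its centre \<open>a\<close>. The centre
  costs nothing, as the modulus of the transform is invariant under translation.\<close>

lemma fourier_decay_uniform:
  assumes M: "0 \<le> M"
  shows "\<exists>m C. 0 < C \<and> (\<forall>A a (u :: real^'n::finite \<Rightarrow> complex) y. 0 \<le> A \<longrightarrow>
       (\<forall>j. dbnd m j (\<lambda>x. A * jbr (x - a) powr (-(real CARD('n) + 1))) u) \<longrightarrow>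
       norm (fourier u y) \<le> C * A * jbr y powr (-M))"
proof -
  let ?K = "real CARD('n) + 1"
  define I where "I = (LINT x::real^'n|lborel. jbr x powr (-?K))"
  define m where "m = nat \<lceil>M\<rceil>"
  have m: "M \<le> real m" unfolding m_def by linarith
  have I0: "0 \<le> I" unfolding I_def by (intro integral_nonneg_AE) auto
  have "norm (fourier u y) \<le> ((2 * real CARD('n)) ^ m * I + 1) * A * jbr y powr (-M)"
    if A: "0 \<le> A" and u: "\<And>j. dbnd m j (\<lambda>x. A * jbr (x - a) powr (-?K)) u"
    for A a and u :: "real^'n \<Rightarrow> complex" and y
  proof -
    have "norm (fourier u y) \<le> (2 * real CARD('n)) ^ m * (LINT x|lborel. A * jbr (x - a) powr (-?K)) * jbr y powr (- real m)"
    proof (rule fourier_decay[OF u])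
      show "integrable lborel (\<lambda>x. A * jbr (x - a) powr (-?K))"
        by (intro integrable_mult_right integrable_jbr_powr_diff) simp
      \<comment> \<open>This constant may depend on \<open>a\<close>: \<open>fourier_decay\<close>
        asks for some bound of this form, and its conclusion involves the integral of
        \<open>B\<close> alone.\<close>
      show "A * jbr (x - a) powr (-?K) \<le> (A * (2 powr ?K * jbr (- a) powr ?K)) * jbr x powr (-?K)" for x
        unfolding mult.assoc
      proof (intro mult_left_mono A)
        have shift: "0 \<le> K \<Longrightarrow> jbr (x - a) powr (-K) \<le> 2 powr K * (jbr (- a) powr K * jbr x powr (-K))" for K
          using jbr_powr_shift_le[of "x - a" "-K" x] by simp
        show "jbr (x - a) powr (-?K) \<le> 2 powr ?K * (jbr (- a) powr ?K * jbr x powr (-?K))"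
          by (rule shift) simp
      qed
    qed simp
    also have "(LINT x|lborel. A * jbr (x - a) powr (-?K)) = A * I"
      using integral_lborel_translate(1)[of "\<lambda>x. jbr x powr (-?K)" "-a"] by (simp add: I_def)
    also have "(2 * real CARD('n)) ^ m * (A * I) * jbr y powr (- real m)
        \<le> (2 * real CARD('n)) ^ m * (A * I) * jbr y powr (- M)"
      using A I0 m by (intro mult_left_mono jbr_powr_mono) auto
    also have "\<dots> \<le> ((2 * real CARD('n)) ^ m * I + 1) * A * jbr y powr (-M)"
      using A by (simp add: algebra_simps)
    finally show ?thesis .
  qed
  moreover have "0 < (2 * real CARD('n)) ^ m * I + 1" using I0 by (intro add_nonneg_pos) auto
  ultimately show ?thesis by blast
qed

text \<open>This is the short-time transform of \<open>f\<close> in a Gaussian window. Decay in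
  \<open>x\<close> reflects the small overlap of \<open>f\<close> with a distant Gaussian, decay in
  \<open>\<xi>\<close> the smoothness of the product.\<close>

lemma fourier_schwartz_gauss:
  assumes f: "schwartz (f :: real^'n::finite \<Rightarrow> complex)" and b: "0 < b" and M: "0 \<le> M"
  obtains C where "0 < C"
    "\<And>x \<xi>. norm (fourier (\<lambda>y. f y * cgauss b (y - x)) \<xi>) \<le> C * jbr x powr (-M) * jbr \<xi> powr (-M)"
proof -
  let ?K = "real CARD('n) + 1"
  \<comment> \<open>Of the decay of \<open>f\<close>, the part \<open>?K\<close> provides
    integrability in \<open>y\<close>; the part \<open>M\<close> is joined with the Gaussian by
    Peetre's inequality to give decay in \<open>x\<close>.\<close>
  define L where "L = M + ?K"
  obtain m C where C: "0 < C"
    "\<forall>A a (u :: real^'n \<Rightarrow> complex) y. 0 \<le> A \<longrightarrow>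
       (\<forall>j. dbnd m j (\<lambda>x. A * jbr (x - a) powr (-?K)) u) \<longrightarrow>
       norm (fourier u y) \<le> C * A * jbr y powr (-M)"
    using fourier_decay_uniform[OF M] by (elim exE conjE)
  obtain C1 where C1: "0 < C1" "\<And>j. dbnd m j (\<lambda>x. C1 * jbr x powr (-L)) (pdiffs [] f)"
    by (rule dbnd_uniform[OF dbnd_schwartz[OF f] powr_ge_zero]; rule that; assumption)
  obtain C2 where C2: "0 < C2" "\<And>j. dbnd m j (\<lambda>x::real^'n. C2 * jbr x powr (-M)) (\<lambda>x. cgauss b x)"
    by (rule dbnd_uniform[OF dbnd_gauss[OF b] powr_ge_zero]; rule that; assumption)
  define D where "D = 2 ^ m * (C1 * C2 * 2 powr M)"
  have D: "0 < D" using C1 C2 by (simp add: D_def)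
  have "norm (fourier (\<lambda>y. f y * cgauss b (y - x)) \<xi>) \<le> C * (D * jbr x powr (-M)) * jbr \<xi> powr (-M)" for x \<xi>
  proof (rule C(2)[rule_format, where a = 0])
    show "0 \<le> D * jbr x powr (-M)" using D by simp
    fix j
    have "dbnd m j (\<lambda>y. 2 ^ m * (C1 * jbr y powr (-L) * (C2 * jbr (y - x) powr (-M)))) (\<lambda>y. pdiffs [] f y * cgauss b (y - x))"
      by (rule dbnd_mult[OF C1(2) dbnd_translate[OF C2(2)]])
    thus "dbnd m j (\<lambda>y. D * jbr x powr (-M) * jbr (y - 0) powr (-?K)) (\<lambda>y. f y * cgauss b (y - x))"
      unfolding pdiffs.simps
    proof (rule dbnd_mono)
      fix y
      have "jbr y powr (-L) * jbr (y - x) powr (-M) = jbr y powr (-?K) * (jbr y powr (-M) * jbr (x - y) powr (-M))"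
        by (simp add: L_def jbr_minus_commute[of y x] powr_add[symmetric] mult.assoc[symmetric])
      also have "\<dots> \<le> jbr y powr (-?K) * (2 powr M * jbr x powr (-M))"
        using jbr_powr_minus_mult_le[OF M, of y "x - y"] by (intro mult_left_mono) auto
      finally have "(2 ^ m * C1 * C2) * (jbr y powr (-L) * jbr (y - x) powr (-M))
          \<le> (2 ^ m * C1 * C2) * (jbr y powr (-?K) * (2 powr M * jbr x powr (-M)))"
        using C1 C2 by (intro mult_left_mono) auto
      thus "2 ^ m * (C1 * jbr y powr (-L) * (C2 * jbr (y - x) powr (-M))) \<le> D * jbr x powr (-M) * jbr (y - 0) powr (-?K)"
        by (simp add: D_def mult_ac)
    qed
  qed
  note B = this
  show thesis
  proof (rule that)
    show "0 < C * D" using C D by simp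
  qed (use B in \<open>simp only: mult.assoc\<close>)
qed

text \<open>Near \<open>a\<close> the weight and its derivatives have size
  \<open>jbr a powr s\<close>; the Peetre loss of order \<open>\<bar>s\<bar>\<close> away from
  \<open>a\<close> is absorbed by the Gaussian.\<close>

lemma fourier_jbr_gauss:
  assumes b: "0 < b" and M: "0 \<le> M"
  obtains C where "0 < C"
    "\<And>(a::real^'n::finite) y. norm (fourier (\<lambda>x. complex_of_real (jbr x powr s) * cgauss b (x - a)) y)
        \<le> C * jbr a powr s * jbr y powr (-M)"
proof -
  let ?K = "real CARD('n) + 1"
  obtain m C where C: "0 < C"
    "\<forall>A a (u :: real^'n \<Rightarrow> complex) y. 0 \<le> A \<longrightarrow>
       (\<forall>j. dbnd m j (\<lambda>x. A * jbr (x - a) powr (-?K)) u) \<longrightarrow>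
       norm (fourier u y) \<le> C * A * jbr y powr (-M)"
    using fourier_decay_uniform[OF M] by (elim exE conjE)
  obtain C1 where C1: "0 < C1" "\<And>j. dbnd m j (\<lambda>x::real^'n. C1 * jbr x powr s) (\<lambda>x. complex_of_real (jbr x powr s))"
    by (rule dbnd_uniform[OF dbnd_jbr_powr powr_ge_zero]; rule that; assumption)
  obtain C2 where C2: "0 < C2" "\<And>j. dbnd m j (\<lambda>x::real^'n. C2 * jbr x powr (-(\<bar>s\<bar> + ?K))) (\<lambda>x. cgauss b x)"
    by (rule dbnd_uniform[OF dbnd_gauss[OF b] powr_ge_zero]; rule that; assumption)
  define D where "D = 2 ^ m * (C1 * C2 * 2 powr \<bar>s\<bar>)"
  have D: "0 < D" using C1 C2 by (simp add: D_def)
  have "norm (fourier (\<lambda>x. complex_of_real (jbr x powr s) * cgauss b (x - a)) y)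
        \<le> C * (D * jbr a powr s) * jbr y powr (-M)" for a y :: "real^'n"
  proof (rule C(2)[rule_format, where a = a])
    show "0 \<le> D * jbr a powr s" using D by simp
    fix j
    have "dbnd m j (\<lambda>x. 2 ^ m * (C1 * jbr x powr s * (C2 * jbr (x - a) powr (-(\<bar>s\<bar> + ?K)))))
        (\<lambda>x. complex_of_real (jbr x powr s) * cgauss b (x - a))"
      by (rule dbnd_mult[OF C1(2) dbnd_translate[OF C2(2)]])
    thus "dbnd m j (\<lambda>x. D * jbr a powr s * jbr (x - a) powr (-?K))
        (\<lambda>x. complex_of_real (jbr x powr s) * cgauss b (x - a))"
    proof (rule dbnd_mono)
      fix x :: "real^'n"
      have "jbr x powr s * jbr (x - a) powr (-(\<bar>s\<bar> + ?K))
          \<le> (2 powr \<bar>s\<bar> * (jbr (x - a) powr \<bar>s\<bar> * jbr a powr s)) * jbr (x - a) powr (-(\<bar>s\<bar> + ?K))"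
        by (intro mult_right_mono jbr_powr_shift_le) auto
      also have "\<dots> = 2 powr \<bar>s\<bar> * jbr a powr s * (jbr (x - a) powr \<bar>s\<bar> * jbr (x - a) powr (-(\<bar>s\<bar> + ?K)))"
        by (simp only: mult_ac)
      also have "jbr (x - a) powr \<bar>s\<bar> * jbr (x - a) powr (-(\<bar>s\<bar> + ?K)) = jbr (x - a) powr (-?K)"
        by (simp flip: powr_add)
      finally have "(2 ^ m * C1 * C2) * (jbr x powr s * jbr (x - a) powr (-(\<bar>s\<bar> + ?K)))
          \<le> (2 ^ m * C1 * C2) * (2 powr \<bar>s\<bar> * jbr a powr s * jbr (x - a) powr (-?K))"
        using C1 C2 by (intro mult_left_mono) auto
      thus "2 ^ m * (C1 * jbr x powr s * (C2 * jbr (x - a) powr (-(\<bar>s\<bar> + ?K)))) \<le> D * jbr a powr s * jbr (x - a) powr (-?K)"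
        by (simp add: D_def mult_ac)
    qed
  qed
  note B = this
  show thesis
  proof (rule that)
    show "0 < C * D" using C D by simp
  qed (use B in \<open>simp only: mult.assoc\<close>)
qed

text \<open>Treats the factor that appears when the Gaussian window itself is
  differentiated.\<close>

lemma fourier_coord_gauss:
  assumes b: "0 < b" and M: "0 \<le> M"
  obtains C where "0 < C"
    "\<And>j (a::real^'n::finite) y. norm (fourier (\<lambda>x. complex_of_real ((x - a) $ j) * cgauss b (x - a)) y)
        \<le> C * jbr y powr (-M)"
proof -
  let ?K = "real CARD('n) + 1"
  obtain m C where C: "0 < C"
    "\<forall>A a (u :: real^'n \<Rightarrow> complex) y. 0 \<le> A \<longrightarrow>
       (\<forall>j. dbnd m j (\<lambda>x. A * jbr (x - a) powr (-?K)) u) \<longrightarrow>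
       norm (fourier u y) \<le> C * A * jbr y powr (-M)"
    using fourier_decay_uniform[OF M] by (elim exE conjE)
  obtain C2 where C2: "0 < C2" "\<And>j. dbnd m j (\<lambda>x::real^'n. C2 * jbr x powr (-(1 + ?K))) (\<lambda>x. cgauss b x)"
    by (rule dbnd_uniform[OF dbnd_gauss[OF b] powr_ge_zero]; rule that; assumption)
  define D where "D = 2 ^ m * C2"
  have D: "0 < D" using C2 by (simp add: D_def)
  have "norm (fourier (\<lambda>x. complex_of_real ((x - a) $ j) * cgauss b (x - a)) y)
        \<le> C * D * jbr y powr (-M)" for j and a y :: "real^'n"
  proof (rule C(2)[rule_format, where a = a])
    show "0 \<le> D" using D by simp
    fix i
    have "dbnd m i (\<lambda>x. 2 ^ m * (jbr x * (C2 * jbr x powr (-(1 + ?K)))))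
        (\<lambda>x. complex_of_real (x $ j) * cgauss b x)"
      by (rule dbnd_mult[OF dbnd_coord C2(2)])
    hence "dbnd m i (\<lambda>x. D * jbr x powr (-?K)) (\<lambda>x. complex_of_real (x $ j) * cgauss b x)"
    proof (rule dbnd_mono)
      fix x :: "real^'n"
      have "jbr x * jbr x powr (-(1 + ?K)) = jbr x powr (-?K)"
        by (rule jbr_mult_powr) simp
      thus "2 ^ m * (jbr x * (C2 * jbr x powr (-(1 + ?K)))) \<le> D * jbr x powr (-?K)"
        by (simp add: D_def mult_ac)
    qed
    from dbnd_translate[OF this, of a] show "dbnd m i (\<lambda>x. D * jbr (x - a) powr (-?K))
        (\<lambda>x. complex_of_real ((x - a) $ j) * cgauss b (x - a))" .
  qed
  note B = this
  show thesis
  proof (rule that)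
    show "0 < C * D" using C D by simp
  qed (rule B)
qed

section \<open>Products, convolutions and null sets\<close>

text \<open>The joint integrability behind the averages over translated windows: integrating out the
  translation parameter \<open>y\<close> leaves a constant multiple of
  \<open>\<alpha> x\<close>.\<close>

lemma integrable_pair_conv:
  fixes \<alpha> \<beta> :: "'a::euclidean_space \<Rightarrow> complex"
  assumes \<alpha>: "integrable lborel \<alpha>" and \<beta>: "integrable lborel \<beta>"
  shows "integrable (lborel \<Otimes>\<^sub>M lborel) (\<lambda>(x, y). \<alpha> x * \<beta> (x - y))"
proof (rule lborel_pair.Fubini_integrable)
  have [measurable]: "\<alpha> \<in> borel_measurable borel" "\<beta> \<in> borel_measurable borel" using \<alpha> \<beta> by simp_all
  show "(\<lambda>(x, y). \<alpha> x * \<beta> (x - y)) \<in> borel_measurable (lborel \<Otimes>\<^sub>M lborel)" by measurable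
  have "(LINT y|lborel. norm (\<alpha> x * \<beta> (x - y))) = norm (\<alpha> x) * (LINT y|lborel. norm (\<beta> y))" for x
    using integral_lborel_reflect(1)[of "\<lambda>y. norm (\<beta> y)" x] by (simp add: norm_mult)
  thus "integrable lborel (\<lambda>x. LINT y|lborel. norm (case (x, y) of (x, y) \<Rightarrow> \<alpha> x * \<beta> (x - y)))"
    using \<alpha> by simp
  show "AE x in lborel. integrable lborel (\<lambda>y. case (x, y) of (x, y) \<Rightarrow> \<alpha> x * \<beta> (x - y))"
    using \<beta> by (simp add: integral_lborel_reflect(2))
qed

text \<open>The product becomes a convolution of transforms, to which
  \<open>integral_jbr_powr_conv\<close> applies. The constant is fixed before the functions, so the
  lemma can be applied to whole families of translated windows.\<close>

lemma fourier_mult_bound: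
  assumes N: "real CARD('n::finite) < N" and k: "0 \<le> k" "k \<le> N"
  shows "\<exists>C>0. \<forall>(u :: real^'n \<Rightarrow> complex) v A D y. integrable lborel u \<longrightarrow> integrable lborel v \<longrightarrow> continuous_on UNIV v \<longrightarrow>
       (\<forall>z. norm (fourier v z) \<le> A * jbr z powr (-N)) \<longrightarrow> (\<forall>z. norm (fourier u z) \<le> D * jbr z powr (-k)) \<longrightarrow>
       norm (fourier (\<lambda>x. u x * v x) y) \<le> C * A * D * jbr y powr (-k)"
proof -
  obtain C where C: "0 < C"
    "\<And>y::real^'n. integrable lborel (\<lambda>z. jbr z powr (-N) * jbr (y - z) powr (-k))"
    "\<And>y::real^'n. (LINT z|lborel. jbr z powr (-N) * jbr (y - z) powr (-k)) \<le> C * jbr y powr (-k)"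
    by (rule integral_jbr_powr_conv[OF N k]; rule that; assumption)
  have "norm (fourier (\<lambda>x. u x * v x) y) \<le> C * A * D * jbr y powr (-k)"
    if u: "integrable lborel u" and v: "integrable lborel v" "continuous_on UNIV v"
      and A: "\<And>z. norm (fourier v z) \<le> A * jbr z powr (-N)" and D: "\<And>z. norm (fourier u z) \<le> D * jbr z powr (-k)"
    for u v :: "real^'n \<Rightarrow> complex" and A D y
  proof -
    have A0: "0 \<le> A" and D0: "0 \<le> D"
      using order_trans[OF norm_ge_zero A[of 0]] order_trans[OF norm_ge_zero D[of 0]]
      by (auto simp: zero_le_mult_iff)
    have [measurable]: "fourier v \<in> borel_measurable borel" "fourier u \<in> borel_measurable borel"
      using u v by (auto intro!: borel_measurable_continuous_onI continuous_fourier)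
    have Fv: "integrable lborel (fourier v)"
      by (rule Bochner_Integration.integrable_bound[where f = "\<lambda>z. A * jbr z powr (-N)"])
        (use A A0 in \<open>auto intro!: integrable_jbr_powr N simp: abs_mult\<close>)
    have "norm (fourier (\<lambda>x. u x * v x) y) \<le> (LINT z|lborel. norm (fourier v z * fourier u (y - z)))"
      unfolding fourier_mult[OF u v Fv] by (rule integral_norm_bound)
    also have "\<dots> \<le> (LINT z|lborel. (A * D) * (jbr z powr (-N) * jbr (y - z) powr (-k)))"
    proof (rule integral_mono')
      show "integrable lborel (\<lambda>z. (A * D) * (jbr z powr (-N) * jbr (y - z) powr (-k)))"
        by (intro integrable_mult_right C)
      fix z
      have "norm (fourier v z) * norm (fourier u (y - z)) \<le> (A * jbr z powr (-N)) * (D * jbr (y - z) powr (-k))"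
        by (intro mult_mono A D) (use A0 in auto)
      thus "norm (fourier v z * fourier u (y - z)) \<le> (A * D) * (jbr z powr (-N) * jbr (y - z) powr (-k))"
        by (simp add: norm_mult mult_ac)
    qed (use A0 D0 in simp)
    also have "\<dots> \<le> (A * D) * (C * jbr y powr (-k))"
      unfolding integral_mult_right_zero using A0 D0 C(3)[of y] by (intro mult_left_mono) auto
    finally show ?thesis by (simp add: mult_ac)
  qed
  thus ?thesis using C(1) by (intro exI[of _ C]) auto
qed

text \<open>Turns the almost-everywhere bounds hidden in essential suprema into pointwise ones: the
  set where a continuous function exceeds the bound is open, and an open null set is empty.\<close>

lemma AE_continuous_le:
  fixes h :: "'a::euclidean_space \<Rightarrow> real"
  assumes h: "continuous_on UNIV h" and ae: "AE x in lborel. h x \<le> C"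
  shows "h x \<le> C"
proof (rule ccontr)
  assume "\<not> h x \<le> C"
  hence "x \<in> {x. C < h x}" by simp
  hence ne: "{x. C < h x} \<noteq> {}" by blast
  have op: "open {x. C < h x}" using h by (intro open_Collect_less continuous_intros) auto
  have "{x \<in> space lborel. \<not> h x \<le> C} \<in> null_sets lborel"
    using ae op by (subst (asm) AE_iff_null) (auto simp: not_le)
  hence "{x. C < h x} \<in> null_sets lborel" by (simp add: not_le)
  hence "negligible {x. C < h x}"
    unfolding negligible_iff_null_sets by (intro null_sets_completionI)
  thus False using open_not_negligible[OF op ne] by simp
qed

section \<open>The hypothesis in Gaussian windows\<close>

text \<open>The constant depends on the centre \<open>\<xi>\<close>. The lemma therefore serves to
  justify integrability and differentiation under the integral; the uniform estimates come from
  elsewhere.\<close>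

lemma jbr_gauss_bound:
  fixes \<xi> :: "real^'n::finite"
  assumes b: "0 < b"
  obtains C where "0 < C" "\<And>\<eta>. jbr \<eta> powr s * gauss b (\<eta> - \<xi>) \<le> C * jbr \<eta> powr (-K)"
proof -
  define L where "L = \<bar>s + K\<bar>"
  obtain C where C: "0 < C" "\<And>x::real^'n. gauss b x \<le> C * jbr x powr (-L)"
    using gauss_le_jbr[OF b] by blast
  have "jbr \<eta> powr s * gauss b (\<eta> - \<xi>) \<le> (C * 2 powr L * jbr \<xi> powr L) * jbr \<eta> powr (-K)" for \<eta>
  proof -
    have "jbr (\<eta> - \<xi>) powr (-L) \<le> 2 powr L * (jbr \<xi> powr L * jbr \<eta> powr (-L))"
      using jbr_powr_shift_le[of "\<eta> - \<xi>" "-L" \<eta>] by (simp add: L_def)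
    hence "gauss b (\<eta> - \<xi>) \<le> C * (2 powr L * (jbr \<xi> powr L * jbr \<eta> powr (-L)))"
      using order_trans[OF C(2)] C(1) by (simp add: mult_left_mono)
    hence "jbr \<eta> powr s * gauss b (\<eta> - \<xi>) \<le> jbr \<eta> powr s * (C * (2 powr L * (jbr \<xi> powr L * jbr \<eta> powr (-L))))"
      by (intro mult_left_mono) auto
    also have "\<dots> = C * 2 powr L * jbr \<xi> powr L * (jbr \<eta> powr s * jbr \<eta> powr (-L))"
      by (simp only: mult_ac)
    also have "jbr \<eta> powr s * jbr \<eta> powr (-L) = jbr \<eta> powr (s - L)" by (simp flip: powr_add)
    also have "C * 2 powr L * jbr \<xi> powr L * jbr \<eta> powr (s - L) \<le> C * 2 powr L * jbr \<xi> powr L * jbr \<eta> powr (-K)"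
      using C(1) by (intro mult_left_mono jbr_powr_mono) (auto simp: L_def)
    finally show ?thesis .
  qed
  moreover have "0 < C * 2 powr L * jbr \<xi> powr L" using C(1) by simp
  ultimately show thesis using that by blast
qed

lemma integrable_mult_gauss:
  fixes f :: "real^'n::finite \<Rightarrow> complex"
  assumes b: "0 < b" and f: "continuous_on UNIV f" "\<And>\<eta>. norm (f \<eta>) \<le> A * jbr \<eta> powr s"
  shows "integrable lborel (\<lambda>\<eta>. f \<eta> * cgauss b (\<eta> - \<xi>))"
proof -
  let ?K = "real CARD('n) + 1"
  obtain C where C: "0 < C" "\<And>\<eta>. jbr \<eta> powr s * gauss b (\<eta> - \<xi>) \<le> C * jbr \<eta> powr (-?K)"
    using jbr_gauss_bound[OF b] by blast
  have [measurable]: "f \<in> borel_measurable borel" using f by (intro borel_measurable_continuous_onI)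
  have A: "0 \<le> A" using order_trans[OF norm_ge_zero f(2)[of 0]] by (simp add: zero_le_mult_iff)
  show ?thesis
  proof (rule Bochner_Integration.integrable_bound)
    show "integrable lborel (\<lambda>\<eta>::real^'n. A * C * jbr \<eta> powr (-?K))"
      by (intro integrable_mult_right integrable_jbr_powr) simp
    have "norm (f \<eta> * cgauss b (\<eta> - \<xi>)) \<le> A * C * jbr \<eta> powr (-?K)" for \<eta>
    proof -
      have "norm (f \<eta> * cgauss b (\<eta> - \<xi>)) \<le> A * jbr \<eta> powr s * gauss b (\<eta> - \<xi>)"
        using f(2) by (simp add: norm_mult mult_right_mono)
      also have "\<dots> \<le> A * (C * jbr \<eta> powr (-?K))"
        unfolding mult.assoc by (intro mult_left_mono C A)
      finally show ?thesis by (simp add: mult.assoc)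
    qed
    thus "AE \<eta> in lborel. norm (f \<eta> * cgauss b (\<eta> - \<xi>)) \<le> norm (A * C * jbr \<eta> powr (-?K))"
      unfolding real_norm_def by (intro AE_I2 order_trans[OF _ abs_ge_self])
  qed measurable
qed

section \<open>Pointwise information from the amalgam norm\<close>

lemma in_W_top_AE:
  assumes "in_W \<phi> top top N a"
  obtains C where "0 \<le> C" "AE x in lborel. AE \<xi> in lborel. norm (stft \<phi> a x \<xi>) * jbr \<xi> powr N \<le> C"
proof -
  define g where "g x \<xi> = ennreal (norm (stft \<phi> a x \<xi>) * jbr \<xi> powr N)" for x \<xi>
  define W where "W = esssup lborel (\<lambda>x. esssup lborel (g x))"
  have "W < top" using assms by (simp add: in_W_def wnorm_def lpnorm_def W_def g_def[abs_def])
  hence W: "W = ennreal (enn2real W)" by simp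
  have "AE x in lborel. esssup lborel (g x) \<le> W" unfolding W_def by (rule esssup_AE)
  hence "AE x in lborel. AE \<xi> in lborel. norm (stft \<phi> a x \<xi>) * jbr \<xi> powr N \<le> enn2real W"
  proof eventually_elim
    case (elim x)
    have "AE \<xi> in lborel. g x \<xi> \<le> esssup lborel (g x)" by (rule esssup_AE)
    thus ?case
    proof eventually_elim
      case (elim \<xi>)
      hence "g x \<xi> \<le> ennreal (enn2real W)" using \<open>esssup lborel (g x) \<le> W\<close> W by simp
      thus ?case unfolding g_def by (subst (asm) ennreal_le_iff) auto
    qed
  qed
  thus thesis by (intro that[of "enn2real W"]) auto
qed

lemma in_W_integrable:
  assumes "in_W \<phi> p q N a"
  shows "integrable lborel (\<lambda>y. a y * cnj (\<phi> (y - x)))"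
proof -
  have "integrable lborel (\<lambda>y. a y * cnj (\<phi> (y - x)) * exp (- (2 * pi * \<i> * complex_of_real (y \<bullet> 0))))"
    using assms unfolding in_W_def by blast
  thus ?thesis by simp
qed

text \<open>Continuity of the transform removes the exceptional set in \<open>\<xi>\<close>. The one
  in \<open>x\<close> is kept: later \<open>x\<close> is either integrated out or treated by
  continuity of the window.\<close>

lemma in_W_top_fourier:
  assumes W: "in_W \<phi> top top N a"
  obtains C where "0 \<le> C"
    "AE x in lborel. \<forall>\<xi>. norm (fourier (\<lambda>y. a y * cnj (\<phi> (y - x))) \<xi>) \<le> C * jbr \<xi> powr (-N)"
proof -
  obtain C where C: "0 \<le> C" "AE x in lborel. AE \<xi> in lborel. norm (stft \<phi> a x \<xi>) * jbr \<xi> powr N \<le> C"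
    using in_W_top_AE[OF W] by blast
  have "AE x in lborel. \<forall>\<xi>. norm (fourier (\<lambda>y. a y * cnj (\<phi> (y - x))) \<xi>) \<le> C * jbr \<xi> powr (-N)"
    using C(2)
  proof eventually_elim
    case (elim x)
    have "continuous_on UNIV (\<lambda>\<xi>. norm (fourier (\<lambda>y. a y * cnj (\<phi> (y - x))) \<xi>) * jbr \<xi> powr N)"
      by (intro continuous_intros continuous_fourier in_W_integrable[OF W])
    from AE_continuous_le[OF this elim[unfolded stft_eq_fourier]]
    show ?case by (simp add: jbr_powr_le_iff mult.commute)
  qed
  thus thesis using that C(1) by blast
qed

lemma norm_le_integral_fourier:
  fixes u :: "real^'n::finite \<Rightarrow> complex"
  assumes u: "integrable lborel u" "continuous_on UNIV u"
    and N: "real CARD('n) < N" and C: "\<And>\<xi>. norm (fourier u \<xi>) \<le> C * jbr \<xi> powr (-N)"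
  shows "norm (u x) \<le> (LINT \<xi>::real^'n|lborel. C * jbr \<xi> powr (-N))"
proof -
  have [measurable]: "fourier u \<in> borel_measurable borel"
    using u by (auto intro!: borel_measurable_continuous_onI continuous_fourier)
  have I: "integrable lborel (\<lambda>\<xi>::real^'n. C * jbr \<xi> powr (-N))"
    by (intro integrable_mult_right integrable_jbr_powr N)
  have Fu: "integrable lborel (fourier u)"
    by (rule Bochner_Integration.integrable_bound[OF I])
      (use order_trans[OF C abs_ge_self] in \<open>auto intro!: AE_I2\<close>)
  have "norm (u x) \<le> (LINT \<xi>|lborel. norm (fourier u \<xi>))"
    using norm_fourier_le[of "fourier u" "-x"] fourier_inversion[OF u Fu, of x] by simp
  also have "\<dots> \<le> (LINT \<xi>::real^'n|lborel. C * jbr \<xi> powr (-N))"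
    using Fu by (intro integral_mono I C) auto
  finally show ?thesis .
qed

text \<open>As \<open>N > n\<close>, the transforms of \<open>a\<close> times a translated window
  are integrable uniformly in almost every \<open>x\<close>, and inversion bounds
  \<open>norm (a \<eta>) * norm (\<phi> (\<eta> - x))\<close>. By continuity this holds for every
  \<open>x\<close>, in particular for \<open>x = \<eta> - z\<close>, where the window does not
  vanish.\<close>

lemma in_W_top_bounded:
  fixes a :: "real^'n::finite \<Rightarrow> complex"
  assumes W: "in_W \<phi> top top N a" and N: "real CARD('n) < N"
    and a: "continuous_on UNIV a" and \<phi>: "continuous_on UNIV \<phi>" "\<phi> z \<noteq> 0"
  obtains C where "0 \<le> C" "\<And>\<eta>. norm (a \<eta>) \<le> C"
proof -
  obtain C where C: "0 \<le> C"
    "AE x in lborel. \<forall>\<xi>. norm (fourier (\<lambda>y. a y * cnj (\<phi> (y - x))) \<xi>) \<le> C * jbr \<xi> powr (-N)"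
    using in_W_top_fourier[OF W] by blast
  define B where "B = (LINT \<xi>::real^'n|lborel. C * jbr \<xi> powr (-N))"
  have \<phi>': "continuous_on UNIV (\<lambda>y. \<phi> (f y))" if "continuous_on UNIV f" for f :: "real^'n \<Rightarrow> real^'n"
    using that by (rule continuous_on_compose2[OF \<phi>(1)]) simp
  have ae: "AE x in lborel. norm (a \<eta>) * norm (\<phi> (\<eta> - x)) \<le> B" for \<eta>
    using C(2)
  proof eventually_elim
    case (elim x)
    have "norm (a \<eta> * cnj (\<phi> (\<eta> - x))) \<le> B"
      unfolding B_def using elim
      by (intro norm_le_integral_fourier[OF in_W_integrable[OF W] _ N]) (auto intro!: continuous_intros a \<phi>')
    thus ?case by (simp add: norm_mult)
  qed
  have "norm (a \<eta>) \<le> B / norm (\<phi> z)" for \<eta>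
  proof -
    have "continuous_on UNIV (\<lambda>x. norm (a \<eta>) * norm (\<phi> (\<eta> - x)))" by (intro continuous_intros \<phi>')
    from AE_continuous_le[OF this ae, of "\<eta> - z"] show ?thesis using \<phi>(2) by (simp add: field_simps)
  qed
  moreover from this[of 0] have "0 \<le> B / norm (\<phi> z)" using norm_ge_zero order_trans by blast
  ultimately show thesis using that by blast
qed

text \<open>The squared L^2 norm of a window is the normalising constant by which the reproducing
  formulas are divided.\<close>

lemma norm_sq_integral_pos:
  fixes \<phi> :: "real^'n::finite \<Rightarrow> complex"
  assumes cont: "continuous_on UNIV \<phi>" and K: "real CARD('n) < K"
    and C: "\<And>x. norm (\<phi> x) \<le> C * jbr x powr (-K)" and nz: "\<phi> z \<noteq> 0"
  shows "integrable lborel (\<lambda>x. (norm (\<phi> x))\<^sup>2)" "0 < (LINT x|lborel. (norm (\<phi> x))\<^sup>2)"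
proof -
  have [measurable]: "\<phi> \<in> borel_measurable borel" using cont by (rule borel_measurable_continuous_onI)
  have sq: "(norm (\<phi> x))\<^sup>2 \<le> C\<^sup>2 * jbr x powr (-K)" for x
  proof -
    have "(norm (\<phi> x))\<^sup>2 \<le> (C * jbr x powr (-K))\<^sup>2" by (intro power_mono C) auto
    also have "\<dots> = C\<^sup>2 * (jbr x powr (-K) * jbr x powr (-K))" by (simp add: power2_eq_square mult_ac)
    also have "\<dots> \<le> C\<^sup>2 * (jbr x powr (-K) * 1)"
      using K by (intro mult_left_mono jbr_powr_le_1) auto
    finally show ?thesis by simp
  qed
  show I: "integrable lborel (\<lambda>x. (norm (\<phi> x))\<^sup>2)"
  proof (rule Bochner_Integration.integrable_bound)
    show "integrable lborel (\<lambda>x::real^'n. C\<^sup>2 * jbr x powr (-K))"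
      by (intro integrable_mult_right integrable_jbr_powr K)
  qed (use sq in auto)
  show "0 < (LINT x|lborel. (norm (\<phi> x))\<^sup>2)"
  proof (rule ccontr)
    assume "\<not> ?thesis"
    moreover have "0 \<le> (LINT x|lborel. (norm (\<phi> x))\<^sup>2)" by (intro integral_nonneg_AE) auto
    ultimately have "(LINT x|lborel. (norm (\<phi> x))\<^sup>2) = 0" by linarith
    hence "AE x in lborel. (norm (\<phi> x))\<^sup>2 = 0"
      using integral_nonneg_eq_0_iff_AE[OF I] by simp
    hence "AE x in lborel. (norm (\<phi> x))\<^sup>2 \<le> 0" by eventually_elim simp
    moreover have "continuous_on UNIV (\<lambda>x. (norm (\<phi> x))\<^sup>2)" by (intro continuous_intros cont)
    ultimately have "(norm (\<phi> z))\<^sup>2 \<le> 0" by (intro AE_continuous_le)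
    thus False using nz by simp
  qed
qed

text \<open>Change of window: \<open>a g\<^sub>u\<close> is an average of the products
  \<open>(a \<phi>\<^sub>x\<^sup>*) (\<phi>\<^sub>x g\<^sub>u)\<close> over all translates \<open>\<phi>\<^sub>x\<close>.\<close>

lemma in_W_top_gauss_window:
  fixes a :: "real^'n::finite \<Rightarrow> complex"
  assumes W: "in_W \<phi> top top N a" and N: "real CARD('n) < N"
    and a: "continuous_on UNIV a" and \<phi>: "schwartz \<phi>" "\<phi> z \<noteq> 0" and b: "0 < b"
  obtains C where "0 < C"
    "\<And>u y. norm (fourier (\<lambda>\<eta>. a \<eta> * cgauss b (\<eta> - u)) y) \<le> C * jbr y powr (-N)"
proof -
  define K where "K = real CARD('n) + 1"
  have K: "0 \<le> K" "real CARD('n) < K" by (auto simp: K_def)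
  have N0: "0 \<le> N" using N by linarith
  have cont: "continuous_on UNIV \<phi>" using pdiffs_continuous[OF \<phi>(1), of "[]"] by simp
  have [measurable]: "\<phi> \<in> borel_measurable borel" "a \<in> borel_measurable borel"
    using cont a by (auto intro: borel_measurable_continuous_onI)
  have \<phi>': "continuous_on UNIV (\<lambda>y. \<phi> (f y))" if "continuous_on UNIV f" for f :: "real^'n \<Rightarrow> real^'n"
    using that by (rule continuous_on_compose2[OF cont]) simp
  define c where "c = (LINT x|lborel. (norm (\<phi> x))\<^sup>2)"
  obtain Ca where Ca: "0 \<le> Ca" "\<And>\<eta>. norm (a \<eta>) \<le> Ca"
    using in_W_top_bounded[OF W N a cont \<phi>(2)] by blast
  obtain Ch where Ch: "0 \<le> Ch"
    "AE x in lborel. \<forall>\<xi>. norm (fourier (\<lambda>y. a y * cnj (\<phi> (y - x))) \<xi>) \<le> Ch * jbr \<xi> powr (-N)"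
    using in_W_top_fourier[OF W] by blast
  obtain Cp where Cp: "0 < Cp" "\<And>x. norm (\<phi> x) \<le> Cp * jbr x powr (-K)"
    using pdiffs_bound[OF \<phi>(1), of "[]"] by (metis pdiffs.simps(1))
  have c: "0 < c" unfolding c_def by (rule norm_sq_integral_pos(2)[OF cont K(2) Cp(2) \<phi>(2)])
  \<comment> \<open>One exponent \<open>N + K\<close> covers two demands: \<open>K\<close> makes the
    average over the translates converge, \<open>N\<close> is the order that
    \<open>fourier_mult_bound\<close> preserves.\<close>
  obtain Cv where Cv: "0 < Cv"
    "\<And>x \<xi>. norm (fourier (\<lambda>y. \<phi> y * cgauss b (y - x)) \<xi>) \<le> Cv * jbr x powr (-(N + K)) * jbr \<xi> powr (-(N + K))"
    by (rule fourier_schwartz_gauss[OF \<phi>(1) b add_nonneg_nonneg[OF N0 K(1)]]; rule that; assumption)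
  obtain Cm where Cm: "0 < Cm"
    "\<forall>(u :: real^'n \<Rightarrow> complex) v A D y. integrable lborel u \<longrightarrow> integrable lborel v \<longrightarrow> continuous_on UNIV v \<longrightarrow>
       (\<forall>z. norm (fourier v z) \<le> A * jbr z powr (-N)) \<longrightarrow> (\<forall>z. norm (fourier u z) \<le> D * jbr z powr (-N)) \<longrightarrow>
       norm (fourier (\<lambda>x. u x * v x) y) \<le> Cm * A * D * jbr y powr (-N)"
    using fourier_mult_bound[OF N N0 order_refl] by (elim exE conjE)
  define I where "I = (LINT x::real^'n|lborel. jbr x powr (-K))"
  have I0: "0 \<le> I" unfolding I_def by (intro integral_nonneg_AE) auto
  have main: "norm (fourier (\<lambda>\<eta>. a \<eta> * cgauss b (\<eta> - u)) y) \<le> (Cm * Cv * Ch * I / c + 1) * jbr y powr (-N)" for u y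
  proof -
    \<comment> \<open>Integrated over \<open>x\<close> first, the two copies of the window give
      \<open>c\<close>. Integrated over \<open>\<eta>\<close> first, one copy goes to
      \<open>a\<close>, where the hypothesis applies, and the other to the Gaussian, forming
      \<open>v x\<close>.\<close>
    define f where "f \<eta> x = a \<eta> * cgauss b (\<eta> - u) * chr (- (\<eta> \<bullet> y)) * (\<phi> (\<eta> - x) * cnj (\<phi> (\<eta> - x)))" for \<eta> x
    have int: "integrable (lborel \<Otimes>\<^sub>M lborel) (\<lambda>(\<eta>, x). f \<eta> x)"
      unfolding f_def
    proof (rule integrable_pair_conv)
      have "integrable lborel (\<lambda>\<eta>. complex_of_real ((norm (\<phi> \<eta>))\<^sup>2))"
        by (intro integrable_of_real norm_sq_integral_pos(1)[OF cont K(2) Cp(2) \<phi>(2)])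
      thus "integrable lborel (\<lambda>\<eta>. \<phi> \<eta> * cnj (\<phi> \<eta>))" by (simp only: complex_norm_square)
      show "integrable lborel (\<lambda>\<eta>. a \<eta> * cgauss b (\<eta> - u) * chr (- (\<eta> \<bullet> y)))"
        by (intro integrable_mult_chr integrable_mult_gauss[OF b a, of Ca 0]) (use Ca in auto)
    qed
    define v where "v x \<eta> = \<phi> (\<eta> - x) * cgauss b (\<eta> - u)" for x \<eta>
    have Fv: "norm (fourier (v x) \<zeta>) \<le> (Cv * jbr (x - u) powr (-K)) * jbr \<zeta> powr (-N)" for x \<zeta>
    proof -
      have "v x = (\<lambda>\<eta>. (\<lambda>y. \<phi> y * cgauss b (y - (u - x))) (\<eta> - x))" by (simp add: v_def[abs_def])
      hence "norm (fourier (v x) \<zeta>) = norm (fourier (\<lambda>y. \<phi> y * cgauss b (y - (u - x))) \<zeta>)"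
        using fourier_translate[of "\<lambda>y. \<phi> y * cgauss b (y - (u - x))" x \<zeta>] by (simp add: norm_mult)
      also have "\<dots> \<le> Cv * jbr (u - x) powr (-(N + K)) * jbr \<zeta> powr (-(N + K))" by (rule Cv)
      also have "\<dots> \<le> Cv * jbr (u - x) powr (-K) * jbr \<zeta> powr (-N)"
        using Cv N0 K by (intro mult_mono jbr_powr_mono order_refl) auto
      finally show ?thesis by (simp add: jbr_minus_commute[of u])
    qed
    have vint: "integrable lborel (v x)" for x
    proof (rule Bochner_Integration.integrable_bound)
      show "integrable lborel (\<lambda>\<eta>. Cp * jbr (\<eta> - x) powr (-K))"
        by (intro integrable_mult_right integrable_jbr_powr_diff K)
      show "v x \<in> borel_measurable lborel" unfolding v_def by measurable
      have "norm (v x \<eta>) \<le> Cp * jbr (\<eta> - x) powr (-K)" for \<eta>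
      proof -
        have "norm (v x \<eta>) \<le> norm (\<phi> (\<eta> - x)) * 1"
          unfolding v_def norm_mult using b by (intro mult_left_mono) (auto simp: gauss_le_1)
        thus ?thesis using Cp(2)[of "\<eta> - x"] by simp
      qed
      thus "AE \<eta> in lborel. norm (v x \<eta>) \<le> norm (Cp * jbr (\<eta> - x) powr (-K))"
        by (intro AE_I2) (simp add: order_trans[OF _ abs_ge_self])
    qed
    have e1: "(LINT x|lborel. f \<eta> x) = complex_of_real c * (a \<eta> * cgauss b (\<eta> - u) * chr (- (\<eta> \<bullet> y)))" for \<eta>
    proof -
      have "(LINT x|lborel. \<phi> (\<eta> - x) * cnj (\<phi> (\<eta> - x))) = (LINT x|lborel. \<phi> x * cnj (\<phi> x))"
        by (rule integral_lborel_reflect(1))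
      also have "\<dots> = complex_of_real c"
        unfolding c_def integral_complex_of_real[symmetric] complex_norm_square[symmetric] by simp
      finally show ?thesis unfolding f_def by (simp add: mult.commute)
    qed
    have e2: "(LINT \<eta>|lborel. f \<eta> x) = fourier (\<lambda>\<eta>. (a \<eta> * cnj (\<phi> (\<eta> - x))) * v x \<eta>) y" for x
      unfolding fourier_chr f_def v_def by (intro Bochner_Integration.integral_cong refl) (simp only: mult_ac)
    have "complex_of_real c * fourier (\<lambda>\<eta>. a \<eta> * cgauss b (\<eta> - u)) y = (LINT \<eta>|lborel. LINT x|lborel. f \<eta> x)"
      unfolding e1 fourier_chr by simp
    also have "\<dots> = (LINT x|lborel. LINT \<eta>|lborel. f \<eta> x)"
      by (rule lborel_pair.Fubini_integral[OF int, symmetric])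
    finally have E: "complex_of_real c * fourier (\<lambda>\<eta>. a \<eta> * cgauss b (\<eta> - u)) y
        = (LINT x|lborel. LINT \<eta>|lborel. f \<eta> x)" .
    have "c * norm (fourier (\<lambda>\<eta>. a \<eta> * cgauss b (\<eta> - u)) y)
        = norm (complex_of_real c * fourier (\<lambda>\<eta>. a \<eta> * cgauss b (\<eta> - u)) y)"
      using c by (simp add: norm_mult)
    also have "\<dots> = norm (LINT x|lborel. LINT \<eta>|lborel. f \<eta> x)" by (simp only: E)
    also have "\<dots> \<le> (LINT x|lborel. norm (LINT \<eta>|lborel. f \<eta> x))" by (rule integral_norm_bound)
    also have "\<dots> \<le> (LINT x|lborel. (Cm * Cv * Ch * jbr y powr (-N)) * jbr (x - u) powr (-K))"
    proof (rule integral_mono_AE)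
      show "integrable lborel (\<lambda>x. norm (LINT \<eta>|lborel. f \<eta> x))"
        by (intro integrable_norm lborel_pair.integrable_snd[OF int])
      show "integrable lborel (\<lambda>x. (Cm * Cv * Ch * jbr y powr (-N)) * jbr (x - u) powr (-K))"
        by (intro integrable_mult_right integrable_jbr_powr_diff K)
      show "AE x in lborel. norm (LINT \<eta>|lborel. f \<eta> x) \<le> (Cm * Cv * Ch * jbr y powr (-N)) * jbr (x - u) powr (-K)"
        using Ch(2)
      proof eventually_elim
        case (elim x)
        have "norm (fourier (\<lambda>\<eta>. (a \<eta> * cnj (\<phi> (\<eta> - x))) * v x \<eta>) y) \<le> Cm * (Cv * jbr (x - u) powr (-K)) * Ch * jbr y powr (-N)"
          by (rule Cm(2)[rule_format, OF in_W_integrable[OF W] vint _ Fv])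
            (use elim in \<open>auto simp: v_def intro!: continuous_intros \<phi>'\<close>)
        thus ?case unfolding e2 by (simp only: mult_ac)
      qed
    qed
    also have "\<dots> = Cm * Cv * Ch * jbr y powr (-N) * I"
      using integral_lborel_translate(1)[of "\<lambda>x. jbr x powr (-K)" "-u"] by (simp add: I_def)
    finally have "norm (fourier (\<lambda>\<eta>. a \<eta> * cgauss b (\<eta> - u)) y) \<le> Cm * Cv * Ch * jbr y powr (-N) * I / c"
      using c by (simp add: pos_le_divide_eq mult.commute)
    also have "\<dots> \<le> (Cm * Cv * Ch * I / c + 1) * jbr y powr (-N)"
      by (simp add: algebra_simps)
    finally show ?thesis .
  qed
  show thesis
  proof (rule that)
    show "0 < Cm * Cv * Ch * I / c + 1" using Cm(1) Cv(1) Ch(1) I0 c by (intro add_nonneg_pos) auto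
  qed (rule main)
qed

section \<open>Localised unimodular factors\<close>

text \<open>The hypotheses of the theorem after the change to Gaussian windows. A locale is
  convenient because it is interpreted twice, for the given phase and for the zero phase; the latter
  is the reason for admitting \<open>s = 0\<close>.\<close>

locale phase_symbol =
  fixes \<mu> :: "real^'n::finite \<Rightarrow> real" and s N :: real
  assumes s: "0 \<le> s" and N: "real CARD('n) < N"
    and der: "\<And>j x. ((\<lambda>t. \<mu> (x + t *\<^sub>R axis j 1)) has_real_derivative pdiff j \<mu> x) (at 0)"
    and cont: "continuous_on UNIV \<mu>"
    and cont_grad: "\<And>j. continuous_on UNIV (pdiff j \<mu>)"
    and grad_bounded: "\<And>j. \<exists>C. \<forall>x. \<bar>jbr x powr (-s) * pdiff j \<mu> x\<bar> \<le> C"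
    and grad_decay: "\<And>j b. 0 < b \<Longrightarrow> \<exists>C>0. \<forall>u y.
      norm (fourier (\<lambda>\<eta>. complex_of_real (jbr \<eta> powr (-s) * pdiff j \<mu> \<eta>) * cgauss b (\<eta> - u)) y)
        \<le> C * jbr y powr (-N)"
begin

definition E :: "real^'n \<Rightarrow> complex" where
  "E \<eta> = exp (\<i> * complex_of_real (\<mu> \<eta>))"

text \<open>All parameters \<open>b\<close> are included because the induction step for
  \<open>b\<close> invokes the hypothesis for \<open>b / 3\<close>.\<close>

definition phase_bound :: "real \<Rightarrow> bool" where
  "phase_bound k \<longleftrightarrow> (\<forall>b>0. \<exists>C>0. \<forall>\<xi> y.
     norm (fourier (\<lambda>\<eta>. E \<eta> * cgauss b (\<eta> - \<xi>)) y) \<le> C * (jbr \<xi> powr s / jbr y) powr k)"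

lemma N0: "0 \<le> N" using N by linarith

lemma norm_E [simp]: "norm (E \<eta>) = 1"
  by (simp add: E_def)

lemma continuous_E: "continuous_on UNIV E"
  unfolding E_def by (intro continuous_intros cont)

lemma E_line_derivative:
  "((\<lambda>t. E (x + t *\<^sub>R axis j 1)) has_vector_derivative \<i> * complex_of_real (pdiff j \<mu> x) * E x) (at 0)"
proof -
  have E: "E \<eta> = complex_of_real (cos (\<mu> \<eta>)) + \<i> * complex_of_real (sin (\<mu> \<eta>))" for \<eta>
    by (simp add: E_def exp_Euler cos_of_real sin_of_real)
  define m where "m t = \<mu> (x + t *\<^sub>R axis j 1)" for t
  have m: "(m has_real_derivative pdiff j \<mu> x) (at 0)" "m 0 = \<mu> x"
    using der[where x = x and j = j] by (simp_all add: m_def[abs_def])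
  have "((\<lambda>t. cos (m t)) has_real_derivative - sin (m 0) * pdiff j \<mu> x) (at 0)"
    by (rule DERIV_chain2[OF DERIV_cos m(1)])
  moreover have "((\<lambda>t. sin (m t)) has_real_derivative cos (m 0) * pdiff j \<mu> x) (at 0)"
    by (rule DERIV_chain2[OF DERIV_sin m(1)])
  ultimately have "((\<lambda>t. complex_of_real (cos (m t)) + \<i> * complex_of_real (sin (m t))) has_vector_derivative
      complex_of_real (- sin (m 0) * pdiff j \<mu> x) + \<i> * complex_of_real (cos (m 0) * pdiff j \<mu> x)) (at 0)"
    by (intro has_vector_derivative_add has_vector_derivative_mult_right has_vector_derivative_of_real)
  thus ?thesis by (simp add: E m(2) m_def[symmetric] algebra_simps)
qed

lemma grad_bounded_uniform:
  obtains C where "0 < C" "\<And>j x. \<bar>jbr x powr (-s) * pdiff j \<mu> x\<bar> \<le> C"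
proof -
  obtain C where C: "\<And>j x. \<bar>jbr x powr (-s) * pdiff j \<mu> x\<bar> \<le> C j" using grad_bounded by metis
  have "\<bar>jbr x powr (-s) * pdiff j \<mu> x\<bar> \<le> 1 + (\<Sum>j\<in>UNIV. \<bar>C j\<bar>)" for j x
    using C[of x j] member_le_sum[of j UNIV "\<lambda>j. \<bar>C j\<bar>"] by simp
  moreover have "0 < 1 + (\<Sum>j\<in>UNIV. \<bar>C j\<bar>)" by (intro add_pos_nonneg sum_nonneg) auto
  ultimately show thesis using that by blast
qed

lemma grad_decay_uniform:
  assumes b: "0 < b"
  obtains C where "0 < C" "\<And>j u y.
      norm (fourier (\<lambda>\<eta>. complex_of_real (jbr \<eta> powr (-s) * pdiff j \<mu> \<eta>) * cgauss b (\<eta> - u)) y)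
        \<le> C * jbr y powr (-N)"
proof -
  have "\<forall>j. \<exists>C>0. \<forall>u y.
      norm (fourier (\<lambda>\<eta>. complex_of_real (jbr \<eta> powr (-s) * pdiff j \<mu> \<eta>) * cgauss b (\<eta> - u)) y)
        \<le> C * jbr y powr (-N)"
    by (intro allI grad_decay[OF b])
  from choice[OF this] obtain C where C: "\<And>j. 0 < C j" "\<And>j u y.
      norm (fourier (\<lambda>\<eta>. complex_of_real (jbr \<eta> powr (-s) * pdiff j \<mu> \<eta>) * cgauss b (\<eta> - u)) y)
        \<le> C j * jbr y powr (-N)"
    by blast
  have "norm (fourier (\<lambda>\<eta>. complex_of_real (jbr \<eta> powr (-s) * pdiff j \<mu> \<eta>) * cgauss b (\<eta> - u)) y)
        \<le> (\<Sum>j\<in>UNIV. C j) * jbr y powr (-N)" for j u y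
    by (rule order_trans[OF C(2)[of j]]) (auto intro!: mult_right_mono member_le_sum less_imp_le[OF C(1)])
  moreover have "0 < (\<Sum>j\<in>UNIV. C j)" by (intro sum_pos C) auto
  ultimately show thesis using that by blast
qed

section \<open>Decay of the localised phase factor, by induction on the order\<close>

lemma integrable_E_gauss:
  assumes "0 < b" shows "integrable lborel (\<lambda>\<eta>. E \<eta> * cgauss b (\<eta> - \<xi>))"
  by (rule integrable_mult_gauss[OF assms continuous_E, of 1 0]) simp

lemma phase_bound_0: "phase_bound 0"
  unfolding phase_bound_def
proof (intro allI impI)
  fix b :: real assume b: "0 < b"
  have "norm (fourier (\<lambda>\<eta>. E \<eta> * cgauss b (\<eta> - \<xi>)) y) \<le> (LINT \<eta>::real^'n|lborel. gauss b \<eta>) + 1" for \<xi> y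
  proof -
    have "norm (fourier (\<lambda>\<eta>. E \<eta> * cgauss b (\<eta> - \<xi>)) y)
        \<le> (LINT \<eta>|lborel. norm (E \<eta> * cgauss b (\<eta> - \<xi>)))" by (rule norm_fourier_le)
    also have "\<dots> = (LINT \<eta>|lborel. gauss b (\<eta> - \<xi>))" by (simp add: norm_mult)
    also have "\<dots> = (LINT \<eta>::real^'n|lborel. gauss b \<eta>)"
      using integral_lborel_translate(1)[of "gauss b :: real^'n \<Rightarrow> real" "-\<xi>"] by simp
    finally show ?thesis by simp
  qed
  moreover have "0 < (LINT \<eta>::real^'n|lborel. gauss b \<eta>) + 1"
    by (intro add_nonneg_pos integral_nonneg_AE) auto
  moreover have "(jbr \<xi> powr s / jbr y) powr 0 = 1" for \<xi> y :: "real^'n" by simp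
  ultimately show "\<exists>C>0. \<forall>\<xi> y. norm (fourier (\<lambda>\<eta>. E \<eta> * cgauss b (\<eta> - \<xi>)) y)
      \<le> C * (jbr \<xi> powr s / jbr y) powr 0"
    by (intro exI[of _ "(LINT \<eta>::real^'n|lborel. gauss b \<eta>) + 1"]) simp
qed

text \<open>A single differentiation, all that a C^1 phase permits. The first summand differentiates
  \<open>E\<close>, the second the Gaussian, and both still contain \<open>E\<close> times a
  Gaussian, which makes the iteration possible.\<close>

lemma phase_deriv:
  assumes b: "0 < b"
  shows "complex_of_real (2 * pi * (y $ j)) * \<i> * fourier (\<lambda>\<eta>. E \<eta> * cgauss b (\<eta> - \<xi>)) y
     = fourier (\<lambda>\<eta>. \<i> * complex_of_real (pdiff j \<mu> \<eta>) * E \<eta> * cgauss b (\<eta> - \<xi>)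
         + complex_of_real (- (2 * b)) * (complex_of_real ((\<eta> - \<xi>) $ j) * E \<eta> * cgauss b (\<eta> - \<xi>))) y"
    (is "_ = fourier ?u' y")
proof -
  define K where "K = real CARD('n) + 1"
  obtain Ca where Ca: "0 < Ca" "\<And>j x. \<bar>jbr x powr (-s) * pdiff j \<mu> x\<bar> \<le> Ca"
    using grad_bounded_uniform by blast
  obtain C0 where C0: "0 < C0" "\<And>\<eta>. jbr \<eta> powr 0 * gauss b (\<eta> - \<xi>) \<le> C0 * jbr \<eta> powr (-K)"
    using jbr_gauss_bound[OF b] by blast
  obtain Cs where Cs: "0 < Cs" "\<And>\<eta>. jbr \<eta> powr s * gauss b (\<eta> - \<xi>) \<le> Cs * jbr \<eta> powr (-K)"
    using jbr_gauss_bound[OF b] by blast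
  obtain C1 where C1: "0 < C1" "\<And>\<eta>. jbr \<eta> powr 1 * gauss b (\<eta> - \<xi>) \<le> C1 * jbr \<eta> powr (-K)"
    using jbr_gauss_bound[OF b] by blast
  have grad: "\<bar>pdiff j \<mu> \<eta>\<bar> \<le> Ca * jbr \<eta> powr s" for \<eta>
    using Ca(2)[of \<eta> j] by (simp add: abs_mult powr_minus divide_simps mult.commute)
  define C where "C = C0 + Ca * Cs + 2 * b * (2 * jbr \<xi> * C1)"
  have "fourier ?u' y = complex_of_real (2 * pi * (y $ j)) * \<i> * fourier (\<lambda>\<eta>. E \<eta> * cgauss b (\<eta> - \<xi>)) y"
  proof (rule fourier_deriv[where K = K and C = C])
    fix x
    have "(\<lambda>t. gauss b (x + t *\<^sub>R axis j 1 - \<xi>)) = (\<lambda>t. gauss b (x - \<xi> + t *\<^sub>R axis j 1))"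
      by (simp add: algebra_simps)
    moreover have "((\<lambda>t. cgauss b (x - \<xi> + t *\<^sub>R axis j 1)) has_vector_derivative
        complex_of_real (- (2 * b) * ((x - \<xi>) $ j) * gauss b (x - \<xi>))) (at 0)"
      by (rule has_vector_derivative_of_real[OF gauss_line_derivative])
    ultimately have "((\<lambda>t. cgauss b (x + t *\<^sub>R axis j 1 - \<xi>)) has_vector_derivative
        complex_of_real (- (2 * b) * ((x - \<xi>) $ j) * gauss b (x - \<xi>))) (at 0)"
      by (simp only: fun_eq_iff)
    from has_vector_derivative_mult[OF E_line_derivative[of x j] this]
    show "((\<lambda>t. E (x + t *\<^sub>R axis j 1) * cgauss b (x + t *\<^sub>R axis j 1 - \<xi>)) has_vector_derivative ?u' x) (at 0)"
      by (simp add: algebra_simps)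
    have g0: "gauss b (x - \<xi>) \<le> C0 * jbr x powr (-K)" using C0(2)[of x] by simp
    have nn: "0 \<le> Ca * Cs" "0 \<le> 2 * b * (2 * jbr \<xi> * C1)" using Ca(1) Cs(1) b C1(1) by auto
    have cc: "C0 * jbr x powr (-K) \<le> C * jbr x powr (-K)"
      unfolding C_def using nn by (intro mult_right_mono) auto
    show "norm (E x * cgauss b (x - \<xi>)) \<le> C * jbr x powr (-K)"
      using order_trans[OF g0 cc] by (simp add: norm_mult)
    have t1: "\<bar>pdiff j \<mu> x\<bar> * gauss b (x - \<xi>) \<le> Ca * Cs * jbr x powr (-K)"
    proof -
      have "\<bar>pdiff j \<mu> x\<bar> * gauss b (x - \<xi>) \<le> Ca * (jbr x powr s * gauss b (x - \<xi>))"
        using mult_right_mono[OF grad, of "gauss b (x - \<xi>)" x] by (simp add: mult.assoc)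
      also have "\<dots> \<le> Ca * (Cs * jbr x powr (-K))" using Ca(1) Cs(2)[of x] by (intro mult_left_mono) auto
      finally show ?thesis by (simp add: mult.assoc)
    qed
    have t2: "\<bar>(x - \<xi>) $ j\<bar> * gauss b (x - \<xi>) \<le> 2 * jbr \<xi> * C1 * jbr x powr (-K)"
    proof -
      have "\<bar>(x - \<xi>) $ j\<bar> \<le> jbr (x - \<xi>)" using component_le_norm_cart[of "x - \<xi>" j] norm_le_jbr[of "x - \<xi>"] by linarith
      also have "\<dots> \<le> 2 * (jbr x * jbr \<xi>)" using jbr_add_le_mult[of x "-\<xi>"] by simp
      finally have "\<bar>(x - \<xi>) $ j\<bar> * gauss b (x - \<xi>) \<le> 2 * (jbr x * jbr \<xi>) * gauss b (x - \<xi>)"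
        by (intro mult_right_mono) auto
      also have "\<dots> = 2 * jbr \<xi> * (jbr x powr 1 * gauss b (x - \<xi>))" by simp
      also have "\<dots> \<le> 2 * jbr \<xi> * (C1 * jbr x powr (-K))" using C1(2)[of x] by (intro mult_left_mono) auto
      finally show ?thesis by (simp add: mult.assoc)
    qed
    have "norm (?u' x) \<le> \<bar>pdiff j \<mu> x\<bar> * gauss b (x - \<xi>) + 2 * b * (\<bar>(x - \<xi>) $ j\<bar> * gauss b (x - \<xi>))"
      using norm_triangle_ineq[of "\<i> * complex_of_real (pdiff j \<mu> x) * E x * cgauss b (x - \<xi>)"
          "complex_of_real (- (2 * b)) * (complex_of_real ((x - \<xi>) $ j) * E x * cgauss b (x - \<xi>))"] b
      by (simp only: norm_mult norm_of_real norm_ii norm_E abs_minus_cancel mult_1_left mult_1_right abs_of_pos[OF gauss_pos]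
          abs_of_pos[of "2 * b"] zero_less_mult_iff)
    also have "\<dots> \<le> Ca * Cs * jbr x powr (-K) + 2 * b * (2 * jbr \<xi> * C1 * jbr x powr (-K))"
      using b by (intro add_mono t1 mult_left_mono t2) auto
    also have "\<dots> \<le> C * jbr x powr (-K)" using C0(1) by (simp add: C_def algebra_simps)
    finally show "norm (?u' x) \<le> C * jbr x powr (-K)" .
  qed (auto simp: K_def intro!: continuous_intros continuous_E cont_grad)
  thus ?thesis by simp
qed

text \<open>With \<open>g = g' g' g'\<close> the derivative of \<open>E g\<close> is \<open>E g'\<close> times factors whose Fourier
  transforms are \<open>O(\<langle>\<xi>\<rangle>\<^sup>s \<langle>y\<rangle>\<^sup>-\<^sup>N)\<close>, and convolution with \<open>\<langle>y\<rangle>\<^sup>-\<^sup>N\<close> preserves a decay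
  of any order \<open>k \<le> N\<close>. So each step gains a factor \<open>\<langle>\<xi>\<rangle>\<^sup>s / \<langle>y\<rangle>\<close>.\<close>

lemma phase_bound_step:
  assumes k: "0 \<le> k" "k \<le> N" and IH: "phase_bound k"
  shows "phase_bound (k + 1)"
  unfolding phase_bound_def
proof (intro allI impI)
  fix b :: real assume b: "0 < b"
  \<comment> \<open>The phase term has three factors: \<open>E\<close>, the normalised gradient of
    order zero, and the weight \<open>jbr \<eta> powr s\<close>. Each receives a Gaussian of
    parameter \<open>b / 3\<close>. In the window term \<open>E\<close> keeps one third, and the
    coordinate factor takes the other two.\<close>
  define b3 where "b3 = b / 3"
  have b3: "0 < b3" "0 < 2 * b3" using b by (auto simp: b3_def)
  obtain Cb where Cb: "0 < Cb" "\<And>\<xi> y. norm (fourier (\<lambda>\<eta>. E \<eta> * cgauss b (\<eta> - \<xi>)) y)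
      \<le> Cb * (jbr \<xi> powr s / jbr y) powr k"
    using IH b unfolding phase_bound_def by blast
  obtain C3 where C3: "0 < C3" "\<And>\<xi> y. norm (fourier (\<lambda>\<eta>. E \<eta> * cgauss b3 (\<eta> - \<xi>)) y)
      \<le> C3 * (jbr \<xi> powr s / jbr y) powr k"
    using IH b3(1) unfolding phase_bound_def by blast
  obtain Ca where Ca: "0 < Ca" "\<And>j x. \<bar>jbr x powr (-s) * pdiff j \<mu> x\<bar> \<le> Ca"
    using grad_bounded_uniform by blast
  obtain Cd where Cd: "0 < Cd" "\<And>j u y.
      norm (fourier (\<lambda>\<eta>. complex_of_real (jbr \<eta> powr (-s) * pdiff j \<mu> \<eta>) * cgauss b3 (\<eta> - u)) y)
        \<le> Cd * jbr y powr (-N)"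
    by (rule grad_decay_uniform[OF b3(1)]; rule that; assumption)
  obtain Cj where Cj: "0 < Cj"
    "\<And>(a::real^'n) y. norm (fourier (\<lambda>x. complex_of_real (jbr x powr s) * cgauss b3 (x - a)) y)
        \<le> Cj * jbr a powr s * jbr y powr (-N)"
    by (rule fourier_jbr_gauss[OF b3(1) N0]; rule that; assumption)
  obtain Cc where Cc: "0 < Cc"
    "\<And>j (a::real^'n) y. norm (fourier (\<lambda>x. complex_of_real ((x - a) $ j) * cgauss (2 * b3) (x - a)) y)
        \<le> Cc * jbr y powr (-N)"
    by (rule fourier_coord_gauss[OF b3(2) N0]; rule that; assumption)
  obtain Cm where Cm: "0 < Cm"
    "\<forall>(u :: real^'n \<Rightarrow> complex) v A D y. integrable lborel u \<longrightarrow> integrable lborel v \<longrightarrow> continuous_on UNIV v \<longrightarrow>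
       (\<forall>z. norm (fourier v z) \<le> A * jbr z powr (-N)) \<longrightarrow> (\<forall>z. norm (fourier u z) \<le> D * jbr z powr (-N)) \<longrightarrow>
       norm (fourier (\<lambda>x. u x * v x) y) \<le> Cm * A * D * jbr y powr (-N)"
    using fourier_mult_bound[OF N N0 order_refl] by (elim exE conjE)
  obtain Ck where Ck: "0 < Ck"
    "\<forall>(u :: real^'n \<Rightarrow> complex) v A D y. integrable lborel u \<longrightarrow> integrable lborel v \<longrightarrow> continuous_on UNIV v \<longrightarrow>
       (\<forall>z. norm (fourier v z) \<le> A * jbr z powr (-N)) \<longrightarrow> (\<forall>z. norm (fourier u z) \<le> D * jbr z powr (-k)) \<longrightarrow>
       norm (fourier (\<lambda>x. u x * v x) y) \<le> Ck * A * D * jbr y powr (-k)"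
    using fourier_mult_bound[OF N k] by (elim exE conjE)
  \<comment> \<open>The first summand comes from the derivative of the phase, the second from that
    of the Gaussian.\<close>
  define T where "T = Ck * (Cm * Cj * Cd) * C3 + 2 * b * (Ck * Cc * C3)"
  have T: "0 < T" using Ck(1) Cm(1) Cj(1) Cd(1) C3(1) b Cc(1) by (auto simp: T_def intro!: add_pos_pos)
  define n where "n = real CARD('n)"
  have "norm (fourier (\<lambda>\<eta>. E \<eta> * cgauss b (\<eta> - \<xi>)) y) \<le> (Cb + n * T) * (jbr \<xi> powr s / jbr y) powr (k + 1)" for \<xi> y
  proof -
    define lam where "lam = jbr \<xi> powr s"
    have lam: "1 \<le> lam" unfolding lam_def by (rule jbr_powr_ge_1[OF s])
    have q: "(lam / jbr z) powr k = lam powr k * jbr z powr (-k)" for z :: "real^'n"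
      using lam by (simp add: powr_divide powr_minus_divide)
    define w where "w \<eta> = E \<eta> * cgauss b3 (\<eta> - \<xi>)" for \<eta>
    have wint: "integrable lborel w" unfolding w_def by (rule integrable_E_gauss[OF b3(1)])
    have Fw: "norm (fourier w z) \<le> (C3 * lam powr k) * jbr z powr (-k)" for z
      using C3(2)[of \<xi> z] unfolding w_def[abs_def] lam_def[symmetric] q by (simp only: mult.assoc)
    define a where "a j \<eta> = complex_of_real (jbr \<eta> powr (-s) * pdiff j \<mu> \<eta>) * cgauss b3 (\<eta> - \<xi>)" for j \<eta>
    define p where "p \<eta> = complex_of_real (jbr \<eta> powr s) * cgauss b3 (\<eta> - \<xi>)" for \<eta>
    define r where "r j \<eta> = complex_of_real ((\<eta> - \<xi>) $ j) * cgauss (2 * b3) (\<eta> - \<xi>)" for j \<eta>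
    have aint: "integrable lborel (a j)" for j
      unfolding a_def
    proof (rule integrable_mult_gauss[OF b3(1), where A = Ca and s = 0])
      show "continuous_on UNIV (\<lambda>\<eta>. complex_of_real (jbr \<eta> powr (-s) * pdiff j \<mu> \<eta>))"
        by (intro continuous_intros cont_grad)
      show "norm (complex_of_real (jbr \<eta> powr (-s) * pdiff j \<mu> \<eta>)) \<le> Ca * jbr \<eta> powr 0" for \<eta>
        using Ca(2)[of \<eta> j] by (simp only: norm_of_real) simp
    qed
    have acont: "continuous_on UNIV (a j)" for j unfolding a_def by (intro continuous_intros cont_grad)
    have pint: "integrable lborel p" unfolding p_def
      by (rule integrable_mult_gauss[OF b3(1), where A = 1 and s = s]) (auto intro!: continuous_intros)
    have pcont: "continuous_on UNIV p" unfolding p_def by (intro continuous_intros)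
    have rint: "integrable lborel (r j)" for j
    proof -
      have "integrable lborel (\<lambda>\<eta>. complex_of_real (\<eta> $ j) * cgauss (2 * b3) (\<eta> - 0))"
      proof (rule integrable_mult_gauss[OF b3(2), where A = 1 and s = 1])
        show "norm (complex_of_real (\<eta> $ j)) \<le> 1 * jbr \<eta> powr 1" for \<eta> :: "real^'n"
          using component_le_norm_cart[of \<eta> j] norm_le_jbr[of \<eta>] by simp
      qed (intro continuous_intros)
      from integral_lborel_translate(2)[of "\<lambda>\<eta>. complex_of_real (\<eta> $ j) * cgauss (2 * b3) \<eta>" "-\<xi>"] this
      show ?thesis unfolding r_def by simp
    qed
    have rcont: "continuous_on UNIV (r j)" for j unfolding r_def by (intro continuous_intros)
    have Fv1: "norm (fourier (\<lambda>\<eta>. a j \<eta> * p \<eta>) z) \<le> (Cm * Cj * Cd * lam) * jbr z powr (-N)" for j z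
    proof -
      have "norm (fourier (\<lambda>\<eta>. a j \<eta> * p \<eta>) z) \<le> Cm * (Cj * lam) * Cd * jbr z powr (-N)"
        by (rule Cm(2)[rule_format, OF aint pint pcont])
          (use Cj(2)[of \<xi>] Cd(2)[of j \<xi>] in \<open>simp_all add: a_def[abs_def] p_def[abs_def] lam_def\<close>)
      thus ?thesis by (simp only: mult_ac)
    qed
    have v1int: "integrable lborel (\<lambda>\<eta>. a j \<eta> * p \<eta>)" for j
    proof -
      have "integrable lborel (\<lambda>\<eta>. complex_of_real (jbr \<eta> powr (-s) * pdiff j \<mu> \<eta>) * cgauss b3 (\<eta> - \<xi>)
          * complex_of_real (jbr \<eta> powr s) * cgauss b3 (\<eta> - \<xi>))"
      proof (rule integrable_mult_gauss[OF b3(1), where A = Ca and s = s])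
        show "continuous_on UNIV (\<lambda>\<eta>. complex_of_real (jbr \<eta> powr (-s) * pdiff j \<mu> \<eta>) * cgauss b3 (\<eta> - \<xi>)
          * complex_of_real (jbr \<eta> powr s))" by (intro continuous_intros cont_grad)
        fix \<eta>
        have "\<bar>jbr \<eta> powr (-s) * pdiff j \<mu> \<eta>\<bar> * gauss b3 (\<eta> - \<xi>) * jbr \<eta> powr s \<le> Ca * 1 * jbr \<eta> powr s"
          using Ca b3(1) by (intro mult_right_mono mult_mono gauss_le_1) auto
        thus "norm (complex_of_real (jbr \<eta> powr (-s) * pdiff j \<mu> \<eta>) * cgauss b3 (\<eta> - \<xi>)
          * complex_of_real (jbr \<eta> powr s)) \<le> Ca * jbr \<eta> powr s"
          by (simp only: norm_mult norm_of_real) simp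
      qed
      thus ?thesis unfolding a_def p_def by (simp only: mult.assoc)
    qed
    have v1cont: "continuous_on UNIV (\<lambda>\<eta>. a j \<eta> * p \<eta>)" for j by (intro continuous_intros acont pcont)
    have T1: "norm (fourier (\<lambda>\<eta>. w \<eta> * (a j \<eta> * p \<eta>)) y) \<le> Ck * (Cm * Cj * Cd * lam) * (C3 * lam powr k) * jbr y powr (-k)" for j
      by (rule Ck(2)[rule_format, OF wint v1int v1cont Fv1 Fw])
    have T2: "norm (fourier (\<lambda>\<eta>. w \<eta> * r j \<eta>) y) \<le> Ck * Cc * (C3 * lam powr k) * jbr y powr (-k)" for j
      by (rule Ck(2)[rule_format, OF wint rint rcont _ Fw]) (use Cc(2)[of \<xi> j] in \<open>simp add: r_def[abs_def]\<close>)
    have wv1: "integrable lborel (\<lambda>\<eta>. w \<eta> * (a j \<eta> * p \<eta>))" for j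
    proof (rule Bochner_Integration.integrable_bound[OF v1int[of j]])
      have "norm (w \<eta>) \<le> 1" for \<eta> using b3(1) by (simp add: w_def norm_mult gauss_le_1)
      thus "AE \<eta> in lborel. norm (w \<eta> * (a j \<eta> * p \<eta>)) \<le> norm (a j \<eta> * p \<eta>)"
        by (intro AE_I2) (simp add: norm_mult[of "w _"] mult_left_le_one_le)
      show "(\<lambda>\<eta>. w \<eta> * (a j \<eta> * p \<eta>)) \<in> borel_measurable lborel"
        using borel_measurable_integrable[OF wint] borel_measurable_integrable[OF v1int[of j]] by (rule borel_measurable_times)
    qed
    have wr: "integrable lborel (\<lambda>\<eta>. w \<eta> * r j \<eta>)" for j
    proof (rule Bochner_Integration.integrable_bound[OF rint[of j]])
      have "norm (w \<eta>) \<le> 1" for \<eta> using b3(1) by (simp add: w_def norm_mult gauss_le_1)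
      thus "AE \<eta> in lborel. norm (w \<eta> * r j \<eta>) \<le> norm (r j \<eta>)"
        by (intro AE_I2) (simp add: norm_mult[of "w _"] mult_left_le_one_le)
      show "(\<lambda>\<eta>. w \<eta> * r j \<eta>) \<in> borel_measurable lborel"
        using borel_measurable_integrable[OF wint] borel_measurable_integrable[OF rint[of j]] by (rule borel_measurable_times)
    qed
    define X where "X = norm (fourier (\<lambda>\<eta>. E \<eta> * cgauss b (\<eta> - \<xi>)) y)"
    define Y where "Y = lam * (lam powr k * jbr y powr (-k))"
    have Y0: "0 \<le> Y" using lam by (simp add: Y_def)
    have coord: "\<bar>y $ j\<bar> * X \<le> T * Y" for j
    proof -
      have g3: "cgauss b z = cgauss b3 z * (cgauss b3 z * cgauss b3 z)"
        "cgauss b z = cgauss b3 z * cgauss (2 * b3) z" for z :: "real^'n"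
        by (simp_all add: gauss_mult b3_def flip: of_real_mult)
      have jj: "complex_of_real (jbr \<eta> powr (-s) * pdiff j \<mu> \<eta>) * complex_of_real (jbr \<eta> powr s) = complex_of_real (pdiff j \<mu> \<eta>)" for \<eta>
        by (simp add: powr_minus flip: of_real_mult)
      have e1: "\<i> * complex_of_real (pdiff j \<mu> \<eta>) * E \<eta> * cgauss b (\<eta> - \<xi>) = \<i> * (w \<eta> * (a j \<eta> * p \<eta>))" for \<eta>
        unfolding jj[symmetric, of \<eta>] g3(1) w_def a_def p_def by (simp only: mult_ac)
      have e2: "complex_of_real ((\<eta> - \<xi>) $ j) * E \<eta> * cgauss b (\<eta> - \<xi>) = w \<eta> * r j \<eta>" for \<eta>
        unfolding g3(2) w_def r_def by (simp only: mult_ac)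
      have "complex_of_real (2 * pi * (y $ j)) * \<i> * fourier (\<lambda>\<eta>. E \<eta> * cgauss b (\<eta> - \<xi>)) y
          = fourier (\<lambda>\<eta>. \<i> * (w \<eta> * (a j \<eta> * p \<eta>)) + complex_of_real (- (2 * b)) * (w \<eta> * r j \<eta>)) y"
        using phase_deriv[OF b, of y j \<xi>] by (simp only: e1 e2)
      also have "\<dots> = \<i> * fourier (\<lambda>\<eta>. w \<eta> * (a j \<eta> * p \<eta>)) y + complex_of_real (- (2 * b)) * fourier (\<lambda>\<eta>. w \<eta> * r j \<eta>) y"
        unfolding fourier_cmult[symmetric] by (intro fourier_add integrable_mult_right wv1 wr)
      finally have "norm (complex_of_real (2 * pi * (y $ j)) * \<i> * fourier (\<lambda>\<eta>. E \<eta> * cgauss b (\<eta> - \<xi>)) y)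
          \<le> norm (\<i> * fourier (\<lambda>\<eta>. w \<eta> * (a j \<eta> * p \<eta>)) y) + norm (complex_of_real (- (2 * b)) * fourier (\<lambda>\<eta>. w \<eta> * r j \<eta>) y)"
        by (simp only: norm_triangle_ineq)
      hence "\<bar>2 * pi * (y $ j)\<bar> * X \<le> norm (fourier (\<lambda>\<eta>. w \<eta> * (a j \<eta> * p \<eta>)) y) + 2 * b * norm (fourier (\<lambda>\<eta>. w \<eta> * r j \<eta>) y)"
        using b unfolding X_def by (simp only: norm_mult norm_of_real norm_ii mult_1_left mult_1_right abs_minus_cancel)
      also have "\<dots> \<le> Ck * (Cm * Cj * Cd * lam) * (C3 * lam powr k) * jbr y powr (-k)
          + 2 * b * (Ck * Cc * (C3 * lam powr k) * jbr y powr (-k))"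
        using b by (intro add_mono mult_left_mono T1 T2) auto
      \<comment> \<open>The window term lacks the factor \<open>lam\<close> of the phase term; it
        may be inserted because \<open>1 <= lam\<close>.\<close>
      also have "\<dots> \<le> Ck * (Cm * Cj * Cd * lam) * (C3 * lam powr k) * jbr y powr (-k)
          + 2 * b * (Ck * Cc * (C3 * lam powr k) * jbr y powr (-k)) * lam"
      proof -
        have "0 \<le> 2 * b * (Ck * Cc * (C3 * lam powr k) * jbr y powr (-k))" using b Ck(1) Cc(1) C3(1) by simp
        from mult_left_mono[OF lam this] show ?thesis by simp
      qed
      also have "\<dots> = T * Y" by (simp add: T_def Y_def algebra_simps)
      finally have 1: "\<bar>2 * pi * (y $ j)\<bar> * X \<le> T * Y" .
      have "\<bar>y $ j\<bar> * X \<le> \<bar>2 * pi * (y $ j)\<bar> * X"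
        using pi_gt3 by (intro mult_right_mono) (auto simp: abs_mult mult_le_cancel_right1 X_def)
      thus ?thesis using 1 by linarith
    qed
    have X1: "X \<le> Cb * Y"
    proof -
      have "X \<le> Cb * (lam powr k * jbr y powr (-k))"
        using Cb(2)[of \<xi> y] unfolding X_def lam_def[symmetric] q .
      also have "\<dots> = Cb * (1 * (lam powr k * jbr y powr (-k)))" by simp
      also have "\<dots> \<le> Cb * (lam * (lam powr k * jbr y powr (-k)))"
        using lam Cb(1) by (intro mult_left_mono mult_right_mono) auto
      finally show ?thesis by (simp add: Y_def)
    qed
    \<comment> \<open>Near \<open>y = 0\<close> the coordinates gain nothing, so the bound
      \<open>X1\<close> for \<open>X\<close> itself is added to the coordinate bounds.\<close>
    have "jbr y * X \<le> (1 + (\<Sum>j\<in>UNIV. \<bar>y $ j\<bar>)) * X"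
      using jbr_le[of y] norm_le_l1_cart[of y] by (intro mult_right_mono) (auto simp: X_def)
    also have "\<dots> = X + (\<Sum>j\<in>UNIV. \<bar>y $ j\<bar> * X)" by (simp add: distrib_right sum_distrib_right)
    also have "\<dots> \<le> Cb * Y + (\<Sum>j\<in>(UNIV::'n set). T * Y)" by (intro add_mono X1 sum_mono coord)
    also have "\<dots> = (Cb + n * T) * Y" by (simp add: n_def algebra_simps)
    finally have "X \<le> (Cb + n * T) * (Y / jbr y)" by (simp add: field_simps)
    also have "Y / jbr y = (lam / jbr y) powr (k + 1)"
      using lam by (simp add: Y_def powr_add powr_divide powr_minus_divide)
    finally show ?thesis by (simp add: X_def lam_def)
  qed
  moreover have "0 < Cb + n * T" using Cb(1) T by (simp add: n_def add_pos_nonneg)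
  ultimately show "\<exists>C>0. \<forall>\<xi> y. norm (fourier (\<lambda>\<eta>. E \<eta> * cgauss b (\<eta> - \<xi>)) y)
      \<le> C * (jbr \<xi> powr s / jbr y) powr (k + 1)" by blast
qed

text \<open>The step is available from every \<open>k <= N\<close>, so all integers up to
  \<open>N + 1\<close> are reached; this is enough to enclose \<open>N\<close> between two of
  them.\<close>

lemma phase_bound_nat: "real k \<le> N + 1 \<Longrightarrow> phase_bound (real k)"
proof (induction k)
  case 0
  show ?case using phase_bound_0 by simp
next
  case (Suc k)
  thus ?case using phase_bound_step[of "real k"] by (simp add: add.commute)
qed

text \<open>For non-integer \<open>N\<close> the two neighbouring integer orders are combined. With
  \<open>q = jbr \<xi> powr s / jbr y\<close>, the lower order is the better one where
  \<open>q >= 1\<close> and the upper one where \<open>q < 1\<close>; in either case the result is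
  at most a multiple of \<open>q powr N\<close>.\<close>

lemma fourier_phase_gauss:
  assumes b: "0 < b"
  obtains C where "0 < C" "\<And>\<xi> y. norm (fourier (\<lambda>\<eta>. E \<eta> * cgauss b (\<eta> - \<xi>)) y)
      \<le> C * jbr \<xi> powr (s * N) * jbr y powr (-N)"
proof -
  define k where "k = nat \<lfloor>N\<rfloor>"
  have k: "real k \<le> N" "N \<le> real (Suc k)" using N0 by (auto simp: k_def) linarith+
  obtain C1 where C1: "0 < C1" "\<And>\<xi> y. norm (fourier (\<lambda>\<eta>. E \<eta> * cgauss b (\<eta> - \<xi>)) y)
      \<le> C1 * (jbr \<xi> powr s / jbr y) powr real k"
    using phase_bound_nat[of k] k b unfolding phase_bound_def by force
  obtain C2 where C2: "0 < C2" "\<And>\<xi> y. norm (fourier (\<lambda>\<eta>. E \<eta> * cgauss b (\<eta> - \<xi>)) y)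
      \<le> C2 * (jbr \<xi> powr s / jbr y) powr real (Suc k)"
    using phase_bound_nat[of "Suc k"] k b unfolding phase_bound_def by force
  have "norm (fourier (\<lambda>\<eta>. E \<eta> * cgauss b (\<eta> - \<xi>)) y)
      \<le> (C1 + C2) * jbr \<xi> powr (s * N) * jbr y powr (-N)" for \<xi> y
  proof -
    define q where "q = jbr \<xi> powr s / jbr y"
    have q: "0 < q" by (simp add: q_def)
    have qN: "q powr N = jbr \<xi> powr (s * N) * jbr y powr (-N)"
      by (simp add: q_def powr_divide powr_powr powr_minus_divide)
    have "norm (fourier (\<lambda>\<eta>. E \<eta> * cgauss b (\<eta> - \<xi>)) y) \<le> (C1 + C2) * q powr N"
    proof (cases "1 \<le> q")
      case True
      have "C1 * q powr real k \<le> (C1 + C2) * q powr N"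
        using True k C1(1) C2(1) by (intro mult_mono powr_mono) auto
      thus ?thesis using C1(2)[of \<xi> y] by (simp add: q_def)
    next
      case False
      have "C2 * q powr real (Suc k) \<le> (C1 + C2) * q powr N"
        using False q k C1(1) C2(1) by (intro mult_mono powr_mono') auto
      thus ?thesis using C2(2)[of \<xi> y] unfolding q_def by linarith
    qed
    thus ?thesis by (simp add: qN mult.assoc)
  qed
  thus thesis using that[of "C1 + C2"] C1(1) C2(1) by (simp add: add_pos_pos)
qed

end

section \<open>The multiplier as an integral operator in phase space\<close>

lemma schwartz_continuous: "schwartz f \<Longrightarrow> continuous_on UNIV f"
  using pdiffs_continuous[of f "[]"] by simp

lemma schwartz_bound:
  assumes "schwartz f"
  obtains C where "0 < C" "\<And>x. norm (f x) \<le> C * jbr x powr (-K)"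
  by (rule pdiffs_bound[OF assms, of "[]" K]) (simp add: that)

lemma integrable_of_jbr_bound:
  fixes u :: "real^'n::finite \<Rightarrow> complex"
  assumes u: "continuous_on UNIV u" "\<And>x. norm (u x) \<le> C * jbr x powr (-K)" and K: "real CARD('n) < K"
  shows "integrable lborel u"
proof (rule Bochner_Integration.integrable_bound)
  show "integrable lborel (\<lambda>x::real^'n. C * jbr x powr (-K))"
    by (intro integrable_mult_right integrable_jbr_powr K)
  show "u \<in> borel_measurable lborel" using u(1) by (simp add: borel_measurable_continuous_onI)
  show "AE x in lborel. norm (u x) \<le> norm (C * jbr x powr (-K))"
    unfolding real_norm_def by (intro AE_I2 order_trans[OF u(2) abs_ge_self])
qed

lemma schwartz_integrable:
  assumes f: "schwartz (f :: real^'n::finite \<Rightarrow> complex)"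
  shows "integrable lborel f"
proof -
  obtain C where "\<And>x. norm (f x) \<le> C * jbr x powr (-(real CARD('n) + 1))"
    using schwartz_bound[OF f] by blast
  thus ?thesis by (rule integrable_of_jbr_bound[OF schwartz_continuous[OF f]]) simp
qed

lemma fourier_schwartz_decay:
  assumes f: "schwartz (f :: real^'n::finite \<Rightarrow> complex)" and M: "0 \<le> M"
  obtains C where "0 < C" "\<And>\<xi>. norm (fourier f \<xi>) \<le> C * jbr \<xi> powr (-M)"
proof -
  let ?K = "real CARD('n) + 1"
  obtain m C where C: "0 < C"
    "\<forall>A a (u :: real^'n \<Rightarrow> complex) y. 0 \<le> A \<longrightarrow>
       (\<forall>j. dbnd m j (\<lambda>x. A * jbr (x - a) powr (-?K)) u) \<longrightarrow>
       norm (fourier u y) \<le> C * A * jbr y powr (-M)"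
    using fourier_decay_uniform[OF M] by (elim exE conjE)
  obtain A where A: "0 < A" "\<And>j. dbnd m j (\<lambda>x. A * jbr x powr (-?K)) (pdiffs [] f)"
    by (rule dbnd_uniform[OF dbnd_schwartz[OF f] powr_ge_zero]; rule that; assumption)
  have "norm (fourier f \<xi>) \<le> C * A * jbr \<xi> powr (-M)" for \<xi>
    by (rule C(2)[rule_format, where a = 0]) (use A in simp_all)
  thus thesis using that[of "C * A"] A(1) C(1) by simp
qed

lemma fourier_schwartz_integrable:
  assumes f: "schwartz (f :: real^'n::finite \<Rightarrow> complex)"
  shows "integrable lborel (fourier f)"
proof -
  obtain C where "\<And>x. norm (fourier f x) \<le> C * jbr x powr (-(real CARD('n) + 1))"
    by (rule fourier_schwartz_decay[OF f, of "real CARD('n) + 1"]) auto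
  thus ?thesis
    by (rule integrable_of_jbr_bound[OF continuous_fourier[OF schwartz_integrable[OF f]]]) simp
qed

lemma fourier_gauss_pi: "fourier (\<lambda>x::real^'n::finite. cgauss pi x) \<xi> = cgauss pi \<xi>"
  using fourier_gauss[of pi \<xi>] by (simp add: power2_eq_square)

section \<open>Short-time transforms on the frequency side\<close>

text \<open>The fundamental identity of time-frequency analysis: up to a phase, windowing
  \<open>fourier \<phi>\<close> by a Gaussian is windowing \<open>\<phi>\<close> by the dual
  Gaussian with the two variables exchanged. The parameter \<open>pi\<close> makes the Gaussian its
  own transform. Decay for products with \<open>fourier \<phi>\<close> thus follows from the
  Schwartz property of \<open>\<phi>\<close> itself.\<close>

lemma fourier_gauss_mult_fourier:
  fixes \<phi> :: "real^'n::finite \<Rightarrow> complex"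
  assumes \<phi>: "integrable lborel \<phi>"
  shows "fourier (\<lambda>\<eta>. cgauss pi (\<eta> - u) * fourier \<phi> (\<eta> - \<xi>)) y
       = chr (- (u \<bullet> y)) * fourier (\<lambda>t. \<phi> t * cgauss pi (t - (- y))) (u - \<xi>)"
proof -
  define g where "g \<eta> = cgauss pi (\<eta> - u) * chr (\<eta> \<bullet> (- y))" for \<eta> :: "real^'n"
  define h where "h t = \<phi> t * chr (t \<bullet> \<xi>)" for t
  have gint: "integrable lborel g"
  proof -
    have "integrable lborel (\<lambda>\<eta>::real^'n. cgauss pi \<eta>)"
      by (intro integrable_of_real integrable_gauss) simp
    hence "integrable lborel (\<lambda>\<eta>::real^'n. cgauss pi (\<eta> - u))"
      using integral_lborel_translate(2)[of "\<lambda>\<eta>::real^'n. cgauss pi \<eta>" "-u"] by simp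
    thus ?thesis unfolding g_def by (intro integrable_mult_chr) auto
  qed
  have hint: "integrable lborel h" unfolding h_def by (intro integrable_mult_chr \<phi>) auto
  have Fh: "fourier h \<eta> = fourier \<phi> (\<eta> - \<xi>)" for \<eta> unfolding h_def by (rule fourier_modulate)
  have Fg: "fourier g t = chr (- (u \<bullet> (t + y))) * cgauss pi (t + y)" for t
    unfolding g_def fourier_modulate fourier_translate[of "\<lambda>\<eta>. cgauss pi \<eta>"] fourier_gauss_pi by simp
  have "fourier (\<lambda>\<eta>. cgauss pi (\<eta> - u) * fourier \<phi> (\<eta> - \<xi>)) y = (LINT \<eta>|lborel. g \<eta> * fourier h \<eta>)"
    by (simp add: fourier_chr[of _ y] Fh g_def mult_ac)
  also have "\<dots> = (LINT t|lborel. h t * fourier g t)"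
    by (rule fourier_multiplication_formula[OF gint hint])
  also have "\<dots> = (LINT t|lborel. chr (- (u \<bullet> y)) * (\<phi> t * cgauss pi (t - (- y)) * chr (- (t \<bullet> (u - \<xi>)))))"
  proof (intro Bochner_Integration.integral_cong refl)
    fix t
    have "chr (t \<bullet> \<xi>) * chr (- (u \<bullet> (t + y))) = chr (- (u \<bullet> y)) * chr (- (t \<bullet> (u - \<xi>)))"
      unfolding chr_add[symmetric] by (simp add: inner_add_right inner_diff_right inner_commute algebra_simps)
    thus "h t * fourier g t = chr (- (u \<bullet> y)) * (\<phi> t * cgauss pi (t - (- y)) * chr (- (t \<bullet> (u - \<xi>))))"
      unfolding h_def Fg by (simp add: mult_ac)
  qed
  finally show ?thesis by (simp add: fourier_chr[of _ "u - \<xi>"])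
qed

text \<open>Moves the short-time transform to the frequency side, where the multiplier is
  multiplication by \<open>E\<close>; the phase in front disappears in the modulus.\<close>

lemma stft_inverse_fourier:
  fixes \<phi> h :: "real^'n::finite \<Rightarrow> complex"
  assumes \<phi>: "integrable lborel \<phi>" and h: "integrable lborel h"
  shows "stft \<phi> (\<lambda>y. fourier h (- y)) x \<xi>
       = chr (- (x \<bullet> \<xi>)) * fourier (\<lambda>\<eta>. h \<eta> * cnj (fourier \<phi> (\<eta> - \<xi>))) (- x)"
proof -
  define v where "v y = cnj (\<phi> (y - x)) * chr (- (y \<bullet> \<xi>))" for y
  have \<phi>1: "integrable lborel (\<lambda>y. cnj (\<phi> (y - x)))"
    using integral_lborel_translate(2)[of "\<lambda>y. cnj (\<phi> y)" "-x"] \<phi> by simp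
  have vint: "integrable lborel v" unfolding v_def by (intro integrable_mult_chr \<phi>1) simp
  have Fv: "(LINT y|lborel. v y * chr (y \<bullet> \<eta>)) = chr (- (x \<bullet> (\<xi> - \<eta>))) * cnj (fourier \<phi> (\<eta> - \<xi>))" for \<eta>
  proof -
    have "(LINT y|lborel. v y * chr (y \<bullet> \<eta>)) = fourier (\<lambda>y. cnj (\<phi> (y - x))) (\<xi> - \<eta>)"
      unfolding fourier_chr v_def by (simp add: mult.assoc inner_diff_right flip: chr_add)
    also have "\<dots> = chr (- (x \<bullet> (\<xi> - \<eta>))) * fourier (\<lambda>y. cnj (\<phi> y)) (\<xi> - \<eta>)"
      by (rule fourier_translate[of "\<lambda>y. cnj (\<phi> y)"])
    finally show ?thesis by (simp add: fourier_cnj)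
  qed
  have "stft \<phi> (\<lambda>y. fourier h (- y)) x \<xi> = (LINT y|lborel. v y * (LINT \<eta>|lborel. h \<eta> * chr (y \<bullet> \<eta>)))"
    unfolding stft_eq_fourier fourier_chr v_def by (simp add: mult_ac inner_commute)
  also have "\<dots> = (LINT \<eta>|lborel. h \<eta> * (LINT y|lborel. v y * chr (y \<bullet> \<eta>)))"
    by (rule fubini_kernel[OF vint h, where B = 1]) auto
  also have "\<dots> = (LINT \<eta>|lborel. chr (- (x \<bullet> \<xi>)) * (h \<eta> * cnj (fourier \<phi> (\<eta> - \<xi>)) * chr (- (\<eta> \<bullet> (- x)))))"
    unfolding Fv by (intro Bochner_Integration.integral_cong refl)
      (simp add: inner_diff_right chr_diff chr_add mult_ac inner_commute)
  finally show ?thesis by (simp add: fourier_chr[of "\<lambda>\<eta>. h \<eta> * cnj (fourier \<phi> (\<eta> - \<xi>))"])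
qed

text \<open>Holds without integrability, since the left side is then \<open>0\<close>. This allows
  iterated integrals to be estimated without a separate integrability argument at each
  level.\<close>

lemma norm_integral_le_nn_integral:
  fixes f :: "'a \<Rightarrow> complex"
  shows "ennreal (norm (LINT x|M. f x)) \<le> (\<integral>\<^sup>+x. ennreal (norm (f x)) \<partial>M)"
  by (cases "integrable M f") (auto simp: integral_norm_bound_ennreal not_integrable_integral_eq)

text \<open>A vanishing transform is integrable, so inversion would give
  \<open>u z = 0\<close>.\<close>

lemma fourier_nonzero:
  fixes u :: "real^'n::finite \<Rightarrow> complex"
  assumes u: "integrable lborel u" "continuous_on UNIV u" and z: "u z \<noteq> 0"
  obtains \<xi> where "fourier u \<xi> \<noteq> 0"
proof (cases "\<exists>\<xi>. fourier u \<xi> \<noteq> 0")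
  case False
  hence F: "fourier u = (\<lambda>_. 0)" by auto
  have "fourier (fourier u) (- z) = u z" by (rule fourier_inversion[OF u]) (simp add: F)
  thus thesis using z unfolding F by (simp add: fourier_chr)
qed (use that in blast)

section \<open>The kernel of the multiplier between two windows\<close>

context phase_symbol
begin

text \<open>Here \<open>u\<close> is an intermediate frequency between \<open>\<xi>\<close> and
  \<open>\<xi>'\<close>. Of the order \<open>M\<close>, the part \<open>s * N\<close> moves the
  weight from \<open>u\<close> to \<open>\<xi>'\<close>, the part \<open>L\<close> at both links
  combines to decay in \<open>\<xi> - \<xi>'\<close>, and \<open>K\<close> is left for the
  integration over \<open>u\<close>.\<close>

lemma window_weight_le:
  assumes L: "0 \<le> L" and K: "0 \<le> K" and M: "M = N + s * N + L + K"
  shows "jbr (u - \<xi>) powr (-M) * (jbr (u - \<xi>') powr (-M) * jbr u powr (s * N))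
      \<le> 2 powr (s * N) * 2 powr L * jbr \<xi>' powr (s * N) * jbr (\<xi> - \<xi>') powr (-L) * jbr (u - \<xi>') powr (-K)"
proof -
  define k where "k = s * N"
  have k: "0 \<le> k" using s N0 by (simp add: k_def)
  have 1: "jbr u powr k \<le> 2 powr k * (jbr (u - \<xi>') powr k * jbr \<xi>' powr k)"
    using jbr_powr_shift_le[of u k "\<xi>'"] k by simp
  have 2: "jbr (u - \<xi>) powr (-M) \<le> jbr (\<xi> - u) powr (-L)"
    unfolding jbr_minus_commute[of \<xi>] using N0 K k by (intro jbr_powr_mono) (simp add: M k_def)
  have 3: "jbr (u - \<xi>') powr (-M) * jbr (u - \<xi>') powr k \<le> jbr (u - \<xi>') powr (-L) * jbr (u - \<xi>') powr (-K)"
    unfolding powr_add[symmetric] using N0 by (intro jbr_powr_mono) (simp add: M k_def)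
  have 4: "jbr (\<xi> - u) powr (-L) * jbr (u - \<xi>') powr (-L) \<le> 2 powr L * jbr (\<xi> - \<xi>') powr (-L)"
    using jbr_powr_minus_mult_le[OF L, of "\<xi> - u" "u - \<xi>'"] by simp
  have "jbr (u - \<xi>) powr (-M) * (jbr (u - \<xi>') powr (-M) * jbr u powr k)
      \<le> jbr (\<xi> - u) powr (-L) * (jbr (u - \<xi>') powr (-M) * (2 powr k * (jbr (u - \<xi>') powr k * jbr \<xi>' powr k)))"
    by (intro mult_mono 1 2) auto
  also have "\<dots> = (2 powr k * jbr \<xi>' powr k * jbr (\<xi> - u) powr (-L)) * (jbr (u - \<xi>') powr (-M) * jbr (u - \<xi>') powr k)"
    by (simp only: mult_ac)
  also have "\<dots> \<le> (2 powr k * jbr \<xi>' powr k * jbr (\<xi> - u) powr (-L)) * (jbr (u - \<xi>') powr (-L) * jbr (u - \<xi>') powr (-K))"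
    by (intro mult_left_mono 3) auto
  also have "\<dots> = (2 powr k * jbr \<xi>' powr k * jbr (u - \<xi>') powr (-K)) * (jbr (\<xi> - u) powr (-L) * jbr (u - \<xi>') powr (-L))"
    by (simp only: mult_ac)
  also have "\<dots> \<le> (2 powr k * jbr \<xi>' powr k * jbr (u - \<xi>') powr (-K)) * (2 powr L * jbr (\<xi> - \<xi>') powr (-L))"
    by (intro mult_left_mono 4) auto
  finally show ?thesis by (simp only: k_def mult_ac)
qed

lemma continuous_fourier_diff:
  "schwartz \<phi> \<Longrightarrow> continuous_on UNIV (\<lambda>\<eta>. fourier \<phi> (\<eta> - a))"
  by (rule continuous_on_compose2[OF continuous_fourier[OF schwartz_integrable], of _ UNIV])
    (auto intro!: continuous_intros)

lemma fourier_window_integrable: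
  fixes \<phi> :: "real^'n \<Rightarrow> complex"
  assumes \<phi>: "schwartz \<phi>"
  shows "integrable lborel (\<lambda>\<eta>. E \<eta> * (fourier \<phi> (\<eta> - \<xi>') * cnj (fourier \<phi> (\<eta> - \<xi>))))"
proof -
  obtain B where B: "0 < B" "\<And>\<xi>. norm (fourier \<phi> \<xi>) \<le> B * jbr \<xi> powr (-0)"
    using fourier_schwartz_decay[OF \<phi> order_refl] by blast
  have I: "integrable lborel (\<lambda>\<eta>. B *\<^sub>R fourier \<phi> (\<eta> - \<xi>'))"
    using integral_lborel_translate(2)[of "fourier \<phi>" "- \<xi>'"] fourier_schwartz_integrable[OF \<phi>] by simp
  show ?thesis
  proof (rule Bochner_Integration.integrable_bound[OF I])
    have "continuous_on UNIV (\<lambda>\<eta>. E \<eta> * (fourier \<phi> (\<eta> - \<xi>') * cnj (fourier \<phi> (\<eta> - \<xi>))))"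
      by (intro continuous_intros continuous_E continuous_fourier_diff[OF \<phi>])
    thus "(\<lambda>\<eta>. E \<eta> * (fourier \<phi> (\<eta> - \<xi>') * cnj (fourier \<phi> (\<eta> - \<xi>)))) \<in> borel_measurable lborel"
      by (simp add: borel_measurable_continuous_onI)
    have "norm (fourier \<phi> (\<eta> - \<xi>')) * norm (fourier \<phi> (\<eta> - \<xi>)) \<le> norm (fourier \<phi> (\<eta> - \<xi>')) * B" for \<eta>
      using B(2)[of "\<eta> - \<xi>"] by (intro mult_left_mono) auto
    thus "AE \<eta> in lborel. norm (E \<eta> * (fourier \<phi> (\<eta> - \<xi>') * cnj (fourier \<phi> (\<eta> - \<xi>)))) \<le> norm (B *\<^sub>R fourier \<phi> (\<eta> - \<xi>'))"
      using B(1) by (intro AE_I2) (simp add: norm_mult mult.commute)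
  qed
qed

text \<open>The phase is understood in Gaussian windows, whereas here it stands between two windows
  \<open>fourier \<phi>\<close>. A Gaussian centred at \<open>u\<close> is inserted, whose integral
  over \<open>u\<close> is the constant \<open>c\<close>; for fixed \<open>u\<close> it is
  distributed over the three factors and \<open>fourier_mult_bound\<close> is used twice.\<close>

lemma fourier_phase_window:
  fixes \<phi> :: "real^'n \<Rightarrow> complex"
  assumes \<phi>: "schwartz \<phi>" and L: "0 \<le> L"
  obtains C where "0 < C"
    "\<And>\<xi> \<xi>' y. norm (fourier (\<lambda>\<eta>. E \<eta> * (fourier \<phi> (\<eta> - \<xi>') * cnj (fourier \<phi> (\<eta> - \<xi>)))) y)
      \<le> C * jbr \<xi>' powr (s * N) * jbr (\<xi> - \<xi>') powr (-L) * jbr y powr (-N)"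
proof -
  define K where "K = real CARD('n) + 1"
  have K: "0 \<le> K" "real CARD('n) < K" by (auto simp: K_def)
  \<comment> \<open>The summand \<open>N\<close> guarantees \<open>N <= M\<close>, the decay in
    \<open>y\<close> that \<open>fourier_mult_bound\<close> demands of the windows.\<close>
  define M where "M = N + s * N + L + K"
  have M: "0 \<le> M" "N \<le> M" using s N0 L K by (auto simp: M_def)
  obtain Cv where Cv: "0 < Cv"
    "\<And>x \<xi>. norm (fourier (\<lambda>y. \<phi> y * cgauss pi (y - x)) \<xi>) \<le> Cv * jbr x powr (-M) * jbr \<xi> powr (-M)"
    by (rule fourier_schwartz_gauss[OF \<phi> pi_gt_zero M(1)]; rule that; assumption)
  obtain Cq where Cq: "0 < Cq" "\<And>\<xi> y. norm (fourier (\<lambda>\<eta>. E \<eta> * cgauss pi (\<eta> - \<xi>)) y)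
      \<le> Cq * jbr \<xi> powr (s * N) * jbr y powr (-N)"
    by (rule fourier_phase_gauss[OF pi_gt_zero]; rule that; assumption)
  obtain Cm where Cm: "0 < Cm"
    "\<forall>(u :: real^'n \<Rightarrow> complex) v A D y. integrable lborel u \<longrightarrow> integrable lborel v \<longrightarrow> continuous_on UNIV v \<longrightarrow>
       (\<forall>z. norm (fourier v z) \<le> A * jbr z powr (-N)) \<longrightarrow> (\<forall>z. norm (fourier u z) \<le> D * jbr z powr (-N)) \<longrightarrow>
       norm (fourier (\<lambda>x. u x * v x) y) \<le> Cm * A * D * jbr y powr (-N)"
    using fourier_mult_bound[OF N N0 order_refl] by (elim exE conjE)
  obtain B where B: "0 < B" "\<And>\<xi>. norm (fourier \<phi> \<xi>) \<le> B * jbr \<xi> powr (-0)"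
    using fourier_schwartz_decay[OF \<phi> order_refl] by blast
  define P where "P u \<xi> \<eta> = fourier \<phi> (\<eta> - \<xi>) * cgauss pi (\<eta> - u)" for u \<xi> \<eta>
  have Pcont: "continuous_on UNIV (P u \<xi>)" for u \<xi>
    unfolding P_def by (intro continuous_intros continuous_fourier_diff[OF \<phi>])
  have Pint: "integrable lborel (P u \<xi>)" for u \<xi>
    unfolding P_def
    by (rule integrable_mult_gauss[OF pi_gt_zero continuous_fourier_diff[OF \<phi>], of _ B 0]) (use B(2) in simp)
  have FP: "norm (fourier (P u \<xi>) y) \<le> (Cv * jbr (u - \<xi>) powr (-M)) * jbr y powr (-N)" for u \<xi> y
  proof -
    have "fourier (P u \<xi>) y = chr (- (u \<bullet> y)) * fourier (\<lambda>t. \<phi> t * cgauss pi (t - (- y))) (u - \<xi>)"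
      unfolding P_def mult.commute[of "fourier \<phi> _"]
      by (rule fourier_gauss_mult_fourier[OF schwartz_integrable[OF \<phi>]])
    hence "norm (fourier (P u \<xi>) y) \<le> Cv * jbr y powr (-M) * jbr (u - \<xi>) powr (-M)"
      using Cv(2)[of "- y" "u - \<xi>"] by (simp add: norm_mult)
    also have "\<dots> \<le> Cv * jbr y powr (-N) * jbr (u - \<xi>) powr (-M)"
      using Cv(1) M by (intro mult_right_mono mult_left_mono jbr_powr_mono) auto
    finally show ?thesis by (simp only: mult_ac)
  qed
  have FPc: "norm (fourier (\<lambda>\<eta>. cnj (P u \<xi> \<eta>)) y) \<le> (Cv * jbr (u - \<xi>) powr (-M)) * jbr y powr (-N)" for u \<xi> y
    using FP[of u \<xi> "- y"] by (simp add: fourier_cnj)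
  define w where "w u \<eta> = E \<eta> * cgauss pi (\<eta> - u)" for u \<eta>
  have wint: "integrable lborel (w u)" for u unfolding w_def by (rule integrable_E_gauss[OF pi_gt_zero])
  have Fw: "norm (fourier (w u) z) \<le> (Cq * jbr u powr (s * N)) * jbr z powr (-N)" for u z
    unfolding w_def[abs_def] by (rule Cq(2))
  have wPint: "integrable lborel (\<lambda>\<eta>. w u \<eta> * P u \<xi>' \<eta>)" for u \<xi>'
  proof (rule Bochner_Integration.integrable_bound[OF Pint[of u "\<xi>'"]])
    have "norm (w u \<eta>) \<le> 1" for \<eta> by (simp add: w_def norm_mult gauss_le_1)
    thus "AE \<eta> in lborel. norm (w u \<eta> * P u \<xi>' \<eta>) \<le> norm (P u \<xi>' \<eta>)"
      by (intro AE_I2) (simp add: norm_mult[of "w _ _"] mult_left_le_one_le)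
    show "(\<lambda>\<eta>. w u \<eta> * P u \<xi>' \<eta>) \<in> borel_measurable lborel"
      using borel_measurable_integrable[OF wint] borel_measurable_integrable[OF Pint] by (rule borel_measurable_times)
  qed
  \<comment> \<open>One Gaussian of parameter \<open>pi\<close> for each of \<open>E\<close> and the
    two windows.\<close>
  define b where "b = pi + (pi + pi)"
  have b: "0 < b" using pi_gt_zero by (simp add: b_def)
  define c where "c = (LINT \<eta>::real^'n|lborel. gauss b \<eta>)"
  have c: "0 < c" unfolding c_def integral_gauss[OF b] using b by simp
  define I where "I = (LINT x::real^'n|lborel. jbr x powr (-K))"
  have I0: "0 \<le> I" unfolding I_def by (intro integral_nonneg_AE) auto
  define D where "D = Cm * Cv * (Cm * Cv * Cq) * (2 powr (s * N) * 2 powr L)"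
  have D: "0 < D" using Cm(1) Cv(1) Cq(1) by (simp add: D_def)
  have main: "norm (fourier (\<lambda>\<eta>. E \<eta> * (fourier \<phi> (\<eta> - \<xi>') * cnj (fourier \<phi> (\<eta> - \<xi>)))) y)
      \<le> (D * I / c + 1) * jbr \<xi>' powr (s * N) * jbr (\<xi> - \<xi>') powr (-L) * jbr y powr (-N)" for \<xi> \<xi>' y
  proof -
    define Z where "Z = jbr \<xi>' powr (s * N) * jbr (\<xi> - \<xi>') powr (-L) * jbr y powr (-N)"
    define \<alpha> where "\<alpha> \<eta> = E \<eta> * (fourier \<phi> (\<eta> - \<xi>') * cnj (fourier \<phi> (\<eta> - \<xi>)))" for \<eta>
    have int: "integrable (lborel \<Otimes>\<^sub>M lborel) (\<lambda>(\<eta>, u). \<alpha> \<eta> * chr (- (\<eta> \<bullet> y)) * cgauss b (\<eta> - u))"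
    proof (rule integrable_pair_conv)
      show "integrable lborel (\<lambda>\<eta>. \<alpha> \<eta> * chr (- (\<eta> \<bullet> y)))"
        unfolding \<alpha>_def by (intro integrable_mult_chr fourier_window_integrable \<phi>) simp
      show "integrable lborel (\<lambda>\<eta>. cgauss b (\<eta>::real^'n))"
        by (intro integrable_of_real integrable_gauss b)
    qed
    have e1: "(LINT u|lborel. \<alpha> \<eta> * chr (- (\<eta> \<bullet> y)) * cgauss b (\<eta> - u)) = complex_of_real c * (\<alpha> \<eta> * chr (- (\<eta> \<bullet> y)))" for \<eta>
      using integral_lborel_reflect(1)[of "\<lambda>u. cgauss b u" \<eta>] by (simp add: c_def)
    have e2: "(LINT \<eta>|lborel. \<alpha> \<eta> * chr (- (\<eta> \<bullet> y)) * cgauss b (\<eta> - u))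
        = fourier (\<lambda>\<eta>. (w u \<eta> * P u \<xi>' \<eta>) * cnj (P u \<xi> \<eta>)) y" for u
      unfolding fourier_chr
    proof (intro Bochner_Integration.integral_cong refl)
      fix \<eta>
      have "cgauss b (\<eta> - u) = cgauss pi (\<eta> - u) * (cgauss pi (\<eta> - u) * cgauss pi (\<eta> - u))"
        by (simp add: b_def gauss_mult flip: of_real_mult)
      thus "\<alpha> \<eta> * chr (- (\<eta> \<bullet> y)) * cgauss b (\<eta> - u)
          = (w u \<eta> * P u \<xi>' \<eta>) * cnj (P u \<xi> \<eta>) * chr (- (\<eta> \<bullet> y))"
        unfolding \<alpha>_def w_def P_def by (simp only: complex_cnj_mult complex_cnj_complex_of_real mult_ac)
    qed
    have bnd: "norm (fourier (\<lambda>\<eta>. (w u \<eta> * P u \<xi>' \<eta>) * cnj (P u \<xi> \<eta>)) y) \<le> (D * Z) * jbr (u - \<xi>') powr (-K)" for u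
    proof -
      have "norm (fourier (\<lambda>\<eta>. w u \<eta> * P u \<xi>' \<eta>) z)
          \<le> Cm * (Cv * jbr (u - \<xi>') powr (-M)) * (Cq * jbr u powr (s * N)) * jbr z powr (-N)" for z
        by (rule Cm(2)[rule_format, OF wint Pint Pcont FP Fw])
      hence "norm (fourier (\<lambda>\<eta>. (w u \<eta> * P u \<xi>' \<eta>) * cnj (P u \<xi> \<eta>)) y)
          \<le> Cm * (Cv * jbr (u - \<xi>) powr (-M)) * (Cm * (Cv * jbr (u - \<xi>') powr (-M)) * (Cq * jbr u powr (s * N))) * jbr y powr (-N)"
        by (intro Cm(2)[rule_format, OF wPint _ _ FPc]) (use Pint Pcont in \<open>auto intro!: continuous_intros\<close>)
      also have "\<dots> = (Cm * Cv * (Cm * Cv * Cq) * jbr y powr (-N)) * (jbr (u - \<xi>) powr (-M) * (jbr (u - \<xi>') powr (-M) * jbr u powr (s * N)))"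
        by (simp only: mult_ac)
      also have "\<dots> \<le> (Cm * Cv * (Cm * Cv * Cq) * jbr y powr (-N)) *
          (2 powr (s * N) * 2 powr L * jbr \<xi>' powr (s * N) * jbr (\<xi> - \<xi>') powr (-L) * jbr (u - \<xi>') powr (-K))"
        using Cm(1) Cv(1) Cq(1) by (intro mult_left_mono window_weight_le[OF L K(1) M_def]) auto
      finally show ?thesis by (simp only: D_def Z_def mult_ac)
    qed
    have "complex_of_real c * fourier \<alpha> y = (LINT \<eta>|lborel. LINT u|lborel. \<alpha> \<eta> * chr (- (\<eta> \<bullet> y)) * cgauss b (\<eta> - u))"
      unfolding e1 fourier_chr by simp
    also have "\<dots> = (LINT u|lborel. LINT \<eta>|lborel. \<alpha> \<eta> * chr (- (\<eta> \<bullet> y)) * cgauss b (\<eta> - u))"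
      by (rule lborel_pair.Fubini_integral[OF int, symmetric])
    finally have "norm (complex_of_real c * fourier \<alpha> y) = norm (LINT u|lborel. fourier (\<lambda>\<eta>. (w u \<eta> * P u \<xi>' \<eta>) * cnj (P u \<xi> \<eta>)) y)"
      by (simp only: e2)
    also have "\<dots> \<le> (LINT u|lborel. norm (fourier (\<lambda>\<eta>. (w u \<eta> * P u \<xi>' \<eta>) * cnj (P u \<xi> \<eta>)) y))"
      by (rule integral_norm_bound)
    also have "\<dots> \<le> (LINT u|lborel. (D * Z) * jbr (u - \<xi>') powr (-K))"
      by (rule integral_mono', intro integrable_mult_right integrable_jbr_powr_diff K)
        (use bnd D in \<open>auto simp: Z_def\<close>)
    also have "\<dots> = D * Z * I"
      using integral_lborel_translate(1)[of "\<lambda>x. jbr x powr (-K)" "-\<xi>'"] by (simp add: I_def)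
    finally have "norm (fourier \<alpha> y) \<le> D * Z * I / c"
      using c by (simp add: norm_mult pos_le_divide_eq mult.commute)
    also have "\<dots> \<le> (D * I / c + 1) * Z" by (simp add: Z_def algebra_simps)
    finally show ?thesis unfolding \<alpha>_def Z_def by (simp only: mult.assoc)
  qed
  show thesis
  proof (rule that)
    show "0 < D * I / c + 1" using D I0 c by (intro add_nonneg_pos) auto
  qed (rule main)
qed

end

section \<open>Pointwise domination of the short-time transform\<close>

context phase_symbol
begin

text \<open>On the frequency side the average of \<open>(norm (F (\<eta> - \<xi>')))^2\<close> over
  \<open>\<xi>'\<close> is the constant \<open>c\<close>. One of its two factors is given to
  \<open>fourier f\<close>, which yields the short-time transform of \<open>f\<close>; the other
  joins \<open>E\<close> and the outer window in \<open>m\<close>, whose transform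
  \<open>fourier_phase_window\<close> controls. The product of the two becomes a convolution in
  \<open>x\<close>.\<close>

lemma stft_fmult_bound:
  fixes \<phi> :: "real^'n \<Rightarrow> complex"
  assumes \<phi>: "schwartz \<phi>" "\<phi> z \<noteq> 0" and L: "0 \<le> L"
  obtains C where "0 < C"
    "\<And>f x \<xi>. schwartz f \<Longrightarrow> ennreal (norm (stft \<phi> (fmult \<mu> f) x \<xi>))
      \<le> (\<integral>\<^sup>+\<xi>'. \<integral>\<^sup>+x'. ennreal (C * (norm (stft \<phi> f x' \<xi>') * jbr \<xi>' powr (s * N)) *
            (jbr (x - x') powr (-N) * jbr (\<xi> - \<xi>') powr (-L))) \<partial>lborel \<partial>lborel)"
proof -
  define F where "F = fourier \<phi>"
  note \<phi>int = schwartz_integrable[OF \<phi>(1)] and \<phi>cont = schwartz_continuous[OF \<phi>(1)]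
  have Fcont: "continuous_on UNIV F" unfolding F_def by (rule continuous_fourier[OF \<phi>int])
  have Fdiff: "continuous_on UNIV (\<lambda>\<eta>. F (\<eta> - a))" for a unfolding F_def by (rule continuous_fourier_diff[OF \<phi>(1)])
  obtain C8 where C8: "0 < C8"
    "\<And>\<xi> \<xi>' y. norm (fourier (\<lambda>\<eta>. E \<eta> * (fourier \<phi> (\<eta> - \<xi>') * cnj (fourier \<phi> (\<eta> - \<xi>)))) y)
      \<le> C8 * jbr \<xi>' powr (s * N) * jbr (\<xi> - \<xi>') powr (-L) * jbr y powr (-N)"
    by (rule fourier_phase_window[OF \<phi>(1) L]; rule that; assumption)
  \<comment> \<open>A nonzero value of \<open>F\<close> is what makes the normalising constant
    \<open>c\<close> positive.\<close>
  obtain z' where z': "F z' \<noteq> 0" unfolding F_def using fourier_nonzero[OF \<phi>int \<phi>cont \<phi>(2)] by blast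
  obtain B where B: "0 < B" "\<And>\<xi>. norm (F \<xi>) \<le> B * jbr \<xi> powr (-N)"
    unfolding F_def using fourier_schwartz_decay[OF \<phi>(1) N0] by blast
  define c where "c = (LINT x|lborel. (norm (F x))\<^sup>2)"
  note sq = norm_sq_integral_pos[OF Fcont N B(2) z', folded c_def]
  have Fb: "norm (F \<xi>) \<le> B" for \<xi>
    using order_trans[OF B(2) mult_left_mono[OF jbr_powr_le_1[of "-N"]]] B(1) N0 by simp
  have mult_F: "integrable lborel (\<lambda>\<eta>. h \<eta> * cnj (F (\<eta> - \<xi>)))" if h: "integrable lborel h" for h \<xi>
  proof (rule Bochner_Integration.integrable_bound)
    show "integrable lborel (\<lambda>\<eta>. B *\<^sub>R h \<eta>)" using h by simp
    have [measurable]: "(\<lambda>\<eta>. F (\<eta> - \<xi>)) \<in> borel_measurable borel" "h \<in> borel_measurable borel"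
      using Fdiff[of \<xi>] h by (auto simp: borel_measurable_continuous_onI)
    show "(\<lambda>\<eta>. h \<eta> * cnj (F (\<eta> - \<xi>))) \<in> borel_measurable lborel" by measurable
    show "AE \<eta> in lborel. norm (h \<eta> * cnj (F (\<eta> - \<xi>))) \<le> norm (B *\<^sub>R h \<eta>)"
      using B(1) mult_left_mono[OF Fb norm_ge_zero] by (intro AE_I2) (simp add: norm_mult mult.commute[of B])
  qed
  have E_int: "integrable lborel (\<lambda>\<eta>. E \<eta> * h \<eta>)" if h: "integrable lborel h" for h
  proof (rule Bochner_Integration.integrable_bound[OF h])
    have [measurable]: "E \<in> borel_measurable borel" "h \<in> borel_measurable borel"
      using continuous_E h by (auto simp: borel_measurable_continuous_onI)
    show "(\<lambda>\<eta>. E \<eta> * h \<eta>) \<in> borel_measurable lborel" by measurable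
  qed (simp add: norm_mult)
  have main: "ennreal (norm (stft \<phi> (fmult \<mu> f) x \<xi>))
      \<le> (\<integral>\<^sup>+\<xi>'. \<integral>\<^sup>+x'. ennreal (C8 / c * (norm (stft \<phi> f x' \<xi>') * jbr \<xi>' powr (s * N)) *
            (jbr (x - x') powr (-N) * jbr (\<xi> - \<xi>') powr (-L))) \<partial>lborel \<partial>lborel)"
    if f: "schwartz f" for f x \<xi>
  proof -
    note fint = schwartz_integrable[OF f] and fcont = schwartz_continuous[OF f]
    note Ff = fourier_schwartz_integrable[OF f]
    \<comment> \<open>By inversion \<open>f\<close> is the inverse transform of
      \<open>fourier f\<close>, so the transform of \<open>H \<xi>'\<close> at \<open>- x'\<close>
      is, up to a phase, the short-time transform of \<open>f\<close> at
      \<open>(x', \<xi>')\<close>.\<close>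
    define H where "H \<xi>' \<eta> = fourier f \<eta> * cnj (F (\<eta> - \<xi>'))" for \<xi>' \<eta>
    have Hint: "integrable lborel (H \<xi>')" for \<xi>' unfolding H_def by (rule mult_F[OF Ff])
    have VH: "norm (stft \<phi> f x' \<xi>') = norm (fourier (H \<xi>') (- x'))" for x' \<xi>'
    proof -
      have "f = (\<lambda>y. fourier (fourier f) (- y))"
        using fourier_inversion[OF fint fcont Ff] by simp
      hence "stft \<phi> f x' \<xi>' = stft \<phi> (\<lambda>y. fourier (fourier f) (- y)) x' \<xi>'" by simp
      thus ?thesis unfolding stft_inverse_fourier[OF \<phi>int Ff] by (simp add: norm_mult H_def[abs_def] F_def)
    qed
    define m where "m \<xi>' \<eta> = E \<eta> * (F (\<eta> - \<xi>') * cnj (F (\<eta> - \<xi>)))" for \<xi>' \<eta>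
    have mint: "integrable lborel (m \<xi>')" for \<xi>'
      unfolding m_def F_def by (rule fourier_window_integrable[OF \<phi>(1)])
    have mcont: "continuous_on UNIV (m \<xi>')" for \<xi>'
      unfolding m_def by (intro continuous_intros continuous_E Fdiff)
    have Fm: "norm (fourier (m \<xi>') y) \<le> C8 * jbr \<xi>' powr (s * N) * jbr (\<xi> - \<xi>') powr (-L) * jbr y powr (-N)" for \<xi>' y
      unfolding m_def[abs_def] F_def by (rule C8(2))
    have Fmint: "integrable lborel (fourier (m \<xi>'))" for \<xi>'
      by (rule integrable_of_jbr_bound[OF continuous_fourier[OF mint] Fm N])
    define \<alpha> where "\<alpha> \<eta> = E \<eta> * fourier f \<eta> * cnj (F (\<eta> - \<xi>))" for \<eta>
    have \<alpha>int: "integrable lborel \<alpha>" unfolding \<alpha>_def by (intro mult_F E_int Ff)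
    have Tf: "norm (stft \<phi> (fmult \<mu> f) x \<xi>) = norm (fourier \<alpha> (- x))"
    proof -
      have "fmult \<mu> f = (\<lambda>y. fourier (\<lambda>\<eta>. E \<eta> * fourier f \<eta>) (- y))"
        by (simp add: fun_eq_iff fmult_eq_fourier E_def)
      hence "stft \<phi> (fmult \<mu> f) x \<xi> = chr (- (x \<bullet> \<xi>)) * fourier \<alpha> (- x)"
        unfolding \<alpha>_def F_def using stft_inverse_fourier[OF \<phi>int E_int[OF Ff]] by simp
      thus ?thesis by (simp add: norm_mult)
    qed
    have int: "integrable (lborel \<Otimes>\<^sub>M lborel) (\<lambda>(\<eta>, \<xi>'). \<alpha> \<eta> * chr (- (\<eta> \<bullet> (- x))) * complex_of_real ((norm (F (\<eta> - \<xi>')))\<^sup>2))"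
    proof (rule integrable_pair_conv[where \<beta> = "\<lambda>\<eta>. complex_of_real ((norm (F \<eta>))\<^sup>2)"])
      show "integrable lborel (\<lambda>\<eta>. \<alpha> \<eta> * chr (- (\<eta> \<bullet> (- x))))"
        by (rule integrable_mult_chr[OF _ \<alpha>int]) simp
      show "integrable lborel (\<lambda>\<eta>. complex_of_real ((norm (F \<eta>))\<^sup>2))"
        by (rule integrable_of_real[OF sq(1)])
    qed
    have e1: "(LINT \<xi>'|lborel. \<alpha> \<eta> * chr (- (\<eta> \<bullet> (- x))) * complex_of_real ((norm (F (\<eta> - \<xi>')))\<^sup>2)) = complex_of_real c * (\<alpha> \<eta> * chr (- (\<eta> \<bullet> (- x))))" for \<eta>
    proof -
      have "(LINT \<xi>'|lborel. complex_of_real ((norm (F (\<eta> - \<xi>')))\<^sup>2)) = complex_of_real c"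
        unfolding c_def integral_lborel_reflect(1)[of "\<lambda>\<xi>'. complex_of_real ((norm (F \<xi>'))\<^sup>2)" \<eta>]
        by (rule integral_complex_of_real)
      thus ?thesis by (simp only: integral_mult_right_zero mult.commute)
    qed
    have e2: "(LINT \<eta>|lborel. \<alpha> \<eta> * chr (- (\<eta> \<bullet> (- x))) * complex_of_real ((norm (F (\<eta> - \<xi>')))\<^sup>2))
        = fourier (\<lambda>\<eta>. H \<xi>' \<eta> * m \<xi>' \<eta>) (- x)" for \<xi>'
      unfolding fourier_chr complex_norm_square \<alpha>_def H_def m_def
      by (intro Bochner_Integration.integral_cong refl) (simp only: mult_ac)
    have "complex_of_real c * fourier \<alpha> (- x) = (LINT \<eta>|lborel. LINT \<xi>'|lborel. \<alpha> \<eta> * chr (- (\<eta> \<bullet> (- x))) * complex_of_real ((norm (F (\<eta> - \<xi>')))\<^sup>2))"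
      unfolding e1 fourier_chr by simp
    also have "\<dots> = (LINT \<xi>'|lborel. LINT \<eta>|lborel. \<alpha> \<eta> * chr (- (\<eta> \<bullet> (- x))) * complex_of_real ((norm (F (\<eta> - \<xi>')))\<^sup>2))"
      by (rule lborel_pair.Fubini_integral[OF int, symmetric])
    finally have "complex_of_real c * fourier \<alpha> (- x) = (LINT \<xi>'|lborel. fourier (\<lambda>\<eta>. H \<xi>' \<eta> * m \<xi>' \<eta>) (- x))"
      by (simp only: e2)
    hence "fourier \<alpha> (- x) = complex_of_real (1 / c) * (LINT \<xi>'|lborel. fourier (\<lambda>\<eta>. H \<xi>' \<eta> * m \<xi>' \<eta>) (- x))"
      using sq(2) by (simp add: field_simps)
    also have "\<dots> = (LINT \<xi>'|lborel. LINT z|lborel. complex_of_real (1 / c) * (fourier (m \<xi>') z * fourier (H \<xi>') (- x - z)))"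
      by (simp only: fourier_mult[OF Hint mint mcont Fmint] integral_mult_right_zero)
    finally have "ennreal (norm (stft \<phi> (fmult \<mu> f) x \<xi>))
        \<le> (\<integral>\<^sup>+\<xi>'. ennreal (norm (LINT z|lborel. complex_of_real (1 / c) * (fourier (m \<xi>') z * fourier (H \<xi>') (- x - z)))) \<partial>lborel)"
      unfolding Tf by (simp only: norm_integral_le_nn_integral)
    also have "\<dots> \<le> (\<integral>\<^sup>+\<xi>'. \<integral>\<^sup>+x'. ennreal (C8 / c * (norm (stft \<phi> f x' \<xi>') * jbr \<xi>' powr (s * N)) *
            (jbr (x - x') powr (-N) * jbr (\<xi> - \<xi>') powr (-L))) \<partial>lborel \<partial>lborel)"
    proof (rule nn_integral_mono)
      fix \<xi>'
      have [measurable]: "fourier (m \<xi>') \<in> borel_measurable borel" "fourier (H \<xi>') \<in> borel_measurable borel"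
        using continuous_fourier[OF mint] continuous_fourier[OF Hint] by (auto intro: borel_measurable_continuous_onI)
      define q where "q z = ennreal (norm (complex_of_real (1 / c) * (fourier (m \<xi>') z * fourier (H \<xi>') (- x - z))))" for z
      have qm: "q \<in> borel_measurable borel" unfolding q_def by measurable
      have "ennreal (norm (LINT z|lborel. complex_of_real (1 / c) * (fourier (m \<xi>') z * fourier (H \<xi>') (- x - z)))) \<le> (\<integral>\<^sup>+z. q z \<partial>lborel)"
        unfolding q_def by (rule norm_integral_le_nn_integral)
      \<comment> \<open>With \<open>z = x' - x\<close> the second factor is evaluated at
        \<open>- x'\<close>, the point where it is the short-time transform of
        \<open>f\<close>.\<close>
      also have "\<dots> = (\<integral>\<^sup>+x'. q (x' + (- x)) \<partial>lborel)"
        by (rule nn_integral_lborel_translate[OF qm, symmetric])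
      also have "\<dots> \<le> (\<integral>\<^sup>+x'. ennreal (C8 / c * (norm (stft \<phi> f x' \<xi>') * jbr \<xi>' powr (s * N)) *
            (jbr (x - x') powr (-N) * jbr (\<xi> - \<xi>') powr (-L))) \<partial>lborel)"
      proof (rule nn_integral_mono)
        fix x'
        have "norm (complex_of_real (1 / c) * (fourier (m \<xi>') (x' + - x) * fourier (H \<xi>') (- x - (x' + - x))))
            = 1 / c * (norm (fourier (m \<xi>') (x' - x)) * norm (stft \<phi> f x' \<xi>'))"
          using sq(2) by (simp add: norm_mult VH norm_divide)
        also have "\<dots> \<le> 1 / c * ((C8 * jbr \<xi>' powr (s * N) * jbr (\<xi> - \<xi>') powr (-L) * jbr (x' - x) powr (-N)) * norm (stft \<phi> f x' \<xi>'))"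
          using sq(2) by (intro mult_left_mono mult_right_mono Fm) auto
        also have "\<dots> = C8 / c * (norm (stft \<phi> f x' \<xi>') * jbr \<xi>' powr (s * N)) * (jbr (x - x') powr (-N) * jbr (\<xi> - \<xi>') powr (-L))"
          by (simp add: jbr_minus_commute[of x'] mult_ac)
        finally show "q (x' + - x) \<le> ennreal (C8 / c * (norm (stft \<phi> f x' \<xi>') * jbr \<xi>' powr (s * N)) *
            (jbr (x - x') powr (-N) * jbr (\<xi> - \<xi>') powr (-L)))"
          unfolding q_def by (rule ennreal_leI)
      qed
      finally show "ennreal (norm (LINT z|lborel. complex_of_real (1 / c) * (fourier (m \<xi>') z * fourier (H \<xi>') (- x - z))))
        \<le> (\<integral>\<^sup>+x'. ennreal (C8 / c * (norm (stft \<phi> f x' \<xi>') * jbr \<xi>' powr (s * N)) *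
            (jbr (x - x') powr (-N) * jbr (\<xi> - \<xi>') powr (-L))) \<partial>lborel)" .
    qed
    finally show ?thesis .
  qed
  have "0 < C8 / c" using C8(1) sq(2) by simp
  thus thesis using that main by blast
qed

end

text \<open>For \<open>\<mu> = 0\<close> the multiplier is the identity, so the kernel estimate turns into a
  reproducing inequality for the short-time Fourier transform, with arbitrarily large \<open>N\<close>.\<close>

lemma phase_symbol_zero:
  assumes N: "real CARD('n::finite) < N"
  shows "phase_symbol (\<lambda>_::real^'n. 0) 0 N"
proof -
  have p: "pdiff j (\<lambda>_. 0::real) = (\<lambda>_::real^'n. 0)" for j
    by (auto simp: pdiff_def fun_eq_iff)
  show ?thesis
    by unfold_locales
      (use N in \<open>auto simp: p fourier_chr intro!: exI[of _ 1] derivative_eq_intros\<close>)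
qed

lemma fmult_zero:
  assumes f: "schwartz f" shows "fmult (\<lambda>_. 0) f = f"
  using fourier_inversion[OF schwartz_integrable[OF f] schwartz_continuous[OF f] fourier_schwartz_integrable[OF f]]
  by (simp add: fmult_eq_fourier fun_eq_iff)

section \<open>Mixed Lebesgue quasi-norms\<close>

lemma enn_powr_ennreal: "0 \<le> x \<Longrightarrow> enn_powr (ennreal x) r = ennreal (x powr r)"
  by (simp add: enn_powr_def)

lemma enn_powr_top [simp]: "enn_powr top r = top"
  by (simp add: enn_powr_def)

lemma enn_powr_0 [simp]: "enn_powr 0 r = 0"
  by (simp add: enn_powr_def)

lemma enn_powr_1 [simp]: "enn_powr a 1 = a"
  by (cases a) (auto simp: enn_powr_ennreal)

lemma enn_powr_mono: "a \<le> b \<Longrightarrow> 0 \<le> r \<Longrightarrow> enn_powr a r \<le> enn_powr b r"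
  by (cases a; cases b) (auto simp: enn_powr_ennreal top_unique intro!: ennreal_leI powr_mono2)

lemma enn_powr_powr: "enn_powr (enn_powr a r) t = enn_powr a (r * t)"
  by (cases a) (auto simp: enn_powr_ennreal powr_powr)

lemma enn_powr_mult: "0 < r \<Longrightarrow> enn_powr (a * b) r = enn_powr a r * enn_powr b r"
proof (cases a; cases b)
  fix x y assume "0 < r" "0 \<le> x" "a = ennreal x" "0 \<le> y" "b = ennreal y"
  thus ?thesis by (simp add: enn_powr_ennreal powr_mult flip: ennreal_mult)
next
  fix x assume "0 < r" "0 \<le> x" "a = ennreal x" "b = top"
  thus ?thesis by (cases "x = 0") (auto simp: enn_powr_ennreal ennreal_mult_top)
next
  fix y assume "0 < r" "a = top" "0 \<le> y" "b = ennreal y"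
  thus ?thesis by (cases "y = 0") (auto simp: enn_powr_ennreal ennreal_top_mult)
qed auto

lemma measurable_enn_powr [measurable (raw)]:
  assumes [measurable]: "f \<in> borel_measurable M"
  shows "(\<lambda>x. enn_powr (f x) r) \<in> borel_measurable M"
  unfolding enn_powr_def by measurable

text \<open>This replaces Young's inequality when the exponents are below \<open>1\<close>: a function that is
  dominated pointwise by its own integral has a quasi-norm inequality in the reverse direction.
  Boundedness of \<open>h\<close> enters only to make the integral finite, not in the constant.\<close>

lemma nn_integral_powr_self_improve:
  fixes h :: "'a \<Rightarrow> real"
  assumes [measurable]: "h \<in> borel_measurable M" and h: "\<And>u. 0 \<le> h u" "\<And>u. h u \<le> B"
    and r: "0 < r" "r \<le> 1" and C: "0 < C"
    and le: "\<And>u. ennreal (h u) \<le> ennreal C * (\<integral>\<^sup>+u. ennreal (h u) \<partial>M)"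
  shows "enn_powr (\<integral>\<^sup>+u. ennreal (h u) \<partial>M) r \<le> ennreal (C powr (1 - r)) * (\<integral>\<^sup>+u. ennreal (h u powr r) \<partial>M)"
proof -
  define I where "I = (\<integral>\<^sup>+u. ennreal (h u) \<partial>M)"
  define J where "J = (\<integral>\<^sup>+u. ennreal (h u powr r) \<partial>M)"
  \<comment> \<open>Follows from \<open>h = h^(1-r) h^r\<close>. It is applied twice: with the crude
    bound \<open>B\<close> to see that \<open>I\<close> is finite, and with \<open>C * i\<close> to
    obtain the constant.\<close>
  have bnd: "I \<le> ennreal (D powr (1 - r)) * J" if D: "\<And>u. h u \<le> D" for D
  proof -
    have pt: "h u \<le> D powr (1 - r) * h u powr r" for u
    proof (cases "h u = 0")
      case False
      have "h u = h u powr (1 - r) * h u powr r" using h(1)[of u] by (simp flip: powr_add)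
      also have "\<dots> \<le> D powr (1 - r) * h u powr r"
        using D h r by (intro mult_right_mono powr_mono2) auto
      finally show ?thesis .
    qed simp
    have "I \<le> (\<integral>\<^sup>+u. ennreal (D powr (1 - r)) * ennreal (h u powr r) \<partial>M)"
      unfolding I_def by (intro nn_integral_mono) (simp add: pt flip: ennreal_mult)
    also have "\<dots> = ennreal (D powr (1 - r)) * J"
      unfolding J_def by (rule nn_integral_cmult) measurable
    finally show ?thesis .
  qed
  show ?thesis
  proof (cases "J = top")
    case True
    thus ?thesis using C by (simp add: J_def[symmetric] ennreal_mult_top)
  next
    case False
    have "I < top" using bnd[OF h(2)] False by (auto simp: ennreal_mult_less_top less_top intro: le_less_trans)
    then obtain i where i: "0 \<le> i" "I = ennreal i" by (cases I) auto
    obtain j where j: "0 \<le> j" "J = ennreal j" using False by (cases J) auto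
    have "i powr r \<le> C powr (1 - r) * j"
    proof (cases "i = 0")
      case False
      hence ip: "0 < i" using i by simp
      \<comment> \<open>Self-domination replaces \<open>B\<close> by a multiple of the integral
        itself. Then \<open>i <= (C i)^(1-r) j\<close>, and \<open>i^(1-r)\<close> can be divided
        out because \<open>i\<close> is finite and positive.\<close>
      have "h u \<le> C * i" for u
        using le[of u] C i by (simp add: I_def[symmetric] flip: ennreal_mult)
      from bnd[OF this] have "i \<le> (C * i) powr (1 - r) * j"
        using i j by (simp flip: ennreal_mult)
      also have "\<dots> = C powr (1 - r) * j * (i / i powr r)"
        using ip C by (simp add: powr_mult powr_diff)
      finally have "i * (i powr r) \<le> C powr (1 - r) * j * i" using ip by (simp add: field_simps)
      thus ?thesis using ip by simp
    qed (use j in simp)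
    thus ?thesis using i j by (simp add: I_def[symmetric] J_def[symmetric] enn_powr_ennreal flip: ennreal_mult)
  qed
qed

section \<open>Young's and Hoelder's inequalities\<close>

text \<open>Convexity of \<open>x powr Q\<close>: the graph lies above its tangent at
  \<open>t\<close>. The point of tangency stays free and is optimised later.\<close>

lemma young_ineq_powr:
  fixes x t Q :: real
  assumes "0 \<le> x" "0 < t" "1 \<le> Q"
  shows "Q * t powr (Q - 1) * x \<le> x powr Q + (Q - 1) * t powr Q"
proof (cases "Q = 1 \<or> x = 0")
  case True
  thus ?thesis using assms by auto
next
  case False
  have Q: "1 < Q" "0 < x" using False assms by auto
  have "(x powr Q) powr (1 / Q) * (t powr Q) powr (1 - 1 / Q) \<le> 1 / Q * x powr Q + (1 - 1 / Q) * t powr Q"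
    by (rule Youngs_inequality_0) (use assms Q in auto)
  moreover have "Q * (1 - 1 / Q) = Q - 1" using Q by (simp add: field_simps)
  ultimately have "x * t powr (Q - 1) \<le> 1 / Q * x powr Q + (1 - 1 / Q) * t powr Q"
    using Q by (simp add: powr_powr)
  hence "Q * (x * t powr (Q - 1)) \<le> Q * (1 / Q * x powr Q + (1 - 1 / Q) * t powr Q)"
    using Q by (intro mult_left_mono) auto
  also have "\<dots> = x powr Q + (Q - 1) * t powr Q" using Q by (simp add: distrib_left) (simp add: field_simps)
  finally show ?thesis by (simp only: mult_ac)
qed

text \<open>Hoelder's inequality for \<open>k = (k / b) b\<close> with respect to the measure of
  density \<open>b\<close>. The tangent inequality is used at \<open>k / b\<close> and integrated
  against \<open>b\<close>. Where \<open>b\<close> is infinite the quotient is read as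
  \<open>0\<close>; there the right side of the pointwise inequality is infinite through its second
  summand.\<close>

lemma nn_integral_powr_Hoelder:
  fixes k b :: "'a \<Rightarrow> ennreal"
  assumes [measurable]: "k \<in> borel_measurable M" "b \<in> borel_measurable M"
    and Q: "1 < Q" and b0: "\<And>w. 0 < b w" and T: "(\<integral>\<^sup>+w. b w \<partial>M) = ennreal T" "0 < T"
  shows "enn_powr (\<integral>\<^sup>+w. k w \<partial>M) Q
    \<le> ennreal (T powr (Q - 1)) * (\<integral>\<^sup>+w. enn_powr (k w) Q * (if b w = top then 0 else ennreal (enn2real (b w) powr (1 - Q))) \<partial>M)"
    (is "_ \<le> _ * (\<integral>\<^sup>+w. ?g w \<partial>M)")
proof -
  define S where "S = (\<integral>\<^sup>+w. k w \<partial>M)"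
  define J where "J = (\<integral>\<^sup>+w. ?g w \<partial>M)"
  have pt: "ennreal (Q * t powr (Q - 1)) * k w \<le> ?g w + ennreal ((Q - 1) * t powr Q) * b w" if t: "0 < t" for t w
  proof (cases "b w")
    case (real y)
    hence y: "0 < y" using b0[of w] by simp
    show ?thesis
    proof (cases "k w")
      case (real x)
      have "y * (Q * t powr (Q - 1) * (x / y)) \<le> y * ((x / y) powr Q + (Q - 1) * t powr Q)"
        using young_ineq_powr[of "x / y" t Q] real y t Q by (intro mult_left_mono) auto
      also have "y * (Q * t powr (Q - 1) * (x / y)) = Q * t powr (Q - 1) * x" using y by simp
      also have "y * ((x / y) powr Q + (Q - 1) * t powr Q) = x powr Q * y powr (1 - Q) + (Q - 1) * t powr Q * y"
        using y real by (simp add: powr_divide powr_diff field_simps)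
      finally have "ennreal (Q * t powr (Q - 1) * x) \<le> ennreal (x powr Q * y powr (1 - Q) + (Q - 1) * t powr Q * y)"
        by (rule ennreal_leI)
      thus ?thesis using real \<open>b w = ennreal y\<close> y Q
        by (simp add: enn_powr_ennreal ennreal_mult ennreal_plus)
    next
      case top
      thus ?thesis using \<open>b w = ennreal y\<close> y by (simp add: ennreal_top_mult)
    qed
  next
    case top
    thus ?thesis using Q t by (simp add: ennreal_mult_top)
  qed
  have int: "ennreal (Q * t powr (Q - 1)) * S \<le> J + ennreal ((Q - 1) * t powr Q * T)" if t: "0 < t" for t
  proof -
    have "ennreal (Q * t powr (Q - 1)) * S = (\<integral>\<^sup>+w. ennreal (Q * t powr (Q - 1)) * k w \<partial>M)"
      unfolding S_def by (rule nn_integral_cmult[symmetric]) measurable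
    also have "\<dots> \<le> (\<integral>\<^sup>+w. ?g w + ennreal ((Q - 1) * t powr Q) * b w \<partial>M)"
      by (intro nn_integral_mono pt t)
    also have "\<dots> = J + (\<integral>\<^sup>+w. ennreal ((Q - 1) * t powr Q) * b w \<partial>M)"
      unfolding J_def by (rule nn_integral_add) measurable
    also have "(\<integral>\<^sup>+w. ennreal ((Q - 1) * t powr Q) * b w \<partial>M) = ennreal ((Q - 1) * t powr Q * T)"
      using Q T by (simp add: nn_integral_cmult ennreal_mult)
    finally show ?thesis .
  qed
  show ?thesis
  proof (cases "J = top")
    case True
    thus ?thesis using T by (simp add: J_def[symmetric] ennreal_mult_top)
  next
    case False
    then obtain j where j: "0 \<le> j" "J = ennreal j" by (cases J) auto
    \<comment> \<open>The value \<open>t = 1\<close> is a preliminary choice that shows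
      \<open>S\<close> to be finite.\<close>
    have "ennreal (Q * 1 powr (Q - 1)) * S < top"
      using int[of 1] j by (auto intro: le_less_trans)
    hence "S \<noteq> top" using Q by (auto simp: ennreal_mult_top)
    then obtain x where x: "0 \<le> x" "S = ennreal x" by (cases S) auto
    have "x powr Q \<le> T powr (Q - 1) * j"
    proof (cases "x = 0")
      case False
      \<comment> \<open>The optimal point of tangency: the mean of \<open>k / b\<close> with respect
        to \<open>b\<close>.\<close>
      define t where "t = x / T"
      have t: "0 < t" using False x T by (simp add: t_def)
      have "Q * t powr (Q - 1) * x \<le> j + (Q - 1) * t powr Q * T"
        using int[OF t] x j Q T by (simp flip: ennreal_mult ennreal_plus)
      moreover have "t powr (Q - 1) * x = t powr Q * T" using t T by (simp add: powr_diff t_def field_simps)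
      ultimately have "t powr Q * T \<le> j" by (simp add: algebra_simps)
      hence "T powr (Q - 1) * (t powr Q * T) \<le> T powr (Q - 1) * j" by (intro mult_left_mono) auto
      moreover have "T powr (Q - 1) * (t powr Q * T) = x powr Q"
        using T x by (simp add: t_def powr_divide powr_diff field_simps)
      ultimately show ?thesis by simp
    qed (use j in simp)
    thus ?thesis using x j by (simp add: S_def[symmetric] J_def[symmetric] enn_powr_ennreal flip: ennreal_mult)
  qed
qed

section \<open>Elementary properties of Lebesgue quasi-norms\<close>

lemma lpnorm_top: "lpnorm top h = esssup lborel h"
  by (simp add: lpnorm_def)

lemma lpnorm_ennreal:
  "0 < Q \<Longrightarrow> lpnorm (ennreal Q) h = enn_powr (\<integral>\<^sup>+x. enn_powr (h x) Q \<partial>lborel) (1 / Q)"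
  by (simp add: lpnorm_def)

text \<open>Expresses a bound on the essential supremum through an integral, so that measurability
  in a parameter and translation invariance follow from the corresponding facts for
  integrals.\<close>

lemma esssup_le_iff:
  fixes h :: "'a::euclidean_space \<Rightarrow> ennreal"
  assumes [measurable]: "h \<in> borel_measurable borel"
  shows "esssup lborel h \<le> c \<longleftrightarrow> (\<integral>\<^sup>+x. (if c < h x then 1 else 0) \<partial>lborel) = 0"
proof -
  have "(\<integral>\<^sup>+x. (if c < h x then 1 else 0) \<partial>lborel) = 0 \<longleftrightarrow> (AE x in lborel. (if c < h x then 1 else 0 :: ennreal) = 0)"
    by (rule nn_integral_0_iff_AE) measurable
  also have "\<dots> \<longleftrightarrow> (AE x in lborel. h x \<le> c)"
    by (intro AE_cong) (auto simp: not_less)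
  also have "\<dots> \<longleftrightarrow> esssup lborel h \<le> c"
  proof
    assume "AE x in lborel. h x \<le> c"
    thus "esssup lborel h \<le> c" by (intro esssup_I) auto
  next
    assume le: "esssup lborel h \<le> c"
    have "AE x in lborel. h x \<le> esssup lborel h" by (rule esssup_AE)
    thus "AE x in lborel. h x \<le> c" by eventually_elim (use le in auto)
  qed
  finally show ?thesis by blast
qed

lemma measurable_lpnorm:
  fixes K :: "'a \<Rightarrow> real^'n::finite \<Rightarrow> ennreal"
  assumes K [measurable]: "(\<lambda>(w, x). K w x) \<in> borel_measurable (M \<Otimes>\<^sub>M borel)"
  shows "(\<lambda>w. lpnorm Q (K w)) \<in> borel_measurable M"
proof (cases "Q = top")
  case False
  have "(\<lambda>w. enn_powr (\<integral>\<^sup>+x. enn_powr (K w x) (enn2real Q) \<partial>lborel) (1 / enn2real Q)) \<in> borel_measurable M"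
    by measurable
  thus ?thesis using False by (simp add: lpnorm_def)
next
  case True
  have Kw: "K w \<in> borel_measurable borel" if "w \<in> space M" for w
    using measurable_compose[OF measurable_Pair1'[OF that] K] by (simp add: comp_def)
  have "(\<lambda>w. esssup lborel (K w)) \<in> borel_measurable M"
  proof (rule borel_measurableI_le)
    fix c :: ennreal
    have "{w \<in> space M. esssup lborel (K w) \<le> c} = {w \<in> space M. (\<integral>\<^sup>+x. (if c < K w x then 1 else 0) \<partial>lborel) = 0}"
      using esssup_le_iff[OF Kw] by auto
    also have "\<dots> \<in> sets M" by measurable
    finally show "{w \<in> space M. esssup lborel (K w) \<le> c} \<in> sets M" .
  qed
  thus ?thesis using True by (simp add: lpnorm_top)
qed

lemma lpnorm_mono:
  assumes f: "f \<in> borel_measurable borel" and le: "\<And>x. f x \<le> g x"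
  shows "lpnorm Q f \<le> lpnorm Q g"
proof (cases "Q = top")
  case True
  thus ?thesis using f le by (auto simp: lpnorm_top intro: esssup_mono)
next
  case False
  thus ?thesis by (auto simp: lpnorm_def intro!: enn_powr_mono nn_integral_mono le)
qed

lemma lpnorm_translate:
  fixes h :: "real^'n::finite \<Rightarrow> ennreal"
  assumes h [measurable]: "h \<in> borel_measurable borel"
  shows "lpnorm Q (\<lambda>x. h (x - a)) = lpnorm Q h"
proof (cases "Q = top")
  case False
  have "(\<integral>\<^sup>+x. enn_powr (h (x - a)) (enn2real Q) \<partial>lborel) = (\<integral>\<^sup>+x. enn_powr (h x) (enn2real Q) \<partial>lborel)"
    using nn_integral_lborel_translate[of "\<lambda>x. enn_powr (h x) (enn2real Q)" "- a"] by simp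
  thus ?thesis using False by (simp add: lpnorm_def)
next
  case True
  have "esssup lborel (\<lambda>x. h (x - a)) \<le> c \<longleftrightarrow> esssup lborel h \<le> c" for c
  proof -
    have "(\<integral>\<^sup>+x. (if c < h (x - a) then 1 else 0 :: ennreal) \<partial>lborel) = (\<integral>\<^sup>+x. (if c < h x then 1 else 0) \<partial>lborel)"
      using nn_integral_lborel_translate[of "\<lambda>x. if c < h x then 1 else 0 :: ennreal" "- a"] by simp
    thus ?thesis by (simp add: esssup_le_iff)
  qed
  thus ?thesis unfolding True lpnorm_top by (intro antisym) auto
qed

lemma lpnorm_cmult_le:
  fixes h :: "real^'n::finite \<Rightarrow> ennreal"
  assumes [measurable]: "h \<in> borel_measurable borel" and Q: "0 < Q" and c: "0 \<le> c"
  shows "lpnorm Q (\<lambda>x. ennreal c * h x) \<le> ennreal c * lpnorm Q h"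
proof (cases Q)
  case (real p)
  hence p: "0 < p" using Q by simp
  have "(\<integral>\<^sup>+x. enn_powr (ennreal c * h x) p \<partial>lborel) = ennreal (c powr p) * (\<integral>\<^sup>+x. enn_powr (h x) p \<partial>lborel)"
    unfolding enn_powr_mult[OF p] enn_powr_ennreal[OF c] by (rule nn_integral_cmult) measurable
  moreover have "enn_powr (ennreal (c powr p)) (1 / p) = ennreal c"
    using c p by (simp add: enn_powr_ennreal powr_powr)
  ultimately show ?thesis unfolding real(2) lpnorm_ennreal[OF p] using p
    by (simp add: enn_powr_mult)
next
  case top
  have "AE x in lborel. h x \<le> esssup lborel h" by (rule esssup_AE)
  hence "AE x in lborel. ennreal c * h x \<le> ennreal c * esssup lborel h"
    by eventually_elim (simp add: mult_left_mono)
  thus ?thesis unfolding top lpnorm_top by (intro esssup_I) auto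
qed

text \<open>The passage from exponents that may be below \<open>1\<close> to exponents for which the
  triangle inequality is available.\<close>

lemma lpnorm_powr:
  fixes h :: "real^'n::finite \<Rightarrow> ennreal"
  assumes [measurable]: "h \<in> borel_measurable borel" and Q: "0 < Q" and r: "0 < r"
  shows "lpnorm (Q / ennreal r) (\<lambda>x. enn_powr (h x) r) = enn_powr (lpnorm Q h) r"
proof (cases Q)
  case (real q)
  hence q: "0 < q" using Q by simp
  have "Q / ennreal r = ennreal (q / r)" using real q r by (simp add: divide_ennreal)
  thus ?thesis using q r by (simp add: real(2) lpnorm_ennreal enn_powr_powr)
next
  case top
  have "esssup lborel (\<lambda>x. enn_powr (h x) r) = enn_powr (esssup lborel h) r"
  proof (rule antisym)
    have "AE x in lborel. h x \<le> esssup lborel h" by (rule esssup_AE)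
    hence "AE x in lborel. enn_powr (h x) r \<le> enn_powr (esssup lborel h) r"
      by eventually_elim (use r in \<open>simp add: enn_powr_mono\<close>)
    thus "esssup lborel (\<lambda>x. enn_powr (h x) r) \<le> enn_powr (esssup lborel h) r"
      by (intro esssup_I) auto
    have "AE x in lborel. enn_powr (h x) r \<le> esssup lborel (\<lambda>x. enn_powr (h x) r)" by (rule esssup_AE)
    hence "AE x in lborel. h x \<le> enn_powr (esssup lborel (\<lambda>x. enn_powr (h x) r)) (1 / r)"
    proof eventually_elim
      case (elim x)
      have "enn_powr (enn_powr (h x) r) (1 / r) \<le> enn_powr (esssup lborel (\<lambda>x. enn_powr (h x) r)) (1 / r)"
        using elim r by (intro enn_powr_mono) auto
      thus ?case using r by (simp add: enn_powr_powr)
    qed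
    hence "esssup lborel h \<le> enn_powr (esssup lborel (\<lambda>x. enn_powr (h x) r)) (1 / r)"
      by (intro esssup_I) auto
    hence "enn_powr (esssup lborel h) r \<le> enn_powr (enn_powr (esssup lborel (\<lambda>x. enn_powr (h x) r)) (1 / r)) r"
      using r by (intro enn_powr_mono) auto
    thus "enn_powr (esssup lborel h) r \<le> esssup lborel (\<lambda>x. enn_powr (h x) r)"
      using r by (simp add: enn_powr_powr)
  qed
  moreover have "Q / ennreal r = top" using top r by (simp add: ennreal_top_divide)
  ultimately show ?thesis by (simp add: top lpnorm_top)
qed

text \<open>Hoelder's inequality with the weight \<open>\<parallel>K w\<parallel> + \<epsilon> \<rho>(w)\<close>; the strictly positive
  \<open>\<rho>\<close> avoids a division by zero.\<close>

lemma lpnorm_Minkowski_finite: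
  fixes K :: "real^'n::finite \<Rightarrow> real^'n \<Rightarrow> ennreal"
  assumes K [measurable]: "(\<lambda>(w, x). K w x) \<in> borel_measurable (borel \<Otimes>\<^sub>M borel)" and Q: "1 < Q"
  shows "lpnorm (ennreal Q) (\<lambda>x. \<integral>\<^sup>+w. K w x \<partial>lborel) \<le> (\<integral>\<^sup>+w. lpnorm (ennreal Q) (K w) \<partial>lborel)"
proof (cases "(\<integral>\<^sup>+w. lpnorm (ennreal Q) (K w) \<partial>lborel) = top")
  case False
  have Q0: "0 < Q" using Q by simp
  define B where "B w = lpnorm (ennreal Q) (K w)" for w
  have [measurable]: "B \<in> borel_measurable borel" unfolding B_def by (rule measurable_lpnorm[OF K])
  obtain T where T: "0 \<le> T" "(\<integral>\<^sup>+w. B w \<partial>lborel) = ennreal T"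
    using False unfolding B_def[symmetric] by (cases "\<integral>\<^sup>+w. B w \<partial>lborel") auto
  define \<rho> where "\<rho> w = gauss 1 w" for w :: "real^'n"
  define R where "R = (LINT w::real^'n|lborel. gauss 1 w)"
  have R: "0 < R" unfolding R_def by (subst integral_gauss) auto
  have \<rho>int: "(\<integral>\<^sup>+w. ennreal (\<rho> w) \<partial>lborel) = ennreal R"
    unfolding \<rho>_def R_def by (intro nn_integral_eq_integral integrable_gauss) auto
  have [measurable]: "\<rho> \<in> borel_measurable borel" unfolding \<rho>_def by measurable
  have "lpnorm (ennreal Q) (\<lambda>x. \<integral>\<^sup>+w. K w x \<partial>lborel) \<le> ennreal T + ennreal e" if e: "0 < e" for e
  proof -
    define b where "b w = B w + ennreal (e / R * \<rho> w)" for w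
    have [measurable]: "b \<in> borel_measurable borel" unfolding b_def by measurable
    have b0: "0 < b w" for w
    proof -
      have "0 < e / R * \<rho> w" using e R by (simp add: \<rho>_def)
      thus ?thesis by (simp add: b_def add_nonneg_pos)
    qed
    have bint: "(\<integral>\<^sup>+w. b w \<partial>lborel) = ennreal (T + e)"
    proof -
      have "(\<integral>\<^sup>+w. ennreal (e / R * \<rho> w) \<partial>lborel) = (\<integral>\<^sup>+w. ennreal (e / R) * ennreal (\<rho> w) \<partial>lborel)"
        using e R by (intro nn_integral_cong ennreal_mult) (auto simp: \<rho>_def)
      also have "\<dots> = ennreal (e / R) * ennreal R" by (subst nn_integral_cmult) (auto simp: \<rho>int)
      also have "\<dots> = ennreal e" using e R by (simp flip: ennreal_mult)
      finally show ?thesis unfolding b_def using T e by (simp add: nn_integral_add)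
    qed
    define W where "W w = (if b w = top then 0 else ennreal (enn2real (b w) powr (1 - Q)))" for w
    have [measurable]: "W \<in> borel_measurable borel" unfolding W_def by measurable
    have KQ: "(\<integral>\<^sup>+x. enn_powr (K w x) Q \<partial>lborel) = enn_powr (B w) Q" for w
      using Q by (simp add: B_def lpnorm_ennreal enn_powr_powr)
    \<comment> \<open>As \<open>B <= b\<close>, the product is at most
      \<open>b^Q b^(1-Q) = b\<close>; the weight reproduces itself, and its integral is
      \<open>T + e\<close>.\<close>
    have WB: "enn_powr (B w) Q * W w \<le> b w" for w
    proof (cases "b w")
      case (real y)
      have y: "0 < y" using b0[of w] real by simp
      have "B w \<le> ennreal y" unfolding real(2)[symmetric] b_def by simp
      hence "enn_powr (B w) Q \<le> ennreal (y powr Q)"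
        using enn_powr_mono[of "B w" "ennreal y" Q] Q y by (simp add: enn_powr_ennreal)
      hence "enn_powr (B w) Q * W w \<le> ennreal (y powr Q) * W w" by (rule mult_right_mono) simp
      also have "\<dots> = b w" using y real by (simp add: W_def powr_diff flip: ennreal_mult)
      finally show ?thesis .
    qed (simp add: W_def)
    have Kx: "(\<lambda>w. K w x) \<in> borel_measurable borel" for x by measurable
    have "(\<integral>\<^sup>+x. enn_powr (\<integral>\<^sup>+w. K w x \<partial>lborel) Q \<partial>lborel)
        \<le> (\<integral>\<^sup>+x. ennreal ((T + e) powr (Q - 1)) * (\<integral>\<^sup>+w. enn_powr (K w x) Q * W w \<partial>lborel) \<partial>lborel)"
      unfolding W_def using bint T e Kx
      by (intro nn_integral_mono nn_integral_powr_Hoelder Q b0) auto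
    also have "\<dots> = ennreal ((T + e) powr (Q - 1)) * (\<integral>\<^sup>+x. \<integral>\<^sup>+w. enn_powr (K w x) Q * W w \<partial>lborel \<partial>lborel)"
      by (rule nn_integral_cmult) measurable
    also have "(\<integral>\<^sup>+x. \<integral>\<^sup>+w. enn_powr (K w x) Q * W w \<partial>lborel \<partial>lborel) = (\<integral>\<^sup>+w. \<integral>\<^sup>+x. enn_powr (K w x) Q * W w \<partial>lborel \<partial>lborel)"
      by (rule lborel_pair.Fubini') measurable
    also have "\<dots> = (\<integral>\<^sup>+w. enn_powr (B w) Q * W w \<partial>lborel)"
      unfolding KQ[symmetric] by (intro nn_integral_cong nn_integral_multc) measurable
    also have "\<dots> \<le> ennreal (T + e)"
      unfolding bint[symmetric] by (intro nn_integral_mono WB)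
    finally have "(\<integral>\<^sup>+x. enn_powr (\<integral>\<^sup>+w. K w x \<partial>lborel) Q \<partial>lborel) \<le> ennreal ((T + e) powr (Q - 1)) * ennreal (T + e)"
      by (simp add: mult_left_mono)
    also have "\<dots> = ennreal ((T + e) powr (Q - 1) * (T + e))"
      using T e by (intro ennreal_mult[symmetric]) auto
    also have "(T + e) powr (Q - 1) * (T + e) = (T + e) powr Q" using T e by (simp add: powr_diff)
    finally have "enn_powr (\<integral>\<^sup>+x. enn_powr (\<integral>\<^sup>+w. K w x \<partial>lborel) Q \<partial>lborel) (1 / Q) \<le> enn_powr (ennreal ((T + e) powr Q)) (1 / Q)"
      using Q by (intro enn_powr_mono) auto
    also have "\<dots> = ennreal T + ennreal e"
      using T e Q by (simp add: enn_powr_ennreal powr_powr)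
    finally show ?thesis by (simp add: lpnorm_ennreal[OF Q0])
  qed
  hence "lpnorm (ennreal Q) (\<lambda>x. \<integral>\<^sup>+w. K w x \<partial>lborel) \<le> ennreal T"
    by (rule ennreal_le_epsilon)
  thus ?thesis using T by (simp add: B_def)
qed simp

text \<open>The endpoints need arguments of their own: exchange of integrals for exponent
  \<open>1\<close>, and exchange of the two almost-everywhere quantifiers for
  \<open>top\<close>.\<close>

lemma lpnorm_Minkowski:
  fixes K :: "real^'n::finite \<Rightarrow> real^'n \<Rightarrow> ennreal"
  assumes K [measurable]: "(\<lambda>(w, x). K w x) \<in> borel_measurable (borel \<Otimes>\<^sub>M borel)" and Q: "1 \<le> Q"
  shows "lpnorm Q (\<lambda>x. \<integral>\<^sup>+w. K w x \<partial>lborel) \<le> (\<integral>\<^sup>+w. lpnorm Q (K w) \<partial>lborel)"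
proof (cases Q)
  case (real q)
  have q: "1 \<le> q" using Q real by simp
  show ?thesis
  proof (cases "q = 1")
    case True
    have "(\<integral>\<^sup>+x. \<integral>\<^sup>+w. K w x \<partial>lborel \<partial>lborel) = (\<integral>\<^sup>+w. \<integral>\<^sup>+x. K w x \<partial>lborel \<partial>lborel)"
      by (rule lborel_pair.Fubini') measurable
    thus ?thesis unfolding real(2) True by (simp add: lpnorm_ennreal[of 1, simplified])
  next
    case False
    thus ?thesis unfolding real(2) using q by (intro lpnorm_Minkowski_finite K) auto
  qed
next
  case top
  have [measurable]: "(\<lambda>w. lpnorm top (K w)) \<in> borel_measurable borel" by (rule measurable_lpnorm[OF K])
  have "AE w in lborel. AE x in lborel. K w x \<le> lpnorm top (K w)"
    unfolding lpnorm_top by (intro AE_I2 esssup_AE)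
  hence "AE x in lborel. AE w in lborel. K w x \<le> lpnorm top (K w)"
    by (subst (asm) lborel_pair.AE_commute) measurable
  hence "AE x in lborel. (\<integral>\<^sup>+w. K w x \<partial>lborel) \<le> (\<integral>\<^sup>+w. lpnorm top (K w) \<partial>lborel)"
    by eventually_elim (rule nn_integral_mono_AE)
  thus ?thesis unfolding top by (subst lpnorm_top, intro esssup_I) auto
qed

section \<open>Convolution in mixed norms\<close>

lemma lpnorm_Young:
  fixes a :: "real^'n::finite \<Rightarrow> ennreal" and k :: "real^'n \<Rightarrow> real"
  assumes [measurable]: "a \<in> borel_measurable borel" "k \<in> borel_measurable borel"
    and k: "\<And>z. 0 \<le> k z" and Q: "1 \<le> Q"
  shows "lpnorm Q (\<lambda>x. \<integral>\<^sup>+z. ennreal (k z) * a (x - z) \<partial>lborel) \<le> (\<integral>\<^sup>+z. ennreal (k z) \<partial>lborel) * lpnorm Q a"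
proof -
  have Q0: "0 < Q" using Q by (auto intro: less_le_trans[of 0 1])
  have "lpnorm Q (\<lambda>x. \<integral>\<^sup>+z. ennreal (k z) * a (x - z) \<partial>lborel)
      \<le> (\<integral>\<^sup>+z. lpnorm Q (\<lambda>x. ennreal (k z) * a (x - z)) \<partial>lborel)"
    by (rule lpnorm_Minkowski[OF _ Q]) measurable
  also have "\<dots> \<le> (\<integral>\<^sup>+z. ennreal (k z) * lpnorm Q a \<partial>lborel)"
  proof (rule nn_integral_mono)
    fix z
    have "lpnorm Q (\<lambda>x. ennreal (k z) * a (x - z)) \<le> ennreal (k z) * lpnorm Q (\<lambda>x. a (x - z))"
      by (rule lpnorm_cmult_le[OF _ Q0 k]) measurable
    thus "lpnorm Q (\<lambda>x. ennreal (k z) * a (x - z)) \<le> ennreal (k z) * lpnorm Q a"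
      by (simp add: lpnorm_translate)
  qed
  also have "\<dots> = (\<integral>\<^sup>+z. ennreal (k z) \<partial>lborel) * lpnorm Q a"
    by (rule nn_integral_multc) measurable
  finally show ?thesis .
qed

text \<open>The inner norm is estimated for fixed \<open>x\<close>, where Minkowski's inequality
  moves it past the integral over the outer shift \<open>z\<close>; what is left is a convolution of
  the inner norms \<open>g\<close> in the outer variable.\<close>

lemma mixed_lpnorm_Young:
  fixes A S :: "real^'n::finite \<Rightarrow> real^'n \<Rightarrow> ennreal" and k l :: "real^'n \<Rightarrow> real"
  assumes A [measurable]: "(\<lambda>(x, y). A x y) \<in> borel_measurable (borel \<Otimes>\<^sub>M borel)"
    and S [measurable]: "(\<lambda>(x, y). S x y) \<in> borel_measurable (borel \<Otimes>\<^sub>M borel)"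
    and [measurable]: "k \<in> borel_measurable borel" "l \<in> borel_measurable borel"
    and k: "\<And>z. 0 \<le> k z" and l: "\<And>z. 0 \<le> l z" and P: "1 \<le> P" and Q: "1 \<le> Q"
    and le: "\<And>x y. S x y \<le> (\<integral>\<^sup>+w. ennreal (l w) * (\<integral>\<^sup>+z. ennreal (k z) * A (x - z) (y - w) \<partial>lborel) \<partial>lborel)"
  shows "lpnorm P (\<lambda>x. lpnorm Q (S x))
    \<le> (\<integral>\<^sup>+z. ennreal (l z) \<partial>lborel) * (\<integral>\<^sup>+z. ennreal (k z) \<partial>lborel) * lpnorm P (\<lambda>x. lpnorm Q (A x))"
proof -
  have Q0: "0 < Q" "0 < P" using P Q by (auto intro: less_le_trans[of 0 1])
  define g where "g x = lpnorm Q (A x)" for x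
  have [measurable]: "g \<in> borel_measurable borel" unfolding g_def by (rule measurable_lpnorm[OF A])
  have Ax [measurable]: "A x \<in> borel_measurable borel" for x by measurable
  have Sx [measurable]: "S x \<in> borel_measurable borel" for x by measurable
  have Sg: "(\<lambda>x. lpnorm Q (S x)) \<in> borel_measurable borel" by (rule measurable_lpnorm[OF S])
  have inner: "lpnorm Q (S x) \<le> (\<integral>\<^sup>+z. ennreal (l z) \<partial>lborel) * (\<integral>\<^sup>+z. ennreal (k z) * g (x - z) \<partial>lborel)" for x
  proof -
    have "lpnorm Q (S x) \<le> lpnorm Q (\<lambda>y. \<integral>\<^sup>+w. ennreal (l w) * (\<integral>\<^sup>+z. ennreal (k z) * A (x - z) (y - w) \<partial>lborel) \<partial>lborel)"
      by (rule lpnorm_mono[OF Sx le])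
    also have "\<dots> \<le> (\<integral>\<^sup>+z. ennreal (l z) \<partial>lborel) * lpnorm Q (\<lambda>y. \<integral>\<^sup>+z. ennreal (k z) * A (x - z) y \<partial>lborel)"
      by (rule lpnorm_Young[where a = "\<lambda>y. \<integral>\<^sup>+z. ennreal (k z) * A (x - z) y \<partial>lborel", OF _ _ l Q]) measurable
    also have "lpnorm Q (\<lambda>y. \<integral>\<^sup>+z. ennreal (k z) * A (x - z) y \<partial>lborel) \<le> (\<integral>\<^sup>+z. lpnorm Q (\<lambda>y. ennreal (k z) * A (x - z) y) \<partial>lborel)"
      by (rule lpnorm_Minkowski[OF _ Q]) measurable
    also have "\<dots> \<le> (\<integral>\<^sup>+z. ennreal (k z) * g (x - z) \<partial>lborel)"
      unfolding g_def by (intro nn_integral_mono lpnorm_cmult_le Ax Q0 k)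
    finally show ?thesis by (simp add: mult_left_mono)
  qed
  have "lpnorm P (\<lambda>x. lpnorm Q (S x)) \<le> lpnorm P (\<lambda>x. (\<integral>\<^sup>+z. ennreal (l z) \<partial>lborel) * (\<integral>\<^sup>+z. ennreal (k z) * g (x - z) \<partial>lborel))"
    by (rule lpnorm_mono[OF Sg inner])
  \<comment> \<open>The integral of \<open>l\<close> may be infinite, while
    \<open>lpnorm_cmult_le\<close> takes a real factor. Written as an integral over \<open>w\<close>
    again, it is pulled out by Minkowski's inequality.\<close>
  also have "\<dots> = lpnorm P (\<lambda>x. \<integral>\<^sup>+w. ennreal (l w) * (\<integral>\<^sup>+z. ennreal (k z) * g (x - z) \<partial>lborel) \<partial>lborel)"
    by (subst nn_integral_multc) auto
  also have "\<dots> \<le> (\<integral>\<^sup>+w. lpnorm P (\<lambda>x. ennreal (l w) * (\<integral>\<^sup>+z. ennreal (k z) * g (x - z) \<partial>lborel)) \<partial>lborel)"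
    by (rule lpnorm_Minkowski[OF _ P]) measurable
  also have "\<dots> \<le> (\<integral>\<^sup>+w. ennreal (l w) * lpnorm P (\<lambda>x. \<integral>\<^sup>+z. ennreal (k z) * g (x - z) \<partial>lborel) \<partial>lborel)"
    by (intro nn_integral_mono lpnorm_cmult_le Q0 l) measurable
  also have "\<dots> = (\<integral>\<^sup>+w. ennreal (l w) \<partial>lborel) * lpnorm P (\<lambda>x. \<integral>\<^sup>+z. ennreal (k z) * g (x - z) \<partial>lborel)"
    by (rule nn_integral_multc) measurable
  also have "\<dots> \<le> (\<integral>\<^sup>+w. ennreal (l w) \<partial>lborel) * ((\<integral>\<^sup>+z. ennreal (k z) \<partial>lborel) * lpnorm P g)"
    by (intro mult_left_mono lpnorm_Young k P) auto
  finally show ?thesis by (simp add: g_def[abs_def] mult.assoc)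
qed

section \<open>Boundedness of the multiplier\<close>

lemma measurable_stft:
  assumes [measurable]: "\<phi> \<in> borel_measurable borel" "f \<in> borel_measurable borel"
  shows "(\<lambda>(x, \<xi>). stft \<phi> f x \<xi>) \<in> borel_measurable (borel \<Otimes>\<^sub>M borel)"
  unfolding stft_eq_fourier split_beta by measurable

text \<open>A qualitative bound: it supplies the finiteness required by
  \<open>nn_integral_powr_self_improve\<close>, and its dependence on \<open>f\<close> does not
  reach the final constant.\<close>

lemma stft_bounded:
  fixes \<phi> f :: "real^'n::finite \<Rightarrow> complex"
  assumes \<phi>: "schwartz \<phi>" and f: "schwartz f"
  obtains B where "0 < B" "\<And>x \<xi>. norm (stft \<phi> f x \<xi>) \<le> B"
proof -
  obtain C where C: "0 < C" "\<And>x. norm (\<phi> x) \<le> C * jbr x powr (-0)"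
    using schwartz_bound[OF \<phi>, of 0] by blast
  have "norm (stft \<phi> f x \<xi>) \<le> C * (LINT y|lborel. norm (f y)) + 1" for x \<xi>
  proof -
    have "norm (stft \<phi> f x \<xi>) \<le> (LINT y|lborel. norm (f y * cnj (\<phi> (y - x))))"
      unfolding stft_eq_fourier by (rule norm_fourier_le)
    also have "\<dots> \<le> (LINT y|lborel. C * norm (f y))"
    proof (rule integral_mono')
      show "integrable lborel (\<lambda>y. C * norm (f y))" using schwartz_integrable[OF f] by simp
      show "norm (f y * cnj (\<phi> (y - x))) \<le> C * norm (f y)" for y
        using mult_left_mono[OF C(2)[of "y - x"], of "norm (f y)"] by (simp add: norm_mult mult.commute)
    qed (use C(1) in simp)
    finally show ?thesis by simp
  qed
  moreover have "0 < C * (LINT y|lborel. norm (f y)) + 1"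
    using C(1) by (intro add_nonneg_pos mult_nonneg_nonneg integral_nonneg_AE) auto
  ultimately show thesis using that by blast
qed

section \<open>Taking r-th powers inside the phase-space integral\<close>

context phase_symbol
begin

lemma continuous_fmult:
  assumes f: "schwartz f"
  shows "continuous_on UNIV (fmult \<mu> f)"
proof -
  have Ff: "integrable lborel (fourier f)" by (rule fourier_schwartz_integrable[OF f])
  have [measurable]: "E \<in> borel_measurable borel" "fourier f \<in> borel_measurable borel"
    using continuous_E Ff by (auto simp: borel_measurable_continuous_onI)
  have "integrable lborel (\<lambda>\<eta>. E \<eta> * fourier f \<eta>)"
    by (rule Bochner_Integration.integrable_bound[OF Ff]) (auto simp: norm_mult)
  hence "continuous_on UNIV (\<lambda>x. fourier (\<lambda>\<eta>. E \<eta> * fourier f \<eta>) (- x))"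
    by (intro continuous_on_compose2[OF continuous_fourier]) (auto intro!: continuous_intros)
  moreover have "fmult \<mu> f = (\<lambda>y. fourier (\<lambda>\<eta>. E \<eta> * fourier f \<eta>) (- y))"
    by (simp add: fun_eq_iff fmult_eq_fourier E_def)
  ultimately show ?thesis by simp
qed

text \<open>For fixed \<open>(x, \<xi>)\<close> the whole integrand of the kernel bound, weights
  included, is dominated pointwise by its own integral, with a constant independent of
  \<open>f\<close>, \<open>x\<close> and \<open>\<xi>\<close>. Self-improvement then replaces the
  power of the integral by the integral of the power.\<close>

lemma stft_fmult_powr_bound:
  fixes \<phi> :: "real^'n \<Rightarrow> complex"
  assumes \<phi>: "schwartz \<phi>" "\<phi> z0 \<noteq> 0" and r: "0 < r" "r \<le> 1"
    and \<delta>: "0 \<le> \<delta>" "s * N \<le> \<delta>" and L: "\<delta> \<le> L"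
  obtains C where "0 < C"
    "\<And>f x \<xi>. schwartz f \<Longrightarrow> enn_powr (ennreal (norm (stft \<phi> (fmult \<mu> f) x \<xi>))) r \<le>
      ennreal C * (\<integral>\<^sup>+w. ennreal (jbr w powr (-(L * r))) * (\<integral>\<^sup>+z. ennreal (jbr z powr (-(N * r))) *
        ennreal ((norm (stft \<phi> f (x - z) (\<xi> - w)) * jbr (\<xi> - w) powr \<delta>) powr r) \<partial>lborel) \<partial>lborel)"
proof -
  have L0: "0 \<le> L" "0 \<le> L + \<delta>" using \<delta> L by auto
  interpret zero: phase_symbol "\<lambda>_::real^'n. 0" 0 N by (rule phase_symbol_zero[OF N])
  obtain C1 where C1: "0 < C1"
    "\<And>f x \<xi>. schwartz f \<Longrightarrow> ennreal (norm (stft \<phi> (fmult \<mu> f) x \<xi>))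
      \<le> (\<integral>\<^sup>+\<xi>'. \<integral>\<^sup>+x'. ennreal (C1 * (norm (stft \<phi> f x' \<xi>') * jbr \<xi>' powr (s * N)) *
            (jbr (x - x') powr (-N) * jbr (\<xi> - \<xi>') powr (-L))) \<partial>lborel \<partial>lborel)"
    using stft_fmult_bound[OF \<phi> L0(1)] by blast
  \<comment> \<open>The extra order \<open>\<delta>\<close> of frequency decay pays for carrying the
    weight \<open>jbr \<xi>' powr \<delta>\<close> from one frequency to another by Peetre's
    inequality.\<close>
  obtain C0 where C0: "0 < C0"
    "\<And>f x \<xi>. schwartz f \<Longrightarrow> ennreal (norm (stft \<phi> (fmult (\<lambda>_. 0) f) x \<xi>))
      \<le> (\<integral>\<^sup>+\<xi>'. \<integral>\<^sup>+x'. ennreal (C0 * (norm (stft \<phi> f x' \<xi>') * jbr \<xi>' powr (0 * N)) *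
            (jbr (x - x') powr (-N) * jbr (\<xi> - \<xi>') powr (-(L + \<delta>)))) \<partial>lborel \<partial>lborel)"
    using zero.stft_fmult_bound[OF \<phi> L0(2)] by blast
  \<comment> \<open>The three powers of \<open>2\<close> are the Peetre constants of the three
    weights in \<open>h\<close>: order \<open>\<delta>\<close> and order \<open>L\<close> in
    frequency, order \<open>N\<close> in position.\<close>
  define Cs where "Cs = C0 * (2 powr \<delta> * 2 powr N * 2 powr L)"
  have Cs: "0 < Cs" using C0(1) by (simp add: Cs_def)
  have main: "enn_powr (ennreal (norm (stft \<phi> (fmult \<mu> f) x \<xi>))) r \<le>
      ennreal (C1 powr r * Cs powr (1 - r)) * (\<integral>\<^sup>+w. ennreal (jbr w powr (-(L * r))) * (\<integral>\<^sup>+z. ennreal (jbr z powr (-(N * r))) *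
        ennreal ((norm (stft \<phi> f (x - z) (\<xi> - w)) * jbr (\<xi> - w) powr \<delta>) powr r) \<partial>lborel) \<partial>lborel)"
    if f: "schwartz f" for f x \<xi>
  proof -
    have [measurable]: "\<phi> \<in> borel_measurable borel" "f \<in> borel_measurable borel"
      using schwartz_continuous[OF \<phi>(1)] schwartz_continuous[OF f] by (auto simp: borel_measurable_continuous_onI)
    define V where "V x' \<xi>' = norm (stft \<phi> f x' \<xi>')" for x' \<xi>'
    note measurable_stft[measurable]
    have Vm [measurable]: "(\<lambda>(x', \<xi>'). V x' \<xi>') \<in> borel_measurable (borel \<Otimes>\<^sub>M borel)"
      unfolding V_def split_beta using measurable_stft[of \<phi> f] by (simp add: split_beta)
    \<comment> \<open>The first component of \<open>w\<close> is the frequency and the second the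
      position, matching the order of the iterated integrals.\<close>
    define h where "h w = V (snd w) (fst w) * jbr (fst w) powr \<delta> * (jbr (x - snd w) powr (-N) * jbr (\<xi> - fst w) powr (-L))" for w
    have hm [measurable]: "h \<in> borel_measurable (lborel \<Otimes>\<^sub>M lborel)" unfolding h_def by measurable
    have h0: "0 \<le> h w" for w by (simp add: h_def V_def)
    define I where "I = (\<integral>\<^sup>+w. ennreal (h w) \<partial>(lborel \<Otimes>\<^sub>M lborel))"
    have "ennreal (norm (stft \<phi> (fmult \<mu> f) x \<xi>)) \<le> (\<integral>\<^sup>+\<xi>'. \<integral>\<^sup>+x'. ennreal C1 * ennreal (h (\<xi>', x')) \<partial>lborel \<partial>lborel)"
    proof (rule order_trans[OF C1(2)[OF f]], intro nn_integral_mono)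
      fix \<xi>' x' :: "real^'n"
      have "jbr \<xi>' powr (s * N) \<le> jbr \<xi>' powr \<delta>" by (rule jbr_powr_mono[OF \<delta>(2)])
      hence "C1 * (V x' \<xi>' * jbr \<xi>' powr (s * N)) * (jbr (x - x') powr (-N) * jbr (\<xi> - \<xi>') powr (-L)) \<le> C1 * h (\<xi>', x')"
        using C1(1) unfolding h_def fst_conv snd_conv mult.assoc by (intro mult_left_mono mult_right_mono) (auto simp: V_def)
      thus "ennreal (C1 * (norm (stft \<phi> f x' \<xi>') * jbr \<xi>' powr (s * N)) * (jbr (x - x') powr (-N) * jbr (\<xi> - \<xi>') powr (-L)))
          \<le> ennreal C1 * ennreal (h (\<xi>', x'))"
        using C1(1) h0 by (simp add: V_def[symmetric] ennreal_leI flip: ennreal_mult)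
    qed
    also have "\<dots> = (\<integral>\<^sup>+w. ennreal C1 * ennreal (h w) \<partial>(lborel \<Otimes>\<^sub>M lborel))"
      by (rule lborel.nn_integral_fst) measurable
    also have "\<dots> = ennreal C1 * I" unfolding I_def by (rule nn_integral_cmult) measurable
    finally have G: "ennreal (norm (stft \<phi> (fmult \<mu> f) x \<xi>)) \<le> ennreal C1 * I" .
    obtain Bf where Bf: "0 < Bf" "\<And>x \<xi>. norm (stft \<phi> f x \<xi>) \<le> Bf" using stft_bounded[OF \<phi>(1) f] by blast
    \<comment> \<open>Here \<open>\<delta> <= L\<close> is needed: the kernel decay in frequency has
      to beat the growth of the weight. The bound may depend on \<open>f\<close> and
      \<open>\<xi>\<close>.\<close>
    have hB: "h w \<le> Bf * (2 powr \<delta> * jbr \<xi> powr \<delta>)" for w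
    proof -
      have "jbr (fst w) powr \<delta> * jbr (\<xi> - fst w) powr (-L) \<le> (2 powr \<delta> * (jbr (fst w - \<xi>) powr \<delta> * jbr \<xi> powr \<delta>)) * jbr (\<xi> - fst w) powr (-\<delta>)"
        using jbr_powr_shift_le[of "fst w" \<delta> \<xi>] \<delta>(1) L by (intro mult_mono jbr_powr_mono) auto
      also have "\<dots> = 2 powr \<delta> * jbr \<xi> powr \<delta>"
        by (simp add: jbr_minus_commute[of \<xi>] powr_minus field_simps)
      finally have 1: "jbr (fst w) powr \<delta> * jbr (\<xi> - fst w) powr (-L) \<le> 2 powr \<delta> * jbr \<xi> powr \<delta>" .
      have "h w = V (snd w) (fst w) * ((jbr (fst w) powr \<delta> * jbr (\<xi> - fst w) powr (-L)) * jbr (x - snd w) powr (-N))"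
        by (simp only: h_def mult_ac)
      also have "\<dots> \<le> Bf * ((2 powr \<delta> * jbr \<xi> powr \<delta>) * 1)"
        using Bf N0 by (intro mult_mono 1 jbr_powr_le_1) (auto simp: V_def)
      finally show ?thesis by simp
    qed
    have self: "ennreal (h w) \<le> ennreal Cs * I" for w
    proof -
      define w1 w2 where "w1 = snd w" and "w2 = fst w"
      define c where "c = jbr w2 powr \<delta> * (jbr (x - w1) powr (-N) * jbr (\<xi> - w2) powr (-L))"
      have c: "0 \<le> c" by (simp add: c_def)
      define g where "g u = C0 * V (snd u) (fst u) * (jbr (w1 - snd u) powr (-N) * jbr (w2 - fst u) powr (-(L + \<delta>)))" for u
      have gm [measurable]: "g \<in> borel_measurable (lborel \<Otimes>\<^sub>M lborel)" unfolding g_def by measurable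
      have g0: "0 \<le> g u" for u using C0(1) by (simp add: g_def V_def)
      have "ennreal (V w1 w2) \<le> (\<integral>\<^sup>+\<xi>'. \<integral>\<^sup>+x'. ennreal (g (\<xi>', x')) \<partial>lborel \<partial>lborel)"
        using C0(2)[OF f, of w1 w2] by (simp add: fmult_zero[OF f] V_def g_def)
      also have "\<dots> = (\<integral>\<^sup>+u. ennreal (g u) \<partial>(lborel \<Otimes>\<^sub>M lborel))"
        by (rule lborel.nn_integral_fst) measurable
      finally have V: "ennreal (V w1 w2) \<le> (\<integral>\<^sup>+u. ennreal (g u) \<partial>(lborel \<Otimes>\<^sub>M lborel))" .
      have "ennreal (h w) = ennreal (V w1 w2) * ennreal c"
        using c by (simp add: h_def w1_def w2_def c_def V_def mult.assoc flip: ennreal_mult)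
      also have "\<dots> \<le> (\<integral>\<^sup>+u. ennreal (g u) \<partial>(lborel \<Otimes>\<^sub>M lborel)) * ennreal c" by (rule mult_right_mono[OF V]) simp
      also have "\<dots> = (\<integral>\<^sup>+u. ennreal (g u) * ennreal c \<partial>(lborel \<Otimes>\<^sub>M lborel))"
        by (rule nn_integral_multc[symmetric]) measurable
      also have "\<dots> \<le> (\<integral>\<^sup>+u. ennreal Cs * ennreal (h u) \<partial>(lborel \<Otimes>\<^sub>M lborel))"
      proof (rule nn_integral_mono)
        fix u :: "(real^'n) \<times> (real^'n)"
        define x' \<xi>' where "x' = snd u" and "\<xi>' = fst u"
        have 1: "jbr w2 powr \<delta> \<le> 2 powr \<delta> * (jbr (w2 - \<xi>') powr \<delta> * jbr \<xi>' powr \<delta>)"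
          using jbr_powr_shift_le[of w2 \<delta> "\<xi>'"] \<delta>(1) by simp
        have 2: "jbr (x - w1) powr (-N) * jbr (w1 - x') powr (-N) \<le> 2 powr N * jbr (x - x') powr (-N)"
          using jbr_powr_minus_mult_le[OF N0, of "x - w1" "w1 - x'"] by simp
        have 3: "jbr (\<xi> - w2) powr (-L) * jbr (w2 - \<xi>') powr (-L) \<le> 2 powr L * jbr (\<xi> - \<xi>') powr (-L)"
          using jbr_powr_minus_mult_le[OF L0(1), of "\<xi> - w2" "w2 - \<xi>'"] by simp
        have 4: "jbr (w2 - \<xi>') powr \<delta> * jbr (w2 - \<xi>') powr (-(L + \<delta>)) = jbr (w2 - \<xi>') powr (-L)"
          by (simp flip: powr_add)
        have "g u * c = C0 * V x' \<xi>' * (jbr w2 powr \<delta> * ((jbr (x - w1) powr (-N) * jbr (w1 - x') powr (-N)) *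
            (jbr (\<xi> - w2) powr (-L) * jbr (w2 - \<xi>') powr (-(L + \<delta>)))))"
          by (simp only: g_def c_def x'_def \<xi>'_def mult_ac)
        also have "\<dots> \<le> C0 * V x' \<xi>' * ((2 powr \<delta> * (jbr (w2 - \<xi>') powr \<delta> * jbr \<xi>' powr \<delta>)) * ((2 powr N * jbr (x - x') powr (-N)) *
            (jbr (\<xi> - w2) powr (-L) * jbr (w2 - \<xi>') powr (-(L + \<delta>)))))"
          using C0(1) by (intro mult_left_mono mult_mono 1 2 order_refl) (auto simp: V_def)
        also have "\<dots> = (C0 * V x' \<xi>' * (2 powr \<delta> * jbr \<xi>' powr \<delta>) * (2 powr N * jbr (x - x') powr (-N))) *
            (jbr (\<xi> - w2) powr (-L) * (jbr (w2 - \<xi>') powr \<delta> * jbr (w2 - \<xi>') powr (-(L + \<delta>))))"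
          by (simp only: mult_ac)
        also have "\<dots> \<le> (C0 * V x' \<xi>' * (2 powr \<delta> * jbr \<xi>' powr \<delta>) * (2 powr N * jbr (x - x') powr (-N))) *
            (2 powr L * jbr (\<xi> - \<xi>') powr (-L))"
          unfolding 4 using C0(1) by (intro mult_left_mono 3) (auto simp: V_def)
        also have "\<dots> = Cs * h u" by (simp only: Cs_def h_def x'_def \<xi>'_def mult_ac)
        finally show "ennreal (g u) * ennreal c \<le> ennreal Cs * ennreal (h u)"
          using c g0 h0 Cs by (simp add: ennreal_leI flip: ennreal_mult)
      qed
      also have "\<dots> = ennreal Cs * I" unfolding I_def by (rule nn_integral_cmult) measurable
      finally show ?thesis .
    qed
    define J where "J = (\<integral>\<^sup>+w. ennreal (jbr w powr (-(L * r))) * (\<integral>\<^sup>+z. ennreal (jbr z powr (-(N * r))) *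
        ennreal ((V (x - z) (\<xi> - w) * jbr (\<xi> - w) powr \<delta>) powr r) \<partial>lborel) \<partial>lborel)"
    have "enn_powr I r \<le> ennreal (Cs powr (1 - r)) * (\<integral>\<^sup>+w. ennreal (h w powr r) \<partial>(lborel \<Otimes>\<^sub>M lborel))"
      unfolding I_def by (rule nn_integral_powr_self_improve[OF hm h0 hB r Cs self[unfolded I_def]])
    also have "(\<integral>\<^sup>+w. ennreal (h w powr r) \<partial>(lborel \<Otimes>\<^sub>M lborel)) = (\<integral>\<^sup>+\<xi>'. \<integral>\<^sup>+x'. ennreal (h (\<xi>', x') powr r) \<partial>lborel \<partial>lborel)"
      by (rule lborel.nn_integral_fst[symmetric]) measurable
    also have "\<dots> = (\<integral>\<^sup>+w. \<integral>\<^sup>+z. ennreal (h (\<xi> - w, x - z) powr r) \<partial>lborel \<partial>lborel)"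
    proof -
      have "(\<integral>\<^sup>+\<xi>'. \<integral>\<^sup>+x'. ennreal (h (\<xi>', x') powr r) \<partial>lborel \<partial>lborel) = (\<integral>\<^sup>+w. \<integral>\<^sup>+x'. ennreal (h (\<xi> - w, x') powr r) \<partial>lborel \<partial>lborel)"
        by (rule nn_integral_lborel_reflect[symmetric]) measurable
      also have "\<dots> = (\<integral>\<^sup>+w. \<integral>\<^sup>+z. ennreal (h (\<xi> - w, x - z) powr r) \<partial>lborel \<partial>lborel)"
        by (intro nn_integral_cong nn_integral_lborel_reflect[symmetric]) measurable
      finally show ?thesis .
    qed
    also have "\<dots> = J"
      unfolding J_def
    proof (rule nn_integral_cong)
      fix w
      have "(\<integral>\<^sup>+z. ennreal (h (\<xi> - w, x - z) powr r) \<partial>lborel) = (\<integral>\<^sup>+z. ennreal (jbr w powr (-(L * r))) * (ennreal (jbr z powr (-(N * r))) *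
        ennreal ((V (x - z) (\<xi> - w) * jbr (\<xi> - w) powr \<delta>) powr r)) \<partial>lborel)"
      proof (rule nn_integral_cong)
        fix z
        have "h (\<xi> - w, x - z) powr r = jbr w powr (-(L * r)) * (jbr z powr (-(N * r)) * (V (x - z) (\<xi> - w) * jbr (\<xi> - w) powr \<delta>) powr r)"
          by (simp add: h_def powr_mult powr_powr V_def mult_ac)
        thus "ennreal (h (\<xi> - w, x - z) powr r) = ennreal (jbr w powr (-(L * r))) * (ennreal (jbr z powr (-(N * r))) *
          ennreal ((V (x - z) (\<xi> - w) * jbr (\<xi> - w) powr \<delta>) powr r))"
          by (simp flip: ennreal_mult)
      qed
      also have "\<dots> = ennreal (jbr w powr (-(L * r))) * (\<integral>\<^sup>+z. ennreal (jbr z powr (-(N * r))) *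
        ennreal ((V (x - z) (\<xi> - w) * jbr (\<xi> - w) powr \<delta>) powr r) \<partial>lborel)"
        by (rule nn_integral_cmult) measurable
      finally show "(\<integral>\<^sup>+z. ennreal (h (\<xi> - w, x - z) powr r) \<partial>lborel) = ennreal (jbr w powr (-(L * r))) * (\<integral>\<^sup>+z. ennreal (jbr z powr (-(N * r))) *
        ennreal ((V (x - z) (\<xi> - w) * jbr (\<xi> - w) powr \<delta>) powr r) \<partial>lborel)" .
    qed
    finally have I: "enn_powr I r \<le> ennreal (Cs powr (1 - r)) * J" .
    have "enn_powr (ennreal (norm (stft \<phi> (fmult \<mu> f) x \<xi>))) r \<le> enn_powr (ennreal C1 * I) r"
      using G r by (intro enn_powr_mono) auto
    also have "\<dots> = ennreal (C1 powr r) * enn_powr I r" using r C1(1) by (simp add: enn_powr_mult enn_powr_ennreal)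
    also have "\<dots> \<le> ennreal (C1 powr r) * (ennreal (Cs powr (1 - r)) * J)"
      by (rule mult_left_mono[OF I]) simp
    finally show ?thesis unfolding J_def V_def by (simp add: ennreal_mult mult.assoc)
  qed
  have "0 < C1 powr r * Cs powr (1 - r)" using C1(1) Cs by simp
  thus thesis using that main by blast
qed

end

section \<open>Choice of parameters and conclusion\<close>

theorem theorem1p2:
  fixes \<phi> :: "real^'n::finite \<Rightarrow> complex"
    and p q :: ennreal
    and \<mu> :: "real^'n \<Rightarrow> real"
    and s \<epsilon> \<delta> :: real
  assumes window: "schwartz \<phi>" "\<phi> \<noteq> (\<lambda>_. 0)"
    and pq: "0 < p" "0 < q"
    and C1: "\<forall>x. \<mu> differentiable (at x)" "\<forall>j. continuous_on UNIV (pdiff j \<mu>)"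
    and s: "s > 0" and eps: "\<epsilon> > 0"
    and hyp: "\<forall>j. in_W \<phi> top top
                 (real CARD('n) / enn2real (min 1 (min p q)) + \<epsilon>)
                 (\<lambda>\<xi>. complex_of_real (jbr \<xi> powr (- s) * pdiff j \<mu> \<xi>))"
    and delta: "\<delta> > s * real CARD('n) / enn2real (min 1 (min p q))"
  shows "\<exists>C::real. \<forall>f. schwartz f \<longrightarrow>
           wnorm \<phi> p q 0 (fmult \<mu> f) \<le> ennreal C * wnorm \<phi> p q \<delta> f"
proof -
  define n where "n = real CARD('n)"
  have n: "0 < n" by (simp add: n_def)
  define m where "m = min 1 (min p q)"
  have m: "0 < m" "m \<le> 1" "m \<le> p" "m \<le> q" "m \<noteq> top"
    using pq by (auto simp: m_def min_def top_unique)
  define r where "r = enn2real m"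
  have rm: "ennreal r = m" using m by (simp add: r_def less_top)
  have r: "0 < r" "r \<le> 1" using m rm by (auto simp: r_def enn2real_positive_iff less_top intro: enn2real_leI)
  \<comment> \<open>The order \<open>N = n / r + e\<close> has to stay within the decay granted by
    the hypothesis, hence \<open>e <= \<epsilon>\<close>, and within the available weight
    \<open>s * N <= \<delta>\<close>, hence the second bound. The strict inequality for
    \<open>\<delta>\<close> keeps \<open>e\<close> positive.\<close>
  define e where "e = min \<epsilon> (\<delta> / s - n / r)"
  have "s * n / r < \<delta>" using delta by (simp add: n_def r_def m_def)
  hence "n / r < \<delta> / s" using s r by (simp add: field_simps)
  hence e: "0 < e" "e \<le> \<epsilon>" "e \<le> \<delta> / s - n / r" using eps by (auto simp: e_def)
  define N where "N = n / r + e"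
  have "s * N \<le> s * (\<delta> / s)" using e(3) s by (intro mult_left_mono) (auto simp: N_def)
  hence sN: "s * N \<le> \<delta>" using s by simp
  \<comment> \<open>Because \<open>r <= 1\<close>, the condition \<open>N > n / r\<close> contains
    the condition \<open>N > n\<close> of \<open>phase_symbol\<close>.\<close>
  have "n * r \<le> n * 1" using n r by (intro mult_left_mono) auto
  hence "n \<le> n / r" using r by (simp add: field_simps)
  hence N: "n < N" using e(1) by (simp add: N_def)
  have N0: "0 \<le> N" using N n by linarith
  have \<delta>0: "0 \<le> \<delta>" using sN N0 s order_trans[of 0 "s * N" \<delta>] by simp
  define a where "a j \<xi> = complex_of_real (jbr \<xi> powr (- s) * pdiff j \<mu> \<xi>)" for j \<xi>
  have W: "in_W \<phi> top top (n / r + \<epsilon>) (a j)" for j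
    using hyp by (simp add: n_def r_def m_def a_def[abs_def])
  have Ne: "n < n / r + \<epsilon>" "N \<le> n / r + \<epsilon>" "real CARD('n) < n / r + \<epsilon>"
    using \<open>n \<le> n / r\<close> eps e(2) n_def by (simp_all add: N_def)
  obtain z where z: "\<phi> z \<noteq> 0" using window(2) by blast
  have \<phi>_cont: "continuous_on UNIV \<phi>" by (rule schwartz_continuous[OF window(1)])
  have acont: "continuous_on UNIV (a j)" for j
    using C1(2) unfolding a_def by (intro continuous_intros) auto
  interpret phase_symbol \<mu> s N
  proof
    show "0 \<le> s" using s by simp
    show "real CARD('n) < N" using N by (simp add: n_def)
    show "((\<lambda>t. \<mu> (x + t *\<^sub>R axis j 1)) has_real_derivative pdiff j \<mu> x) (at 0)" for j x
    proof -
      have "\<mu> differentiable at (x + 0 *\<^sub>R axis j 1)" using C1(1) by blast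
      hence "(\<mu> \<circ> (\<lambda>t. x + t *\<^sub>R axis j 1)) differentiable at 0"
        by (intro differentiable_chain_at) (auto intro!: derivative_intros)
      thus ?thesis
        unfolding has_real_derivative_iff_has_vector_derivative pdiff_def vector_derivative_works[symmetric] comp_def .
    qed
    show "continuous_on UNIV \<mu>"
      using C1(1) by (intro continuous_at_imp_continuous_on ballI differentiable_imp_continuous_within) auto
    show "continuous_on UNIV (pdiff j \<mu>)" for j using C1(2) by blast
    show "\<exists>C. \<forall>x. \<bar>jbr x powr (- s) * pdiff j \<mu> x\<bar> \<le> C" for j
    proof -
      obtain C where "\<And>\<eta>. norm (a j \<eta>) \<le> C"
        using in_W_top_bounded[OF W Ne(3) acont \<phi>_cont z, of j] by blast
      thus ?thesis unfolding a_def norm_of_real by blast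
    qed
    show "\<exists>C>0. \<forall>u y. norm (fourier (\<lambda>\<eta>. complex_of_real (jbr \<eta> powr (- s) * pdiff j \<mu> \<eta>) * cgauss b (\<eta> - u)) y)
        \<le> C * jbr y powr (-N)" if b: "0 < b" for j b
    proof -
      obtain C where C: "0 < C"
        "\<And>u y. norm (fourier (\<lambda>\<eta>. a j \<eta> * cgauss b (\<eta> - u)) y) \<le> C * jbr y powr (-(n / r + \<epsilon>))"
        by (rule in_W_top_gauss_window[OF W Ne(3) acont window(1) z b, of j]; rule that; assumption)
      \<comment> \<open>The change of window is carried out at the full order
        \<open>n / r + \<epsilon>\<close> of the hypothesis; the order is lowered to
        \<open>N\<close> afterwards.\<close>
      have "C * jbr y powr (-(n / r + \<epsilon>)) \<le> C * jbr y powr (-N)" for y :: "real^'n"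
        using C(1) Ne(2) by (intro mult_left_mono jbr_powr_mono) auto
      hence "norm (fourier (\<lambda>\<eta>. a j \<eta> * cgauss b (\<eta> - u)) y) \<le> C * jbr y powr (-N)" for u y
        using C(2) order_trans by blast
      thus ?thesis using C(1) unfolding a_def by blast
    qed
  qed
  \<comment> \<open>The frequency decay is as large as desired because the window is Schwartz; this
    choice gives \<open>\<delta> <= L\<close> and \<open>L * r > n\<close>, so that the r-th power
    of the weight is integrable.\<close>
  define L where "L = \<delta> + (n + 1) / r"
  have L: "\<delta> \<le> L" using n r by (simp add: L_def)
  obtain C where C: "0 < C"
    "\<And>f x \<xi>. schwartz f \<Longrightarrow> enn_powr (ennreal (norm (stft \<phi> (fmult \<mu> f) x \<xi>))) r \<le>
      ennreal C * (\<integral>\<^sup>+w. ennreal (jbr w powr (-(L * r))) * (\<integral>\<^sup>+z. ennreal (jbr z powr (-(N * r))) *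
        ennreal ((norm (stft \<phi> f (x - z) (\<xi> - w)) * jbr (\<xi> - w) powr \<delta>) powr r) \<partial>lborel) \<partial>lborel)"
    using stft_fmult_powr_bound[OF window(1) z r \<delta>0 sN L] by blast
  define l k where "l w = C * jbr w powr (-(L * r))" and "k w = jbr w powr (-(N * r))" for w :: "real^'n"
  have lk: "0 \<le> l w" "0 \<le> k w" for w using C(1) by (auto simp: l_def k_def)
  have [measurable]: "l \<in> borel_measurable borel" "k \<in> borel_measurable borel" unfolding l_def k_def by measurable
  have "L * r = \<delta> * r + (n + 1) / r * r" by (simp only: L_def distrib_right)
  moreover have "(n + 1) / r * r = n + 1" "0 \<le> \<delta> * r" using r \<delta>0 by simp_all
  ultimately have "n < L * r" by linarith
  hence lint: "integrable lborel l" unfolding l_def by (intro integrable_mult_right integrable_jbr_powr) (simp add: n_def)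
  have "n < N * r" using e(1) r by (simp add: N_def distrib_right)
  hence kint: "integrable lborel k" unfolding k_def by (intro integrable_jbr_powr) (simp add: n_def)
  define D where "D = (LINT w|lborel. l w) * (LINT w|lborel. k w)"
  have D0: "0 \<le> D" unfolding D_def using lk by (intro mult_nonneg_nonneg integral_nonneg_AE) auto
  have D: "(\<integral>\<^sup>+w. ennreal (l w) \<partial>lborel) * (\<integral>\<^sup>+w. ennreal (k w) \<partial>lborel) = ennreal D"
    unfolding D_def using lk lint kint by (simp add: nn_integral_eq_integral ennreal_mult integral_nonneg_AE)
  \<comment> \<open>Since \<open>r\<close> is the minimum of \<open>1\<close>, \<open>p\<close> and
    \<open>q\<close>, dividing by it lifts both exponents, infinite ones included, into the range of
    Minkowski's inequality.\<close>
  have PQ: "1 \<le> p / ennreal r" "1 \<le> q / ennreal r"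
  proof -
    have "m / m = 1" using m by (simp add: ennreal_divide_self less_top)
    thus "1 \<le> p / ennreal r" "1 \<le> q / ennreal r"
      using divide_right_mono_ennreal[OF m(3), of m] divide_right_mono_ennreal[OF m(4), of m] by (simp_all add: rm)
  qed
  have "wnorm \<phi> p q 0 (fmult \<mu> f) \<le> ennreal (D powr (1 / r)) * wnorm \<phi> p q \<delta> f" if f: "schwartz f" for f
  proof -
    have [measurable]: "\<phi> \<in> borel_measurable borel" "f \<in> borel_measurable borel" "fmult \<mu> f \<in> borel_measurable borel"
      using \<phi>_cont schwartz_continuous[OF f] continuous_fmult[OF f] by (auto simp: borel_measurable_continuous_onI)
    define G H where "G x \<xi> = ennreal (norm (stft \<phi> (fmult \<mu> f) x \<xi>))"
      and "H x \<xi> = ennreal (norm (stft \<phi> f x \<xi>) * jbr \<xi> powr \<delta>)" for x \<xi>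
    have Gm [measurable]: "(\<lambda>(x, \<xi>). G x \<xi>) \<in> borel_measurable (borel \<Otimes>\<^sub>M borel)"
      using measurable_stft[of \<phi> "fmult \<mu> f"] unfolding G_def split_beta by measurable
    have Hm [measurable]: "(\<lambda>(x, \<xi>). H x \<xi>) \<in> borel_measurable (borel \<Otimes>\<^sub>M borel)"
      using measurable_stft[of \<phi> f] unfolding H_def split_beta by measurable
    have Gx [measurable]: "G x \<in> borel_measurable borel" for x by measurable
    have Hx [measurable]: "H x \<in> borel_measurable borel" for x by measurable
    have wG: "wnorm \<phi> p q 0 (fmult \<mu> f) = lpnorm p (\<lambda>x. lpnorm q (G x))"
      by (simp add: wnorm_def G_def[abs_def])
    have wH: "wnorm \<phi> p q \<delta> f = lpnorm p (\<lambda>x. lpnorm q (H x))"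
      by (simp add: wnorm_def H_def[abs_def])
    have powr_norm: "lpnorm (p / ennreal r) (\<lambda>x. lpnorm (q / ennreal r) (\<lambda>\<xi>. enn_powr (U x \<xi>) r)) = enn_powr (lpnorm p (\<lambda>x. lpnorm q (U x))) r"
      if U [measurable]: "(\<lambda>(x, \<xi>). U x \<xi>) \<in> borel_measurable (borel \<Otimes>\<^sub>M borel)" for U :: "real^'n \<Rightarrow> real^'n \<Rightarrow> ennreal"
    proof -
      have [measurable]: "U x \<in> borel_measurable borel" for x by measurable
      have "(\<lambda>x. lpnorm q (U x)) \<in> borel_measurable borel" by (rule measurable_lpnorm[OF U])
      thus ?thesis using pq r by (simp add: lpnorm_powr)
    qed
    have "lpnorm (p / ennreal r) (\<lambda>x. lpnorm (q / ennreal r) (\<lambda>\<xi>. enn_powr (G x \<xi>) r))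
      \<le> (\<integral>\<^sup>+w. ennreal (l w) \<partial>lborel) * (\<integral>\<^sup>+w. ennreal (k w) \<partial>lborel) *
        lpnorm (p / ennreal r) (\<lambda>x. lpnorm (q / ennreal r) (\<lambda>\<xi>. enn_powr (H x \<xi>) r))"
    proof (rule mixed_lpnorm_Young[OF _ _ _ _ lk(2) lk(1) PQ])
      fix x \<xi>
      have "ennreal C * (\<integral>\<^sup>+w. ennreal (jbr w powr (-(L * r))) * (\<integral>\<^sup>+z. ennreal (k z) * enn_powr (H (x - z) (\<xi> - w)) r \<partial>lborel) \<partial>lborel)
          = (\<integral>\<^sup>+w. ennreal C * (ennreal (jbr w powr (-(L * r))) * (\<integral>\<^sup>+z. ennreal (k z) * enn_powr (H (x - z) (\<xi> - w)) r \<partial>lborel)) \<partial>lborel)"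
        by (rule nn_integral_cmult[symmetric]) measurable
      also have "\<dots> = (\<integral>\<^sup>+w. ennreal (l w) * (\<integral>\<^sup>+z. ennreal (k z) * enn_powr (H (x - z) (\<xi> - w)) r \<partial>lborel) \<partial>lborel)"
        using C(1) by (simp add: l_def ennreal_mult mult.assoc)
      finally show "enn_powr (G x \<xi>) r \<le> (\<integral>\<^sup>+w. ennreal (l w) * (\<integral>\<^sup>+z. ennreal (k z) * enn_powr (H (x - z) (\<xi> - w)) r \<partial>lborel) \<partial>lborel)"
        using C(2)[OF f, of x \<xi>] by (simp add: G_def H_def k_def enn_powr_ennreal)
    qed measurable
    hence "enn_powr (wnorm \<phi> p q 0 (fmult \<mu> f)) r \<le> ennreal D * enn_powr (wnorm \<phi> p q \<delta> f) r"
      unfolding D wG wH by (simp only: powr_norm[OF Gm] powr_norm[OF Hm])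
    hence "enn_powr (enn_powr (wnorm \<phi> p q 0 (fmult \<mu> f)) r) (1 / r) \<le> enn_powr (ennreal D * enn_powr (wnorm \<phi> p q \<delta> f) r) (1 / r)"
      using r by (intro enn_powr_mono) auto
    thus ?thesis using r D0 by (simp add: enn_powr_powr enn_powr_mult enn_powr_ennreal)
  qed
  thus ?thesis by blast
qed

end
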